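(* Let $\mathcal{A}$ and $\mathcal{B}$ be infinite $L$-structures such that $\mathcal{A}\not\cong\mathcal{B}$. Then the following are equivalent: (i) $\{\mathcal{A},\mathcal{B}\}\equiv_{tc}\{\omega,\omega^\star\}$; (ii) both $\mathcal{A}$ and $\mathcal{B}$ are computably presentable, $\mathcal{A}\equiv_1\mathcal{B}$, and both $\Sigma^c_2\text{-}Th(\mathcal{A})\setminus\Sigma^c_2\text{-}Th(\mathcal{B})\neq\emptyset$ and $\Sigma^c_2\text{-}Th(\mathcal{B})\setminus\Sigma^c_2\text{-}Th(\mathcal{A})\neq\emptyset$.
   Context: All structures are in computable languages with domains contained in $\omega$; a class of structures is identified with the class of all isomorphic copies (with domain $\subseteq\omega$) of its members, all in the same language. A Turing computable embedding of a class $\mathcal{K}_0$ into a class $\mathcal{K}_1$ is a Turing operator $\Phi$ such that for every $\mathcal{A}\in\mathcal{K}_0$, $\Phi^{D(\mathcal{A})}$ (with oracle the atomic diagram $D(\mathcal{A})$) is the characteristic function of the atomic diagram of a structure $\Phi(\mathcal{A})\in\mathcal{K}_1$, and for all $\mathcal{A},\mathcal{B}\in\mathcal{K}_0$, $\mathcal{A}\cong\mathcal{B}$ iff $\Phi(\mathcal{A})\cong\Phi(\mathcal{B})$. We write $\mathcal{K}_0\leq_{tc}\mathcal{K}_1$ if such $\Phi$ exists, and $\mathcal{K}_0\equiv_{tc}\mathcal{K}_1$ if $\mathcal{K}_0\leq_{tc}\mathcal{K}_1$ and $\mathcal{K}_1\leq_{tc}\mathcal{K}_0$; $\{\mathcal{A},\mathcal{B}\}$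 denotes the class of all copies of $\mathcal{A}$ and of $\mathcal{B}$. $\omega$ is the order type of the natural numbers and $\omega^\star$ its reverse. $\mathcal{A}\equiv_1\mathcal{B}$ means $\mathcal{A}$ and $\mathcal{B}$ satisfy the same first-order existential sentences. A $\Sigma^c_2$ (computable $\Sigma_2$) sentence is a computably enumerable disjunction of sentences of the form $\exists\bar x\bigwedge_{i}\forall\bar y_i\,\psi_i(\bar x,\bar y_i)$, where each conjunction is computably enumerable and the $\psi_i$ are finitary quantifier-free formulas; $\Sigma^c_2\text{-}Th(\mathcal{S})$ is the set of $\Sigma^c_2$ sentences true in $\mathcal{S}$. *)

theory Defs
  imports Main "HOL-Library.Nat_Bijection"
begin

section \<open>Oracle computability\<close>

text \<open>Programs for functions that are partial recursive relative to an oracle. A program acts on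
  argument lists of any length; unused trailing arguments are ignored.\<close>

datatype prog =
    Zero
  | Succ
  | Proj nat
  | Query
  | Comp prog "prog list"
  | PRec prog prog
  | Mu prog

primrec eval :: "prog \<Rightarrow> nat set \<Rightarrow> nat list \<Rightarrow> nat option" where
  "eval Zero X xs = Some 0"
| "eval Succ X xs = (case xs of [] \<Rightarrow> None | x # _ \<Rightarrow> Some (Suc x))"
| "eval (Proj i) X xs = (if i < length xs then Some (xs ! i) else None)"
| "eval Query X xs = (case xs of [] \<Rightarrow> None | x # _ \<Rightarrow> Some (of_bool (x \<in> X)))"
| "eval (Comp f gs) X xs =
     (let rs = map (\<lambda>g. eval g X xs) gs
      in if None \<in> set rs then None else eval f X (map the rs))"
| "eval (PRec f g) X xs =
     (case xs of [] \<Rightarrow> None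
      | k # ys \<Rightarrow> rec_nat (eval f X ys) (\<lambda>m r. Option.bind r (\<lambda>y. eval g X (m # y # ys))) k)"
| "eval (Mu f) X xs =
     (if \<exists>k. eval f X (k # xs) = Some 0 \<and> (\<forall>m<k. eval f X (m # xs) \<noteq> None)
      then Some (LEAST k. eval f X (k # xs) = Some 0) else None)"

definition computes_set :: "prog \<Rightarrow> nat set \<Rightarrow> nat set \<Rightarrow> bool" where
  "computes_set p X Y \<longleftrightarrow> (\<forall>k. eval p X [k] = Some (of_bool (k \<in> Y)))"

definition computable_set :: "nat set \<Rightarrow> bool" where
  "computable_set Y \<longleftrightarrow> (\<exists>p. computes_set p {} Y)"

definition computable_fun_on :: "nat set \<Rightarrow> (nat \<Rightarrow> nat) \<Rightarrow> bool" where
  "computable_fun_on Y f \<longleftrightarrow> (\<exists>p. \<forall>k\<in>Y. eval p {} [k] = Some (f k))"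

definition ce_set :: "prog \<Rightarrow> nat set" where
  "ce_set p = {k. eval p {} [k] \<noteq> None}"

primrec prog_code :: "prog \<Rightarrow> nat" where
  "prog_code Zero = prod_encode (0, 0)"
| "prog_code Succ = prod_encode (1, 0)"
| "prog_code (Proj i) = prod_encode (2, i)"
| "prog_code Query = prod_encode (3, 0)"
| "prog_code (Comp f gs) =
     prod_encode (4, prod_encode (prog_code f, list_encode (map prog_code gs)))"
| "prog_code (PRec f g) = prod_encode (5, prod_encode (prog_code f, prog_code g))"
| "prog_code (Mu f) = prod_encode (6, prog_code f)"


section \<open>Languages, quantifier-free formulas and structures\<close>

text \<open>Symbols are natural numbers; constants are function symbols of arity 0. Arities of numbers
  that are not symbols of the language are irrelevant.\<close>

record lang =
  rel_syms :: "nat set"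
  rel_arity :: "nat \<Rightarrow> nat"
  fun_syms :: "nat set"
  fun_arity :: "nat \<Rightarrow> nat"

definition computable_lang :: "lang \<Rightarrow> bool" where
  "computable_lang L \<longleftrightarrow>
     computable_set (rel_syms L) \<and> computable_fun_on (rel_syms L) (rel_arity L) \<and>
     computable_set (fun_syms L) \<and> computable_fun_on (fun_syms L) (fun_arity L)"

datatype tm = Var nat | Fn nat "tm list"

datatype qf =
    Rel nat "tm list"
  | Eq tm tm
  | Neg qf
  | Conj qf qf
  | Disj qf qf

primrec tm_code :: "tm \<Rightarrow> nat" where
  "tm_code (Var i) = prod_encode (0, i)"
| "tm_code (Fn f ts) = prod_encode (1, prod_encode (f, list_encode (map tm_code ts)))"

primrec qf_code :: "qf \<Rightarrow> nat" where
  "qf_code (Rel r ts) = prod_encode (0, prod_encode (r, list_encode (map tm_code ts)))"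
| "qf_code (Eq s t) = prod_encode (1, prod_encode (tm_code s, tm_code t))"
| "qf_code (Neg \<phi>) = prod_encode (2, qf_code \<phi>)"
| "qf_code (Conj \<phi> \<psi>) = prod_encode (3, prod_encode (qf_code \<phi>, qf_code \<psi>))"
| "qf_code (Disj \<phi> \<psi>) = prod_encode (4, prod_encode (qf_code \<phi>, qf_code \<psi>))"

primrec tm_vars :: "tm \<Rightarrow> nat set" where
  "tm_vars (Var i) = {i}"
| "tm_vars (Fn f ts) = \<Union> (set (map tm_vars ts))"

primrec qf_vars :: "qf \<Rightarrow> nat set" where
  "qf_vars (Rel r ts) = \<Union> (set (map tm_vars ts))"
| "qf_vars (Eq s t) = tm_vars s \<union> tm_vars t"
| "qf_vars (Neg \<phi>) = qf_vars \<phi>"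
| "qf_vars (Conj \<phi> \<psi>) = qf_vars \<phi> \<union> qf_vars \<psi>"
| "qf_vars (Disj \<phi> \<psi>) = qf_vars \<phi> \<union> qf_vars \<psi>"

primrec wf_tm :: "lang \<Rightarrow> tm \<Rightarrow> bool" where
  "wf_tm L (Var i) = True"
| "wf_tm L (Fn f ts) = (f \<in> fun_syms L \<and> length ts = fun_arity L f \<and> list_all (wf_tm L) ts)"

primrec wf_qf :: "lang \<Rightarrow> qf \<Rightarrow> bool" where
  "wf_qf L (Rel r ts) = (r \<in> rel_syms L \<and> length ts = rel_arity L r \<and> list_all (wf_tm L) ts)"
| "wf_qf L (Eq s t) = (wf_tm L s \<and> wf_tm L t)"
| "wf_qf L (Neg \<phi>) = wf_qf L \<phi>"
| "wf_qf L (Conj \<phi> \<psi>) = (wf_qf L \<phi> \<and> wf_qf L \<psi>)"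
| "wf_qf L (Disj \<phi> \<psi>) = (wf_qf L \<phi> \<and> wf_qf L \<psi>)"

text \<open>The interpretations are meaningful only for symbols of the language applied to argument
  lists of the right length from the universe; other values are ignored by all notions below.\<close>

record struct =
  univ :: "nat set"
  rel_int :: "nat \<Rightarrow> nat list \<Rightarrow> bool"
  fun_int :: "nat \<Rightarrow> nat list \<Rightarrow> nat"

definition tuples :: "struct \<Rightarrow> nat \<Rightarrow> nat list set" where
  "tuples S n = {xs. length xs = n \<and> set xs \<subseteq> univ S}"

definition is_structure :: "lang \<Rightarrow> struct \<Rightarrow> bool" where
  "is_structure L S \<longleftrightarrow>
     (\<forall>f\<in>fun_syms L. \<forall>xs\<in>tuples S (fun_arity L f). fun_int S f xs \<in> univ S)"

definition isomorphic :: "lang \<Rightarrow> struct \<Rightarrow> struct \<Rightarrow> bool" where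
  "isomorphic L S T \<longleftrightarrow>
     (\<exists>h. bij_betw h (univ S) (univ T) \<and>
        (\<forall>r\<in>rel_syms L. \<forall>xs\<in>tuples S (rel_arity L r).
           rel_int S r xs \<longleftrightarrow> rel_int T r (map h xs)) \<and>
        (\<forall>f\<in>fun_syms L. \<forall>xs\<in>tuples S (fun_arity L f).
           h (fun_int S f xs) = fun_int T f (map h xs)))"

primrec tm_val :: "struct \<Rightarrow> (nat \<Rightarrow> nat) \<Rightarrow> tm \<Rightarrow> nat" where
  "tm_val S v (Var i) = v i"
| "tm_val S v (Fn f ts) = fun_int S f (map (tm_val S v) ts)"

primrec qf_holds :: "struct \<Rightarrow> (nat \<Rightarrow> nat) \<Rightarrow> qf \<Rightarrow> bool" where
  "qf_holds S v (Rel r ts) = rel_int S r (map (tm_val S v) ts)"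
| "qf_holds S v (Eq s t) = (tm_val S v s = tm_val S v t)"
| "qf_holds S v (Neg \<phi>) = (\<not> qf_holds S v \<phi>)"
| "qf_holds S v (Conj \<phi> \<psi>) = (qf_holds S v \<phi> \<and> qf_holds S v \<psi>)"
| "qf_holds S v (Disj \<phi> \<psi>) = (qf_holds S v \<phi> \<or> qf_holds S v \<psi>)"


section \<open>Atomic diagrams and Turing computable embeddings\<close>

fun atomic :: "qf \<Rightarrow> bool" where
  "atomic (Rel r ts) = True"
| "atomic (Eq s t) = True"
| "atomic _ = False"

definition literal :: "qf \<Rightarrow> bool" where
  "literal \<phi> \<longleftrightarrow> atomic \<phi> \<or> (\<exists>\<psi>. atomic \<psi> \<and> \<phi> = Neg \<psi>)"

text \<open>The variable \<open>Var a\<close> serves as the constant naming the element \<open>a\<close> of the universe, so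
  sentences with names for elements are formulas evaluated under the identity assignment. The
  universe can be read off from the diagram, since it contains the code of
  \<open>Eq (Var a) (Var a)\<close> exactly for the elements \<open>a\<close>.\<close>

definition diagram :: "lang \<Rightarrow> struct \<Rightarrow> nat set" where
  "diagram L S =
     qf_code ` {\<phi>. wf_qf L \<phi> \<and> literal \<phi> \<and> qf_vars \<phi> \<subseteq> univ S \<and> qf_holds S (\<lambda>a. a) \<phi>}"

definition copies :: "lang \<Rightarrow> struct \<Rightarrow> struct set" where
  "copies L S = {T. is_structure L T \<and> isomorphic L T S}"

definition pair_class :: "lang \<Rightarrow> struct \<Rightarrow> struct \<Rightarrow> struct set" where
  "pair_class L S T = copies L S \<union> copies L T"

definition computably_presentable :: "lang \<Rightarrow> struct \<Rightarrow> bool" where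
  "computably_presentable L S \<longleftrightarrow> (\<exists>T\<in>copies L S. computable_set (diagram L T))"

text \<open>A structure is determined by its diagram up to irrelevant values of its interpretations,
  so \<open>F\<close> below is essentially determined by the program \<open>p\<close> of the Turing operator.\<close>

definition tc_le :: "lang \<Rightarrow> struct set \<Rightarrow> lang \<Rightarrow> struct set \<Rightarrow> bool" where
  "tc_le L0 K0 L1 K1 \<longleftrightarrow>
     (\<exists>p F. (\<forall>S\<in>K0. F S \<in> K1 \<and> computes_set p (diagram L0 S) (diagram L1 (F S))) \<and>
            (\<forall>S\<in>K0. \<forall>T\<in>K0. isomorphic L0 S T \<longleftrightarrow> isomorphic L1 (F S) (F T)))"

definition tc_equiv :: "lang \<Rightarrow> struct set \<Rightarrow> lang \<Rightarrow> struct set \<Rightarrow> bool" where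
  "tc_equiv L0 K0 L1 K1 \<longleftrightarrow> tc_le L0 K0 L1 K1 \<and> tc_le L1 K1 L0 K0"

text \<open>The language of orders has a single binary relation symbol, read as \<open>\<le>\<close>.\<close>

definition order_lang :: lang where
  "order_lang = \<lparr>rel_syms = {0}, rel_arity = (\<lambda>_. 2), fun_syms = {}, fun_arity = (\<lambda>_. 0)\<rparr>"

definition omega :: struct where
  "omega = \<lparr>univ = UNIV, rel_int = (\<lambda>_ xs. xs ! 0 \<le> xs ! 1), fun_int = (\<lambda>_ _. 0)\<rparr>"

definition omega_star :: struct where
  "omega_star = \<lparr>univ = UNIV, rel_int = (\<lambda>_ xs. xs ! 1 \<le> xs ! 0), fun_int = (\<lambda>_ _. 0)\<rparr>"


section \<open>Existential and computable \<open>\<Sigma>\<^sub>2\<close> sentences\<close>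

text \<open>The pair \<open>(n, \<psi>)\<close> stands for the existential sentence that prefixes \<open>\<psi>\<close> with an existential
  quantifier over each of the variables \<open>Var 0, \<dots>, Var (n - 1)\<close>.\<close>

definition ex_sentences :: "lang \<Rightarrow> (nat \<times> qf) set" where
  "ex_sentences L = {(n, \<psi>). wf_qf L \<psi> \<and> qf_vars \<psi> \<subseteq> {..<n}}"

definition ex_holds :: "struct \<Rightarrow> nat \<times> qf \<Rightarrow> bool" where
  "ex_holds S \<sigma> \<longleftrightarrow> (case \<sigma> of (n, \<psi>) \<Rightarrow> \<exists>xs\<in>tuples S n. qf_holds S ((!) xs) \<psi>)"

definition equiv1 :: "lang \<Rightarrow> struct \<Rightarrow> struct \<Rightarrow> bool" where
  "equiv1 L S T \<longleftrightarrow> (\<forall>\<sigma>\<in>ex_sentences L. ex_holds S \<sigma> \<longleftrightarrow> ex_holds T \<sigma>)"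

text \<open>An infinitary \<open>\<Sigma>\<^sub>2\<close> sentence is the set of its disjuncts. A disjunct \<open>(n, C)\<close> quantifies
  existentially over \<open>Var 0, \<dots>, Var (n - 1)\<close> in front of the conjunction \<open>C\<close>; a conjunct
  \<open>(m, \<psi>)\<close> in \<open>C\<close> quantifies universally over \<open>Var n, \<dots>, Var (n + m - 1)\<close> in front of \<open>\<psi>\<close>.\<close>

type_synonym sigma2 = "(nat \<times> (nat \<times> qf) set) set"

definition sigma2_holds :: "struct \<Rightarrow> sigma2 \<Rightarrow> bool" where
  "sigma2_holds S \<Phi> \<longleftrightarrow>
     (\<exists>(n, C)\<in>\<Phi>. \<exists>xs\<in>tuples S n. \<forall>(m, \<psi>)\<in>C. \<forall>ys\<in>tuples S m. qf_holds S ((!) (xs @ ys)) \<psi>)"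

definition wf_sigma2 :: "lang \<Rightarrow> sigma2 \<Rightarrow> bool" where
  "wf_sigma2 L \<Phi> \<longleftrightarrow> (\<forall>(n, C)\<in>\<Phi>. \<forall>(m, \<psi>)\<in>C. wf_qf L \<psi> \<and> qf_vars \<psi> \<subseteq> {..<n + m})"

definition ce_conj :: "prog \<Rightarrow> (nat \<times> qf) set" where
  "ce_conj p = {(m, \<psi>). prod_encode (m, qf_code \<psi>) \<in> ce_set p}"

text \<open>As usual for computable infinitary formulas, the disjunction is computably enumerable in the
  sense that a c.e. set of codes for the disjuncts exists, where \<open>(n, C)\<close> is coded by \<open>n\<close> and a
  c.e. index of \<open>C\<close>.\<close>

definition ce_disj :: "prog \<Rightarrow> sigma2" where
  "ce_disj q = {(n, ce_conj p) | n p. prod_encode (n, prog_code p) \<in> ce_set q}"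

definition sigma2c_sentences :: "lang \<Rightarrow> sigma2 set" where
  "sigma2c_sentences L = {\<Phi>. (\<exists>q. \<Phi> = ce_disj q) \<and> wf_sigma2 L \<Phi>}"

definition sigma2c_Th :: "lang \<Rightarrow> struct \<Rightarrow> sigma2 set" where
  "sigma2c_Th L S = {\<Phi> \<in> sigma2c_sentences L. sigma2_holds S \<Phi>}"

end

theory Submission
  imports Defs "HOL-Library.Infinite_Set"
begin

text \<open>(i) \<open>\<Longrightarrow>\<close> (ii): the embedding of the orders computes presentations from computable copies of
  \<open>\<omega>\<close> and \<open>\<omega>\<^sup>*\<close>, and since every finite part of the one order extends to the other, existential
  sentences transfer. For the other embedding, say with \<open>A\<close> going to \<open>\<omega>\<close>, the sentence separating \<open>A\<close>
  from \<open>B\<close> says that some finite part of the diagram puts an element into the image such that no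
  further finite part puts anything below it. It fails in \<open>B\<close>, whose image has no least element, and
  if it failed in \<open>A\<close> then a sufficiently generic copy of \<open>A\<close> would have an image without least element.

  (ii) \<open>\<Longrightarrow>\<close> (i): the two \<open>\<Sigma>\<^sub>2\<close> sentences, respectively the existence of a least or of a greatest
  element, let one guess in the limit which of the two structures is given. With \<open>A \<equiv>\<^sub>1 B\<close>, or trivially
  for the orders, whatever finite part was built on a wrong guess can be continued to a copy of either target.\<close>

text \<open>An operator is specified only on whole copies, while sentences and stages see finite
  parts. Certificates mediate: a finite list fixes a computation together with the oracle answers it
  relies on. Its code exceeds every number queried, and the code of a formula bounds its variables,
  so \<open>n > c\<close> named elements settle all that certificate \<open>c\<close> asks.
  Genericity enters because the image of one particular copy may have a least element although
  another copy of the same structure, continuing the same finite part, puts something below it. The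
  generic copy meets for each \<open>a\<close> the requirement that something is put below
  \<open>a\<close> or that \<open>a\<close> is kept out of the image for good. Effectiveness is a
  separate obstacle: the separating sentence must be enumerated through codes of well-formed
  formulas. The diagram of a computable presentation decides well-formedness of literals, once a
  fixed element is substituted for all variables. An embedding only sends the two structures to
  different orders. A flag for the orientation lets one sentence serve both assignments; exchanging
  the structures and negating the flag gives the other separation.\<close>

section \<open>A calculus of oracle computable functions\<close>

text \<open>Computable functions take a single argument, which packs all variables in scope by iterated
  pairing. The rules \<open>cintro\<close> follow the syntax of the function body; a binder pushes its variable
  as a new first component.\<close>

definition ocomp :: "(nat set \<Rightarrow> nat \<Rightarrow> nat) \<Rightarrow> bool" where
  "ocomp f \<longleftrightarrow> (\<exists>p. \<forall>X z. eval p X [z] = Some (f X z))"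

definition odec :: "(nat set \<Rightarrow> nat \<Rightarrow> bool) \<Rightarrow> bool" where
  "odec P \<longleftrightarrow> ocomp (\<lambda>X z. of_bool (P X z))"

definition ocompl :: "(nat set \<Rightarrow> nat \<Rightarrow> nat list) \<Rightarrow> bool" where
  "ocompl f \<longleftrightarrow> ocomp (\<lambda>X z. list_encode (f X z))"

definition pfst :: "nat \<Rightarrow> nat" where "pfst z = fst (prod_decode z)"
definition psnd :: "nat \<Rightarrow> nat" where "psnd z = snd (prod_decode z)"

lemma pfst_prod_encode [simp]: "pfst (prod_encode (a, b)) = a"
  and psnd_prod_encode [simp]: "psnd (prod_encode (a, b)) = b"
  by (simp_all add: pfst_def psnd_def)

lemma prod_encode_pfst_psnd [simp]: "prod_encode (pfst z, psnd z) = z"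
  by (simp add: pfst_def psnd_def)

lemma pfst_le: "pfst z \<le> z" and psnd_le: "psnd z \<le> z"
  by (metis le_prod_encode_1 prod_encode_pfst_psnd, metis le_prod_encode_2 prod_encode_pfst_psnd)

named_theorems cintro

subsection \<open>Pairing\<close>

definition "add_prog = PRec (Proj 0) (Comp Succ [Proj 1])"
definition "tri_prog = PRec Zero (Comp add_prog [Comp Succ [Proj 0], Proj 1])"
definition "pred_prog = PRec Zero (Proj 0)"
text \<open>Recursion runs over the first argument, so the subtrahend comes first.\<close>

definition "sub_prog = PRec (Proj 0) (Comp pred_prog [Proj 1])"
definition "isz_prog = PRec (Comp Succ [Zero]) Zero"
definition "pair_prog = Comp add_prog [Comp tri_prog [add_prog], Proj 0]"

lemma eval_add_prog [simp]: "eval add_prog X (k # y # ys) = Some (k + y)"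
  unfolding add_prog_def by (induction k) auto

lemma eval_tri_prog [simp]: "eval tri_prog X [k] = Some (triangle k)"
  unfolding tri_prog_def by (induction k) auto

lemma eval_pred_prog [simp]: "eval pred_prog X [k] = Some (k - 1)"
  unfolding pred_prog_def by (induction k) auto

lemma eval_sub_prog [simp]: "eval sub_prog X [k, y] = Some (y - k)"
  unfolding sub_prog_def by (induction k) auto

lemma eval_isz_prog [simp]: "eval isz_prog X [k] = Some (of_bool (k = 0))"
  unfolding isz_prog_def by (induction k) auto

lemma eval_pair_prog [simp]: "eval pair_prog X (m # n # ys) = Some (prod_encode (m, n))"
  by (simp only: pair_prog_def prod_encode_def prod.case eval.simps list.map Let_def list.set
      eval_add_prog eval_tri_prog) simp

text \<open>As \<open>prod_encode (m, n)\<close> is \<open>triangle (m + n) + m\<close>, inverting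
  it means finding the diagonal \<open>m + n\<close>, the largest \<open>w\<close> with
  \<open>triangle w \<le> z\<close>. It grows by one exactly when \<open>Suc z\<close> reaches the
  next triangular number, a primitive recursion.\<close>

definition diag_index :: "nat \<Rightarrow> nat" where "diag_index z = pfst z + psnd z"

definition "diag_prog =
  PRec Zero (Comp add_prog
    [Comp isz_prog [Comp sub_prog [Comp Succ [Proj 0], Comp tri_prog [Comp Succ [Proj 1]]]], Proj 1])"

lemma diag_index_bounds: "triangle (diag_index z) + pfst z = z" "z < triangle (Suc (diag_index z))"
proof -
  have *: "prod_encode (pfst z, psnd z) = z" by (rule prod_encode_pfst_psnd)
  show 1: "triangle (diag_index z) + pfst z = z"
    using * by (simp only: prod_encode_def diag_index_def) simp
  have "pfst z \<le> diag_index z" by (simp add: diag_index_def)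
  then show "z < triangle (Suc (diag_index z))"
    using 1 by (simp only: triangle_Suc)
qed

lemma triangle_mono: "m \<le> n \<Longrightarrow> triangle m \<le> triangle n"
  by (induction n) (auto simp: le_Suc_eq)

lemma diag_index_unique:
  assumes "triangle w \<le> z" "z < triangle (Suc w)" shows "diag_index z = w"
proof (rule ccontr)
  assume "diag_index z \<noteq> w"
  then consider "Suc w \<le> diag_index z" | "Suc (diag_index z) \<le> w" by linarith
  then show False
  proof cases
    case 1
    then show False using diag_index_bounds(1)[of z] triangle_mono[OF 1] assms by linarith
  next
    case 2
    then show False using diag_index_bounds(2)[of z] triangle_mono[OF 2] assms by linarith
  qed
qed

lemma diag_index_Suc:
  "diag_index (Suc z) = diag_index z + of_bool (triangle (Suc (diag_index z)) - Suc z = 0)"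
proof (cases "Suc z = triangle (Suc (diag_index z))")
  case True
  then have "diag_index (Suc z) = Suc (diag_index z)"
    using triangle_Suc[of "Suc (diag_index z)"] by (intro diag_index_unique) linarith+
  with True show ?thesis by simp
next
  case False
  then have *: "Suc z < triangle (Suc (diag_index z))"
    using diag_index_bounds(2)[of z] by linarith
  have "diag_index (Suc z) = diag_index z"
    using diag_index_bounds(1)[of z] by (intro diag_index_unique[OF _ *]) linarith
  with * show ?thesis by simp
qed

lemma diag_index_0: "diag_index 0 = 0"
  by (rule diag_index_unique) auto

lemma eval_diag_prog [simp]: "eval diag_prog X [k] = Some (diag_index k)"
  unfolding diag_prog_def
  by (induction k) (auto simp: diag_index_0 diag_index_Suc simp del: triangle_Suc)

definition "fst_prog = Comp sub_prog [Comp tri_prog [diag_prog], Proj 0]"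
definition "snd_prog = Comp sub_prog [fst_prog, diag_prog]"

lemma eval_fst_prog [simp]: "eval fst_prog X [k] = Some (pfst k)"
  unfolding fst_prog_def using diag_index_bounds(1)[of k] by auto

lemma eval_snd_prog [simp]: "eval snd_prog X [k] = Some (psnd k)"
  unfolding snd_prog_def by (auto simp: diag_index_def)

subsection \<open>Closure properties\<close>

lemma ocompI: "(\<And>X z. eval p X [z] = Some (f X z)) \<Longrightarrow> ocomp f"
  by (auto simp: ocomp_def)

lemma ocomp_id [cintro]: "ocomp (\<lambda>X z. z)"
  by (rule ocompI[of "Proj 0"]) simp

lemma ocomp_comp:
  assumes "ocomp f" "ocomp g" shows "ocomp (\<lambda>X z. f X (g X z))"
proof -
  obtain p q where "\<And>X z. eval p X [z] = Some (f X z)" "\<And>X z. eval q X [z] = Some (g X z)"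
    using assms unfolding ocomp_def by blast
  then show ?thesis by (intro ocompI[of "Comp p [q]"]) simp
qed

lemma ocomp_pair [cintro]:
  assumes "ocomp f" "ocomp g" shows "ocomp (\<lambda>X z. prod_encode (f X z, g X z))"
proof -
  obtain p q where "\<And>X z. eval p X [z] = Some (f X z)" "\<And>X z. eval q X [z] = Some (g X z)"
    using assms unfolding ocomp_def by blast
  then show ?thesis by (intro ocompI[of "Comp pair_prog [p, q]"]) simp
qed

lemma ocomp_pfst [cintro]: "ocomp f \<Longrightarrow> ocomp (\<lambda>X z. pfst (f X z))"
  using ocomp_comp[OF ocompI[of fst_prog "\<lambda>X. pfst"]] by simp

lemma ocomp_psnd [cintro]: "ocomp f \<Longrightarrow> ocomp (\<lambda>X z. psnd (f X z))"
  using ocomp_comp[OF ocompI[of snd_prog "\<lambda>X. psnd"]] by simp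

text \<open>Functions of several variables enter the calculus here: computability in one packed
  argument yields computability at arbitrary computable arguments.\<close>

lemma ocomp_comp2:
  assumes "ocomp (\<lambda>X z. f X (pfst z) (psnd z))" "ocomp a" "ocomp b"
  shows "ocomp (\<lambda>X z. f X (a X z) (b X z))"
  using ocomp_comp[OF assms(1) ocomp_pair[OF assms(2,3)]] by simp

lemma ocomp_comp3:
  assumes "ocomp (\<lambda>X z. f X (pfst z) (pfst (psnd z)) (psnd (psnd z)))" "ocomp a" "ocomp b" "ocomp c"
  shows "ocomp (\<lambda>X z. f X (a X z) (b X z) (c X z))"
  using ocomp_comp[OF assms(1) ocomp_pair[OF assms(2) ocomp_pair[OF assms(3,4)]]] by simp

lemma ocomp_Suc [cintro]: "ocomp f \<Longrightarrow> ocomp (\<lambda>X z. Suc (f X z))"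
  using ocomp_comp[OF ocompI[of Succ "\<lambda>X. Suc"]] by simp

lemma ocomp_0: "ocomp (\<lambda>X z. 0)"
  by (rule ocompI[of Zero]) simp

lemma ocomp_const [cintro]: "ocomp (\<lambda>X z. n)"
  by (induction n) (auto intro: ocomp_0 ocomp_Suc)

lemma ocomp_oracle:
  assumes "ocomp f" shows "ocomp (\<lambda>X z. of_bool (f X z \<in> X))"
  using ocomp_comp[OF ocompI[of Query "\<lambda>X z. of_bool (z \<in> X)"] assms] by simp

lemma ocomp_rec_nat [cintro]:
  assumes "ocomp n" "ocomp a" "ocomp (\<lambda>X z. g X (pfst z) (pfst (psnd z)) (psnd (psnd z)))"
  shows "ocomp (\<lambda>X z. rec_nat (a X z) (\<lambda>m r. g X m r z) (n X z))"
proof -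
  obtain pn where pn: "\<And>X z. eval pn X [z] = Some (n X z)"
    using assms(1) unfolding ocomp_def by blast
  obtain pa where pa: "\<And>X z. eval pa X [z] = Some (a X z)"
    using assms(2) unfolding ocomp_def by blast
  obtain pg where pg: "\<And>X z. eval pg X [z] = Some (g X (pfst z) (pfst (psnd z)) (psnd (psnd z)))"
    using assms(3) unfolding ocomp_def by blast
  note p = pn pa pg
  let ?R = "PRec pa (Comp pg [Comp pair_prog [Proj 0, Comp pair_prog [Proj 1, Proj 2]]])"
  have "eval ?R X [k, z] = Some (rec_nat (a X z) (\<lambda>m r. g X m r z) k)" for X k z
    by (induction k) (auto simp: p)
  then show ?thesis by (intro ocompI[of "Comp ?R [pn, Proj 0]"]) (simp add: p)
qed

lemma odec_not [cintro]:
  assumes "odec P" shows "odec (\<lambda>X z. \<not> P X z)"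
proof -
  obtain p where p: "\<And>X z. eval p X [z] = Some (of_bool (P X z))"
    using assms unfolding odec_def ocomp_def by blast
  show ?thesis unfolding odec_def
    by (rule ocompI[of "Comp isz_prog [p]"]) (auto simp: p)
qed

text \<open>\<open>Mu\<close> searches for a zero, hence the negated predicate in the program. As
  \<open>ocomp\<close> describes total functions, a solution must exist for every oracle and
  argument; for this reason \<open>switch\<close> guards its search by an implication.\<close>

lemma ocomp_Least:
  assumes ex: "\<And>X z. \<exists>k. P X k z" and P: "odec (\<lambda>X z. P X (pfst z) (psnd z))"
  shows "ocomp (\<lambda>X z. LEAST k. P X k z)"
proof -
  obtain p where p: "\<And>X z. eval p X [z] = Some (of_bool (\<not> P X (pfst z) (psnd z)))"
    using odec_not[OF P] unfolding odec_def ocomp_def by blast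
  let ?Q = "Comp p [pair_prog]"
  have Q: "eval ?Q X [k, z] = Some (of_bool (\<not> P X k z))" for X k z
    by (simp add: p)
  have "eval (Mu ?Q) X [z] = Some (LEAST k. P X k z)" for X z
    using ex[where X=X and z=z] by (simp add: p)
  then show ?thesis by (rule ocompI)
qed

lemma ocomp_add [cintro]:
  assumes "ocomp f" "ocomp g" shows "ocomp (\<lambda>X z. f X z + g X z)"
proof -
  obtain p q where "\<And>X z. eval p X [z] = Some (f X z)" "\<And>X z. eval q X [z] = Some (g X z)"
    using assms unfolding ocomp_def by blast
  then show ?thesis by (intro ocompI[of "Comp add_prog [p, q]"]) simp
qed

lemma ocomp_diff [cintro]:
  assumes "ocomp f" "ocomp g" shows "ocomp (\<lambda>X z. f X z - g X z)"
proof -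
  obtain p q where "\<And>X z. eval p X [z] = Some (f X z)" "\<And>X z. eval q X [z] = Some (g X z)"
    using assms unfolding ocomp_def by blast
  then show ?thesis by (intro ocompI[of "Comp sub_prog [q, p]"]) simp
qed

lemma odec_eq0: "ocomp f \<Longrightarrow> odec (\<lambda>X z. f X z = 0)"
  unfolding odec_def using ocomp_comp[OF ocompI[of isz_prog "\<lambda>X z. of_bool (z = 0)"]] by simp

lemma odec_cong:
  assumes "odec P" "\<And>X z. P X z = Q X z" shows "odec Q"
proof -
  have "P = Q" using assms(2) by blast
  with assms(1) show ?thesis by simp
qed

lemma ocomp_of_bool [cintro]: "odec P \<Longrightarrow> ocomp (\<lambda>X z. of_bool (P X z))"
  by (simp add: odec_def)

lemma odec_le [cintro]:
  assumes "ocomp f" "ocomp g" shows "odec (\<lambda>X z. f X z \<le> g X z)"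
  by (rule odec_cong[OF odec_eq0[OF ocomp_diff[OF assms]]]) simp

lemma odec_less [cintro]:
  assumes "ocomp f" "ocomp g" shows "odec (\<lambda>X z. f X z < g X z)"
  by (rule odec_cong[OF odec_le[OF ocomp_Suc[OF assms(1)] assms(2)]]) auto

lemma odec_conj [cintro]:
  assumes "odec P" "odec Q" shows "odec (\<lambda>X z. P X z \<and> Q X z)"
  by (rule odec_cong[OF odec_eq0[of "\<lambda>X z. of_bool (\<not> P X z) + of_bool (\<not> Q X z)"]])
    (intro cintro assms, simp)

lemma odec_disj [cintro]:
  assumes "odec P" "odec Q" shows "odec (\<lambda>X z. P X z \<or> Q X z)"
  by (rule odec_cong[of "\<lambda>X z. \<not> (\<not> P X z \<and> \<not> Q X z)"]) (intro cintro assms, simp)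

lemma odec_imp [cintro]:
  assumes "odec P" "odec Q" shows "odec (\<lambda>X z. P X z \<longrightarrow> Q X z)"
  by (rule odec_cong[of "\<lambda>X z. \<not> P X z \<or> Q X z"]) (intro cintro assms, simp)

lemma odec_iff [cintro]:
  assumes "odec P" "odec Q" shows "odec (\<lambda>X z. P X z = Q X z)"
  by (rule odec_cong[of "\<lambda>X z. (P X z \<longrightarrow> Q X z) \<and> (Q X z \<longrightarrow> P X z)"]) (intro cintro assms, blast)

lemma odec_eq [cintro]:
  assumes "ocomp f" "ocomp g" shows "odec (\<lambda>X z. f X z = g X z)"
  by (rule odec_cong[of "\<lambda>X z. f X z \<le> g X z \<and> g X z \<le> f X z"]) (intro cintro assms, auto)

lemma odec_const [cintro]: "odec (\<lambda>X z. b)"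
  unfolding odec_def by (rule ocomp_const)

lemma odec_oracle [cintro]: "ocomp f \<Longrightarrow> odec (\<lambda>X z. f X z \<in> X)"
  unfolding odec_def by (rule ocomp_oracle)

lemma odec_comp: "odec P \<Longrightarrow> ocomp f \<Longrightarrow> odec (\<lambda>X z. P X (f X z))"
  unfolding odec_def by (rule ocomp_comp)

lemma odec_comp2:
  assumes "odec (\<lambda>X z. P X (pfst z) (psnd z))" "ocomp a" "ocomp b"
  shows "odec (\<lambda>X z. P X (a X z) (b X z))"
  using odec_comp[OF assms(1) ocomp_pair[OF assms(2,3)]] by simp

lemma odec_comp3:
  assumes "odec (\<lambda>X z. P X (pfst z) (pfst (psnd z)) (psnd (psnd z)))" "ocomp a" "ocomp b" "ocomp c"
  shows "odec (\<lambda>X z. P X (a X z) (b X z) (c X z))"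
  using odec_comp[OF assms(1) ocomp_pair[OF assms(2) ocomp_pair[OF assms(3,4)]]] by simp

lemma ocomp_If [cintro]:
  assumes "odec P" "ocomp f" "ocomp g" shows "ocomp (\<lambda>X z. if P X z then f X z else g X z)"
proof -
  have "(if P X z then f X z else g X z) =
    rec_nat (g X z) (\<lambda>m r. f X z) (of_bool (P X z))" for X z
    by simp
  moreover have "ocomp (\<lambda>X z. rec_nat (g X z) (\<lambda>m r. f X z) (of_bool (P X z)))"
    by (intro cintro assms ocomp_comp[OF assms(2)])
  ultimately show ?thesis by simp
qed

lemma odec_If [cintro]:
  assumes "odec P" "odec Q" "odec R" shows "odec (\<lambda>X z. if P X z then Q X z else R X z)"
  by (rule odec_cong[of "\<lambda>X z. (P X z \<longrightarrow> Q X z) \<and> (\<not> P X z \<longrightarrow> R X z)"]) (intro cintro assms, simp)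

lemma odec_ball_less [cintro]:
  assumes "ocomp b" "odec (\<lambda>X z. P X (pfst z) (psnd z))"
  shows "odec (\<lambda>X z. \<forall>i<b X z. P X i z)"
proof -
  define f where "f X z k = rec_nat (1::nat) (\<lambda>m r. if P X m z then r else 0) k" for X z k
  have f: "f X z k = of_bool (\<forall>i<k. P X i z)" for X z k
    by (induction k) (auto simp: f_def less_Suc_eq)
  have "ocomp (\<lambda>X z. f X z (b X z))"
    unfolding f_def
    by (intro cintro assms(1) odec_comp2[OF assms(2)])
  then show ?thesis by (simp add: odec_def f)
qed

lemma odec_bex_less [cintro]:
  assumes "ocomp b" "odec (\<lambda>X z. P X (pfst z) (psnd z))"
  shows "odec (\<lambda>X z. \<exists>i<b X z. P X i z)"
  by (rule odec_cong[of "\<lambda>X z. \<not> (\<forall>i<b X z. \<not> P X i z)"]) (intro cintro assms, simp)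

lemma odec_bex_le [cintro]:
  assumes "ocomp b" "odec (\<lambda>X z. P X (pfst z) (psnd z))"
  shows "odec (\<lambda>X z. \<exists>i\<le>b X z. P X i z)"
  by (rule odec_cong[of "\<lambda>X z. \<exists>i<Suc (b X z). P X i z"])
    (intro cintro assms, simp add: less_Suc_eq_le)

subsection \<open>Lists\<close>

text \<open>The default 0 gives list access a known value, and so a computable one, beyond the end
  of the list.\<close>

definition lnth :: "nat list \<Rightarrow> nat \<Rightarrow> nat" where
  "lnth xs i = (if i < length xs then xs ! i else 0)"

lemma ocompl_decode [cintro]: "ocomp f \<Longrightarrow> ocompl (\<lambda>X z. list_decode (f X z))"
  by (simp add: ocompl_def)

lemma ocomp_encode [cintro]: "ocompl f \<Longrightarrow> ocomp (\<lambda>X z. list_encode (f X z))"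
  by (simp add: ocompl_def)

lemma ocompl_Nil [cintro]: "ocompl (\<lambda>X z. [])"
  unfolding ocompl_def by (rule ocomp_const)

lemma ocompl_Cons [cintro]: "ocomp f \<Longrightarrow> ocompl g \<Longrightarrow> ocompl (\<lambda>X z. f X z # g X z)"
  unfolding ocompl_def by (auto intro!: cintro)

lemma hd_code: "lnth (list_decode n) 0 = pfst (n - 1)" if "n \<noteq> 0"
  using that by (cases n) (auto simp: lnth_def pfst_def split: prod.split)

text \<open>A nonempty list has code \<open>Suc (prod_encode (x, r))\<close> with \<open>r\<close>
  the code of its tail. The formula also fits the empty list, because 0 decodes to the pair
  \<open>(0, 0)\<close>.\<close>

lemma tl_code: "list_encode (tl (list_decode n)) = psnd (n - 1)"
proof (cases n)
  case 0
  have "prod_decode 0 = (0, 0)"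
    by (simp add: prod_decode_def prod_decode_aux.simps)
  with 0 show ?thesis by (simp add: psnd_def)
qed (auto simp: psnd_def split: prod.split)

lemma ocompl_comp: "ocompl f \<Longrightarrow> ocomp g \<Longrightarrow> ocompl (\<lambda>X z. f X (g X z))"
  unfolding ocompl_def by (rule ocomp_comp)

lemma ocompl_tl [cintro]: "ocompl f \<Longrightarrow> ocompl (\<lambda>X z. tl (f X z))"
proof -
  assume "ocompl f"
  then have f: "ocomp (\<lambda>X z. list_encode (f X z))" by (rule ocomp_encode)
  show ?thesis
    unfolding ocompl_def using tl_code[of "list_encode (f _ _)"]
    by (simp only: list_encode_inverse) (intro cintro f)
qed

lemma ocompl_drop [cintro]:
  assumes "ocomp n" "ocompl f" shows "ocompl (\<lambda>X z. drop (n X z) (f X z))"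
proof -
  have "list_encode (drop k xs) = rec_nat (list_encode xs) (\<lambda>m r. list_encode (tl (list_decode r))) k"
    for k xs
  proof (induction k)
    case (Suc k)
    show ?case by (simp flip: Suc add: drop_Suc tl_drop)
  qed simp
  then show ?thesis unfolding ocompl_def
    by (simp only:) (intro cintro assms)
qed

lemma list_encode_eq_0 [simp]: "list_encode xs = 0 \<longleftrightarrow> xs = []"
  by (cases xs) auto

lemma ocomp_length [cintro]:
  assumes "ocompl f" shows "ocomp (\<lambda>X z. length (f X z))"
proof -
  have "length xs = (LEAST k. list_encode (drop k xs) = 0)" for xs :: "nat list"
    by (rule sym, rule Least_equality) auto
  then have "length (f X z) = (LEAST k. list_encode (drop k (f X z)) = 0)" for X z .
  moreover have "ocomp (\<lambda>X z. LEAST k. list_encode (drop k (f X z)) = 0)"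
  proof (rule ocomp_Least)
    show "\<exists>k. list_encode (drop k (f X z)) = 0" for X z
      by (rule exI[of _ "length (f X z)"]) simp
    show "odec (\<lambda>X z. list_encode (drop (pfst z) (f X (psnd z))) = 0)"
      by (intro cintro ocompl_comp[OF assms])
  qed
  ultimately show ?thesis by simp
qed

lemma ocomp_lnth [cintro]:
  assumes "ocompl f" "ocomp i" shows "ocomp (\<lambda>X z. lnth (f X z) (i X z))"
proof -
  have "lnth xs k = (if k < length xs then pfst (list_encode (drop k xs) - 1) else 0)" for xs k
    using hd_code[of "list_encode (drop k xs)"] by (auto simp: lnth_def)
  then show ?thesis
    by (simp only:) (intro cintro assms)
qed

text \<open>The recursion consumes the list from the right: after \<open>k\<close> steps it holds
  the fold over the last \<open>k\<close> entries.\<close>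

lemma ocomp_foldr:
  assumes "ocompl l" "ocomp a" "ocomp (\<lambda>X z. g X (pfst z) (pfst (psnd z)) (psnd (psnd z)))"
  shows "ocomp (\<lambda>X z. foldr (\<lambda>x r. g X x r z) (l X z) (a X z))"
proof -
  have *: "rec_nat b (\<lambda>m r. g (lnth xs (length xs - Suc m)) r) k = foldr g (drop (length xs - k) xs) b"
    if "k \<le> length xs" for k b xs and g :: "nat \<Rightarrow> nat \<Rightarrow> nat"
    using that
  proof (induction k)
    case (Suc k)
    have "drop (length xs - Suc k) xs = lnth xs (length xs - Suc k) # drop (length xs - k) xs"
    proof -
      have "length xs - Suc k < length xs" "Suc (length xs - Suc k) = length xs - k"
        using Suc.prems by auto
      then show ?thesis using Cons_nth_drop_Suc[of "length xs - Suc k" xs] by (simp add: lnth_def)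
    qed
    with Suc show ?case by simp
  qed simp
  have "foldr (\<lambda>x r. g X x r z) (l X z) (a X z) =
    rec_nat (a X z) (\<lambda>m r. g X (lnth (l X z) (length (l X z) - Suc m)) r z) (length (l X z))" for X z
    using *[of "length (l X z)" "l X z" "a X z" "\<lambda>x r. g X x r z"] by simp
  moreover have "ocomp (\<lambda>X z. rec_nat (a X z) (\<lambda>m r. g X (lnth (l X z) (length (l X z) - Suc m)) r z) (length (l X z)))"
  proof -
    have "ocompl (\<lambda>X z. l X (psnd (psnd z)))"
      using assms(1) unfolding ocompl_def by (rule ocomp_comp) (intro cintro)
    then show ?thesis
      by (intro cintro assms(1,2) ocomp_comp3[OF assms(3)])
  qed
  ultimately show ?thesis by simp
qed

lemma foldr_list_encode:
  "foldr (\<lambda>x r. Suc (prod_encode (f x, r))) xs (list_encode ys) = list_encode (map f xs @ ys)"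
  by (induction xs) auto

lemma ocompl_append [cintro]:
  assumes "ocompl f" "ocompl g" shows "ocompl (\<lambda>X z. f X z @ g X z)"
proof -
  have "ocomp (\<lambda>X z. foldr (\<lambda>x r. Suc (prod_encode (x, r))) (f X z) (list_encode (g X z)))"
    by (rule ocomp_foldr) (intro cintro assms)+
  then show ?thesis by (simp add: ocompl_def foldr_list_encode[of "\<lambda>x. x", simplified])
qed

lemma ocompl_map [cintro]:
  assumes "ocompl l" "ocomp (\<lambda>X z. g X (pfst z) (psnd z))"
  shows "ocompl (\<lambda>X z. map (\<lambda>x. g X x z) (l X z))"
proof -
  have "ocomp (\<lambda>X z. foldr (\<lambda>x r. Suc (prod_encode (g X x z, r))) (l X z) (list_encode []))"
    by (rule ocomp_foldr) (intro cintro assms ocomp_comp2[OF assms(2)])+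
  then show ?thesis
    by (simp only: foldr_list_encode append_Nil2 ocompl_def)
qed

lemma ocompl_upt [cintro]:
  assumes "ocomp n" shows "ocompl (\<lambda>X z. [0..<n X z])"
proof -
  have "list_encode [0..<k] = rec_nat 0 (\<lambda>m r. list_encode (list_decode r @ [m])) k" for k
  proof (induction k)
    case (Suc k)
    show ?case by (simp flip: Suc)
  qed simp
  then show ?thesis unfolding ocompl_def
    by (simp only:) (intro cintro assms)
qed

lemma odec_Ball [cintro]:
  assumes "ocompl l" "odec (\<lambda>X z. P X (pfst z) (psnd z))"
  shows "odec (\<lambda>X z. \<forall>x\<in>set (l X z). P X x z)"
proof -
  have "foldr (\<lambda>x r. if P x then r else 0) xs (1::nat) = of_bool (\<forall>x\<in>set xs. P x)" for xs :: "nat list" and P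
    by (induction xs) auto
  moreover have "ocomp (\<lambda>X z. foldr (\<lambda>x r. if P X x z then r else 0) (l X z) 1)"
    by (rule ocomp_foldr) (intro cintro assms odec_comp2[OF assms(2)])+
  ultimately show ?thesis by (simp only: odec_def)
qed

lemma odec_Bex [cintro]:
  assumes "ocompl l" "odec (\<lambda>X z. P X (pfst z) (psnd z))"
  shows "odec (\<lambda>X z. \<exists>x\<in>set (l X z). P X x z)"
  by (rule odec_cong[of "\<lambda>X z. \<not> (\<forall>x\<in>set (l X z). \<not> P X x z)"]) (intro cintro assms, simp)

lemma odec_member [cintro]:
  assumes "ocomp f" "ocompl l" shows "odec (\<lambda>X z. f X z \<in> set (l X z))"
  by (rule odec_cong[of "\<lambda>X z. \<exists>x\<in>set (l X z). x = f X z"])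
    (intro cintro assms ocomp_comp[OF assms(1)], simp)

lemma odec_list_eq [cintro]:
  assumes "ocompl f" "ocompl g" shows "odec (\<lambda>X z. f X z = g X z)"
  by (rule odec_cong[of "\<lambda>X z. list_encode (f X z) = list_encode (g X z)"])
    (intro cintro assms, simp add: list_encode_eq)

lemma odec_distinct [cintro]:
  assumes "ocompl f" shows "odec (\<lambda>X z. distinct (f X z))"
  by (rule odec_cong[of "\<lambda>X z. \<forall>i<length (f X z). \<forall>j<length (f X z).
      lnth (f X z) i = lnth (f X z) j \<longrightarrow> i = j"])
    (intro cintro assms ocompl_comp[OF assms], auto simp: distinct_conv_nth lnth_def)

subsection \<open>Course-of-values recursion\<close>

text \<open>The table of all earlier values is built as a list code by primitive recursion. This
  admits recursion into arbitrary smaller numbers, as needed for functions that descend through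
  codes of terms, formulas and programs.\<close>

lemma ocomp_course_of_values:
  assumes F: "\<And>X k z. F X k z = H X k (map (\<lambda>j. F X j z) [0..<k]) z"
    and H: "ocomp (\<lambda>X z. H X (pfst z) (list_decode (pfst (psnd z))) (psnd (psnd z)))"
    and "ocomp a" "ocomp b"
  shows "ocomp (\<lambda>X z. F X (a X z) (b X z))"
proof -
  note H' = ocomp_comp3[where f = "\<lambda>X k l z. H X k (list_decode l) z", OF H]
  have tab: "list_encode (map (\<lambda>j. F X j z) [0..<k]) =
      rec_nat 0 (\<lambda>m r. list_encode (list_decode r @ [H X m (list_decode r) z])) k" for X k z
  proof (induction k)
    case (Suc k)
    show ?case using F[of X k z] by (simp flip: Suc)
  qed simp
  have *: "ocomp (\<lambda>X z. list_encode (map (\<lambda>j. F X j (psnd z)) [0..<pfst z]))"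
    unfolding tab by (intro cintro H')
  have "ocomp (\<lambda>X z. H X (pfst z) (list_decode (list_encode (map (\<lambda>j. F X j (psnd z)) [0..<pfst z]))) (psnd z))"
    by (rule H'[OF _ *]) (intro cintro)+
  then have "ocomp (\<lambda>X z. F X (pfst z) (psnd z))"
    by (simp only: list_encode_inverse F[symmetric])
  then show ?thesis using assms(3,4) by (rule ocomp_comp2)
qed

section \<open>Isomorphisms and diagrams\<close>

lemma tm_val_cong: "(\<And>i. i \<in> tm_vars t \<Longrightarrow> v i = w i) \<Longrightarrow> tm_val S v t = tm_val S w t"
proof (induction t)
  case (Fn f ts)
  then have "map (tm_val S v) ts = map (tm_val S w) ts" by auto
  then show ?case by (simp cong: map_cong)
qed simp

lemma qf_holds_cong:
  "(\<And>i. i \<in> qf_vars \<phi> \<Longrightarrow> v i = w i) \<Longrightarrow> qf_holds S v \<phi> \<longleftrightarrow> qf_holds S w \<phi>"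
proof (induction \<phi>)
  case (Rel r ts)
  then have "map (tm_val S v) ts = map (tm_val S w) ts" by (auto intro!: tm_val_cong)
  then show ?case by (simp cong: map_cong)
next
  case (Eq s t)
  then show ?case using tm_val_cong[of s v w S] tm_val_cong[of t v w S] by simp
qed auto

lemma tm_val_univ:
  "is_structure L S \<Longrightarrow> wf_tm L t \<Longrightarrow> (\<And>i. i \<in> tm_vars t \<Longrightarrow> v i \<in> univ S) \<Longrightarrow> tm_val S v t \<in> univ S"
proof (induction t)
  case (Fn f ts)
  then have "map (tm_val S v) ts \<in> tuples S (fun_arity L f)"
    by (auto simp: tuples_def list_all_iff)
  then show ?case using Fn.prems(1,2) by (auto simp: is_structure_def)
qed simp

definition iso_map :: "lang \<Rightarrow> struct \<Rightarrow> struct \<Rightarrow> (nat \<Rightarrow> nat) \<Rightarrow> bool" where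
  "iso_map L S T h \<longleftrightarrow> bij_betw h (univ S) (univ T) \<and>
        (\<forall>r\<in>rel_syms L. \<forall>xs\<in>tuples S (rel_arity L r).
           rel_int S r xs \<longleftrightarrow> rel_int T r (map h xs)) \<and>
        (\<forall>f\<in>fun_syms L. \<forall>xs\<in>tuples S (fun_arity L f).
           h (fun_int S f xs) = fun_int T f (map h xs))"

lemma isomorphic_iff: "isomorphic L S T \<longleftrightarrow> (\<exists>h. iso_map L S T h)"
  by (simp add: isomorphic_def iso_map_def)

lemma iso_map_tuples: "iso_map L S T h \<Longrightarrow> xs \<in> tuples S n \<Longrightarrow> map h xs \<in> tuples T n"
  by (auto simp: iso_map_def tuples_def bij_betw_def)

lemma iso_map_tm_val:
  assumes "iso_map L S T h" "is_structure L S"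
  shows "wf_tm L t \<Longrightarrow> (\<And>i. i \<in> tm_vars t \<Longrightarrow> v i \<in> univ S) \<Longrightarrow>
    h (tm_val S v t) = tm_val T (\<lambda>i. h (v i)) t"
proof (induction t)
  case (Fn f ts)
  then have "map (tm_val S v) ts \<in> tuples S (fun_arity L f)"
    using assms(2) by (auto simp: tuples_def list_all_iff intro!: tm_val_univ)
  moreover have "map h (map (tm_val S v) ts) = map (tm_val T (\<lambda>i. h (v i))) ts"
    using Fn by (auto simp: list_all_iff)
  ultimately show ?case using assms(1) Fn.prems(1)
    by (simp only: iso_map_def wf_tm.simps tm_val.simps)
qed simp

lemma iso_map_qf_holds:
  assumes "iso_map L S T h" "is_structure L S"
  shows "wf_qf L \<phi> \<Longrightarrow> (\<And>i. i \<in> qf_vars \<phi> \<Longrightarrow> v i \<in> univ S) \<Longrightarrow>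
    qf_holds S v \<phi> \<longleftrightarrow> qf_holds T (\<lambda>i. h (v i)) \<phi>"
proof (induction \<phi>)
  case (Rel r ts)
  then have "map (tm_val S v) ts \<in> tuples S (rel_arity L r)"
    using assms(2) by (auto simp: tuples_def list_all_iff intro!: tm_val_univ)
  moreover have "map h (map (tm_val S v) ts) = map (tm_val T (\<lambda>i. h (v i))) ts"
    using Rel by (auto simp: list_all_iff intro!: iso_map_tm_val[OF assms])
  ultimately show ?case using assms(1) Rel.prems(1)
    by (simp only: iso_map_def wf_qf.simps qf_holds.simps)
next
  case (Eq s t)
  then have "tm_val S v s \<in> univ S" "tm_val S v t \<in> univ S"
    using assms(2) by (auto intro!: tm_val_univ)
  moreover have "inj_on h (univ S)" using assms(1) by (auto simp: iso_map_def bij_betw_def)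
  ultimately have "tm_val S v s = tm_val S v t \<longleftrightarrow> h (tm_val S v s) = h (tm_val S v t)"
    by (auto simp: inj_on_eq_iff)
  then show ?case using Eq iso_map_tm_val[OF assms, of s v] iso_map_tm_val[OF assms, of t v] by simp
qed auto

lemma isomorphic_refl: "isomorphic L S S"
  unfolding isomorphic_iff by (rule exI[of _ "\<lambda>x. x"]) (auto simp: iso_map_def bij_betw_def)

lemma isomorphic_trans:
  assumes "isomorphic L S T" "isomorphic L T U" shows "isomorphic L S U"
proof -
  obtain h g where h: "iso_map L S T h" and g: "iso_map L T U g"
    using assms by (auto simp: isomorphic_iff)
  have "iso_map L S U (g \<circ> h)"
    unfolding iso_map_def
  proof (intro conjI ballI)
    show "bij_betw (g \<circ> h) (univ S) (univ U)"
      using h g by (auto simp: iso_map_def intro: bij_betw_trans)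
    show "rel_int S r xs = rel_int U r (map (g \<circ> h) xs)"
      if "r \<in> rel_syms L" "xs \<in> tuples S (rel_arity L r)" for r xs
      using h g that iso_map_tuples[OF h that(2)] by (simp add: iso_map_def)
    show "(g \<circ> h) (fun_int S f xs) = fun_int U f (map (g \<circ> h) xs)"
      if "f \<in> fun_syms L" "xs \<in> tuples S (fun_arity L f)" for f xs
      using h g that iso_map_tuples[OF h that(2)] by (simp add: iso_map_def)
  qed
  then show ?thesis by (auto simp: isomorphic_iff)
qed

lemma isomorphic_sym:
  assumes "isomorphic L S T" "is_structure L S" shows "isomorphic L T S"
proof -
  obtain h where h: "iso_map L S T h" using assms by (auto simp: isomorphic_iff)
  define g where "g = inv_into (univ S) h"
  have b: "bij_betw h (univ S) (univ T)" using h by (simp add: iso_map_def)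
  then have bg: "bij_betw g (univ T) (univ S)" unfolding g_def by (rule bij_betw_inv_into)
  have hg: "h (g y) = y" if "y \<in> univ T" for y
    using b that unfolding g_def by (simp add: bij_betw_inv_into_right)
  have gh: "g (h x) = x" if "x \<in> univ S" for x
    using b that unfolding g_def by (simp add: bij_betw_inv_into_left)
  have tup: "map g xs \<in> tuples S n" "map h (map g xs) = xs" if "xs \<in> tuples T n" for xs n
    using that bg hg by (auto simp: tuples_def bij_betw_def intro!: map_idI)
  have "iso_map L T S g"
    unfolding iso_map_def
  proof (intro conjI ballI bg)
    show "rel_int T r xs = rel_int S r (map g xs)"
      if "r \<in> rel_syms L" "xs \<in> tuples T (rel_arity L r)" for r xs
      using h that tup[OF that(2)] unfolding iso_map_def by metis
    show "g (fun_int T f xs) = fun_int S f (map g xs)"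
      if "f \<in> fun_syms L" "xs \<in> tuples T (fun_arity L f)" for f xs
    proof -
      have "h (fun_int S f (map g xs)) = fun_int T f xs"
        using h that tup[OF that(2)] unfolding iso_map_def by metis
      moreover have "fun_int S f (map g xs) \<in> univ S"
        using assms(2) that(1) tup(1)[OF that(2)] by (auto simp: is_structure_def)
      ultimately show ?thesis using gh by metis
    qed
  qed
  then show ?thesis by (auto simp: isomorphic_iff)
qed

section \<open>Copies given by enumerations of the universe\<close>

definition pull :: "struct \<Rightarrow> (nat \<Rightarrow> nat) \<Rightarrow> struct" where
  "pull S e = \<lparr>univ = UNIV, rel_int = (\<lambda>r xs. rel_int S r (map e xs)),
     fun_int = (\<lambda>f xs. inv e (fun_int S f (map e xs)))\<rparr>"

lemma univ_pull [simp]: "univ (pull S e) = UNIV" by (simp add: pull_def)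

lemma is_structure_pull: "is_structure L (pull S e)" by (simp add: is_structure_def)

lemma iso_map_pull:
  assumes "is_structure L S" "bij_betw e UNIV (univ S)"
  shows "iso_map L (pull S e) S e"
proof -
  have "e (inv e y) = y" if "y \<in> univ S" for y
    using assms(2) that by (simp add: bij_betw_inv_into_right)
  moreover have "map e xs \<in> tuples S n" if "length xs = n" for xs n
    using that assms(2) by (auto simp: tuples_def bij_betw_def)
  ultimately show ?thesis
    using assms by (auto simp: iso_map_def pull_def tuples_def[of "pull _ _"] is_structure_def tuples_def)
qed

text \<open>For an enumeration of the universe this is the diagram of the copy it induces. It also
  makes sense for \<open>(!) xs\<close> with a finite list \<open>xs\<close>, which then acts as a
  finite part of an oracle.\<close>

definition sat_diag :: "lang \<Rightarrow> struct \<Rightarrow> (nat \<Rightarrow> nat) \<Rightarrow> nat set" where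
  "sat_diag L S v = qf_code ` {\<phi>. wf_qf L \<phi> \<and> literal \<phi> \<and> qf_holds S v \<phi>}"

lemma diagram_pull:
  assumes "is_structure L S" "bij_betw e UNIV (univ S)"
  shows "diagram L (pull S e) = sat_diag L S e"
  using iso_map_qf_holds[OF iso_map_pull[OF assms] is_structure_pull, of _ "\<lambda>a. a"]
  by (auto simp: diagram_def sat_diag_def image_iff)

lemma pull_copies:
  assumes "is_structure L S" "bij_betw e UNIV (univ S)"
  shows "pull S e \<in> copies L S"
  using iso_map_pull[OF assms] by (auto simp: copies_def is_structure_pull isomorphic_iff)

lemma copies_trans: "T \<in> copies L S \<Longrightarrow> U \<in> copies L T \<Longrightarrow> U \<in> copies L S"
  by (auto simp: copies_def intro: isomorphic_trans)

lemma copies_sym: "T \<in> copies L S \<Longrightarrow> is_structure L S \<Longrightarrow> S \<in> copies L T"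
  by (auto simp: copies_def intro: isomorphic_sym)

lemma copies_refl: "is_structure L S \<Longrightarrow> S \<in> copies L S"
  by (auto simp: copies_def isomorphic_refl)

lemma copies_infinite: "T \<in> copies L S \<Longrightarrow> infinite (univ S) \<Longrightarrow> infinite (univ T)"
  by (auto simp: copies_def isomorphic_def dest: bij_betw_finite)

text \<open>After \<open>zs\<close> the remaining elements, still infinitely many, are listed in
  increasing order.\<close>

lemma enumeration_extends:
  fixes U :: "nat set"
  assumes "infinite U" "distinct zs" "set zs \<subseteq> U"
  obtains e where "bij_betw e UNIV U" "\<And>i. i < length zs \<Longrightarrow> e i = zs ! i"
proof -
  let ?n = "length zs" and ?V = "U - set zs"
  define e where "e i = (if i < ?n then zs ! i else enumerate ?V (i - ?n))" for i
  have V: "bij_betw (enumerate ?V) UNIV ?V"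
    using assms(1) by (intro bij_enumerate) auto
  have 1: "bij_betw e {..<?n} (set zs)"
  proof -
    have "bij_betw e {..<?n} (set zs) \<longleftrightarrow> bij_betw ((!) zs) {..<?n} (set zs)"
      by (rule bij_betw_cong) (simp add: e_def)
    then show ?thesis using bij_betw_nth[OF assms(2)] by blast
  qed
  have "bij_betw (\<lambda>i. i - ?n) {?n..} UNIV"
    by (rule bij_betw_byWitness[where f' = "\<lambda>i. i + ?n"]) auto
  then have "bij_betw (enumerate ?V \<circ> (\<lambda>i. i - ?n)) {?n..} ?V"
    using V by (rule bij_betw_trans)
  then have 2: "bij_betw e {?n..} ?V"
    by (rule bij_betw_cong[THEN iffD1, rotated]) (simp add: e_def)
  have "bij_betw e ({..<?n} \<union> {?n..}) (set zs \<union> ?V)"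
    by (rule bij_betw_combine[OF 1 2]) auto
  moreover have "{..<?n} \<union> {?n..} = UNIV" by auto
  moreover have "set zs \<union> ?V = U" using assms(3) by auto
  ultimately show ?thesis using that[of e] by (simp add: e_def)
qed

section \<open>Codes of formulas\<close>

lemma tm_code_inj: "tm_code s = tm_code t \<Longrightarrow> s = t"
proof (induction s arbitrary: t)
  case (Var i)
  then show ?case by (cases t) auto
next
  case (Fn f ts)
  then obtain us where t: "t = Fn f us" and e: "map tm_code ts = map tm_code us"
    by (cases t) (auto simp: list_encode_eq)
  have "ts = us"
    using e Fn.IH by (metis (no_types, lifting) list.inj_map_strong)
  then show ?case using t by simp
qed

lemma tm_code_eq [simp]: "tm_code s = tm_code t \<longleftrightarrow> s = t"
  using tm_code_inj by blast

lemma inj_tm_code: "inj tm_code" by (simp add: inj_def)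

lemma qf_code_eq [simp]: "qf_code \<phi> = qf_code \<psi> \<longleftrightarrow> \<phi> = \<psi>"
proof (induction \<phi> arbitrary: \<psi>)
  case (Rel r ts)
  show ?case by (cases \<psi>) (auto simp: list_encode_eq inj_map_eq_map[OF inj_tm_code])
next
  case (Eq s t) then show ?case by (cases \<psi>) auto
next
  case (Neg \<phi>) then show ?case by (cases \<psi>) auto
next
  case (Conj \<phi>1 \<phi>2) then show ?case by (cases \<psi>) auto
next
  case (Disj \<phi>1 \<phi>2) then show ?case by (cases \<psi>) auto
qed

lemma prog_code_inj: "prog_code p = prog_code q \<Longrightarrow> p = q"
proof (induction p arbitrary: q)
  case (Comp f gs)
  then obtain f' gs' where q: "q = Comp f' gs'" and e: "map prog_code gs = map prog_code gs'"
    and f: "prog_code f = prog_code f'"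
    by (cases q) (auto simp: list_encode_eq)
  have "gs = gs'"
    using e Comp.IH(2) by (metis (no_types, lifting) list.inj_map_strong)
  then show ?case using q Comp.IH(1)[OF f] by simp
next
  case (PRec f g) then show ?case by (cases q) auto
next
  case (Mu f) then show ?case by (cases q) auto
next
  case Zero then show ?case by (cases q) auto
next
  case Succ then show ?case by (cases q) auto
next
  case (Proj i) then show ?case by (cases q) auto
next
  case Query then show ?case by (cases q) auto
qed

lemma list_decode_less: "x \<in> set (list_decode n) \<Longrightarrow> x < n"
proof (induction n rule: list_decode.induct)
  case (2 n)
  show ?case
  proof (cases "prod_decode n")
    case (Pair a b)
    then have n: "n = prod_encode (a, b)" by (metis prod_decode_inverse)
    with 2 Pair have "x = a \<or> x < b" by auto
    then show ?thesis using n le_prod_encode_1[of a b] le_prod_encode_2[of b a] by auto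
  qed
qed simp

lemma list_encode_less: "x \<in> set xs \<Longrightarrow> x < list_encode xs"
  using list_decode_less[of x "list_encode xs"] by simp

lemma tm_vars_le_code: "i \<in> tm_vars t \<Longrightarrow> i \<le> tm_code t"
proof (induction t)
  case (Var j) then show ?case using le_prod_encode_2[of j 0] by simp
next
  case (Fn f ts)
  then obtain t where t: "t \<in> set ts" "i \<le> tm_code t" by auto
  have "tm_code t < list_encode (map tm_code ts)" using t by (intro list_encode_less) auto
  also have "\<dots> \<le> tm_code (Fn f ts)"
    using le_prod_encode_2 order_trans by (metis tm_code.simps(2))
  finally show ?case using t by simp
qed

text \<open>Bounds on codes replace bookkeeping of variables: whether \<open>k\<close> lies in a
  diagram depends only on the elements named \<open>0, ..., k\<close>, so a partial enumeration
  longer than \<open>k\<close> settles it.\<close>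

lemma qf_vars_le_code: "i \<in> qf_vars \<phi> \<Longrightarrow> i \<le> qf_code \<phi>"
proof (induction \<phi>)
  case (Rel r ts)
  then obtain t where t: "t \<in> set ts" "i \<le> tm_code t" using tm_vars_le_code by auto
  have "tm_code t < list_encode (map tm_code ts)" using t by (intro list_encode_less) auto
  also have "\<dots> \<le> qf_code (Rel r ts)"
    using le_prod_encode_2 order_trans by (metis qf_code.simps(1))
  finally show ?case using t by simp
next
  case (Eq s t)
  then show ?case using tm_vars_le_code[of i s] tm_vars_le_code[of i t]
    le_prod_encode_1[of "tm_code s" "tm_code t"] le_prod_encode_2[of "tm_code t" "tm_code s"]
    le_prod_encode_2[of "prod_encode (tm_code s, tm_code t)" 1] by auto
next
  case (Neg \<phi>)
  then show ?case using le_prod_encode_2[of "qf_code \<phi>" 2] by auto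
next
  case (Conj \<phi> \<psi>)
  then show ?case using
    le_prod_encode_1[of "qf_code \<phi>" "qf_code \<psi>"] le_prod_encode_2[of "qf_code \<psi>" "qf_code \<phi>"]
    le_prod_encode_2[of "prod_encode (qf_code \<phi>, qf_code \<psi>)" 3] by auto
next
  case (Disj \<phi> \<psi>)
  then show ?case using
    le_prod_encode_1[of "qf_code \<phi>" "qf_code \<psi>"] le_prod_encode_2[of "qf_code \<psi>" "qf_code \<phi>"]
    le_prod_encode_2[of "prod_encode (qf_code \<phi>, qf_code \<psi>)" 4] by auto
qed

subsection \<open>Substitution of names for variables\<close>

primrec tsubst :: "(nat \<Rightarrow> nat) \<Rightarrow> tm \<Rightarrow> tm" where
  "tsubst \<sigma> (Var i) = Var (\<sigma> i)"
| "tsubst \<sigma> (Fn f ts) = Fn f (map (tsubst \<sigma>) ts)"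

fun lsubst :: "(nat \<Rightarrow> nat) \<Rightarrow> qf \<Rightarrow> qf" where
  "lsubst \<sigma> (Rel r ts) = Rel r (map (tsubst \<sigma>) ts)"
| "lsubst \<sigma> (Eq s t) = Eq (tsubst \<sigma> s) (tsubst \<sigma> t)"
| "lsubst \<sigma> (Neg \<phi>) = Neg (lsubst \<sigma> \<phi>)"
| "lsubst \<sigma> \<phi> = \<phi>"

lemma wf_tsubst [simp]: "wf_tm L (tsubst \<sigma> t) = wf_tm L t"
  by (induction t) (auto simp: list_all_iff)

lemma vars_tsubst: "tm_vars (tsubst \<sigma> t) = \<sigma> ` tm_vars t"
  by (induction t) auto

lemma tm_val_tsubst: "tm_val S v (tsubst \<sigma> t) = tm_val S (\<lambda>i. v (\<sigma> i)) t"
proof (induction t)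
  case (Fn f ts)
  then have "map (tm_val S v \<circ> tsubst \<sigma>) ts = map (tm_val S (\<lambda>i. v (\<sigma> i))) ts" by auto
  then show ?case by (simp cong: map_cong)
qed simp

lemma literal_cases:
  assumes "literal \<phi>"
  obtains r ts where "\<phi> = Rel r ts" | s t where "\<phi> = Eq s t"
    | r ts where "\<phi> = Neg (Rel r ts)" | s t where "\<phi> = Neg (Eq s t)"
  using assms unfolding literal_def by (metis atomic.elims(2))

lemma literal_simps [simp]: "literal (Rel r ts)" "literal (Eq s t)" "literal (Neg \<phi>) \<longleftrightarrow> atomic \<phi>"
  by (auto simp: literal_def)

lemma lsubst_literal:
  assumes "literal \<phi>"
  shows "literal (lsubst \<sigma> \<phi>)" "wf_qf L (lsubst \<sigma> \<phi>) = wf_qf L \<phi>"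
    "qf_vars (lsubst \<sigma> \<phi>) = \<sigma> ` qf_vars \<phi>"
    "qf_holds S v (lsubst \<sigma> \<phi>) = qf_holds S (\<lambda>i. v (\<sigma> i)) \<phi>"
  using assms
  by (auto elim!: literal_cases simp: list_all_iff vars_tsubst tm_val_tsubst comp_def image_UN) blast+

text \<open>The counterpart of \<open>tsubst\<close> on codes, made total: a number with any other
  tag is returned unchanged and so still codes no term.\<close>

function subt :: "nat list \<Rightarrow> nat \<Rightarrow> nat" where
  "subt es k =
    (if pfst k = 0 then prod_encode (0, lnth es (psnd k))
     else if pfst k = 1 then
       prod_encode (1, prod_encode (pfst (psnd k),
         list_encode (map (subt es) (list_decode (psnd (psnd k))))))
     else k)"
  by auto
termination
proof (relation "measure snd")
  fix es :: "nat list" and k x :: nat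
  assume "x \<in> set (list_decode (psnd (psnd k)))"
  then have "x < psnd (psnd k)" by (rule list_decode_less)
  also have "\<dots> \<le> k" using psnd_le order_trans by blast
  finally show "((es, x), (es, k)) \<in> measure snd" by simp
qed simp

declare subt.simps [simp del]

text \<open>The fallback carries the tag of \<open>Conj\<close>, so it codes no literal, not even
  below a negation.\<close>

definition asub :: "nat list \<Rightarrow> nat \<Rightarrow> nat" where
  "asub es k =
    (if pfst k = 0 then prod_encode (0, prod_encode (pfst (psnd k),
         list_encode (map (subt es) (list_decode (psnd (psnd k))))))
     else if pfst k = 1 then
       prod_encode (1, prod_encode (subt es (pfst (psnd k)), subt es (psnd (psnd k))))
     else prod_encode (3, 0))"

text \<open>On numbers that do not code literals, this yields numbers that do not code literals either.\<close>

definition lsub :: "nat list \<Rightarrow> nat \<Rightarrow> nat" where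
  "lsub es k = (if pfst k = 2 then prod_encode (2, asub es (psnd k)) else asub es k)"

lemma subt_code: "subt es (tm_code t) = tm_code (tsubst (lnth es) t)"
proof (induction t)
  case (Var i) then show ?case by (subst subt.simps) simp
next
  case (Fn f ts)
  then have "map (subt es \<circ> tm_code) ts = map (tm_code \<circ> tsubst (lnth es)) ts" by auto
  then show ?case by (subst subt.simps) (simp cong: map_cong)
qed

text \<open>Substitution makes no terms out of numbers that code none. Otherwise the diagram could
  give a positive answer about a number that codes no literal.\<close>

lemma subt_is_code: "subt es k = tm_code t' \<Longrightarrow> k \<in> range tm_code"
proof (induction k arbitrary: t' rule: less_induct)
  case (less k)
  show ?case
  proof (cases t')
    case (Var j)
    with less.prems have "pfst k = 0" by (auto simp: subt.simps[of es k] split: if_splits)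
    then have "k = tm_code (Var (psnd k))"
      by (metis prod_encode_pfst_psnd tm_code.simps(1))
    then show ?thesis by blast
  next
    case (Fn f ts)
    show ?thesis
    proof (cases "pfst k = 1")
      case True
      let ?l = "list_decode (psnd (psnd k))"
      have m: "map (subt es) ?l = map tm_code ts"
        using less.prems True Fn by (auto simp: subt.simps[of es k] list_encode_eq)
      have "x \<in> range tm_code" if "x \<in> set ?l" for x
      proof -
        have "x < k" using list_decode_less[OF that] psnd_le[of k] psnd_le[of "psnd k"] by linarith
        moreover have "subt es x \<in> set (map tm_code ts)"
          using that unfolding m[symmetric] by simp
        ultimately show ?thesis using less.IH by auto
      qed
      then have "\<exists>us. ?l = map tm_code us"
        by (metis ex_map_conv rangeE)
      then obtain us where us: "?l = map tm_code us" by blast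
      have "k = tm_code (Fn (pfst (psnd k)) us)"
        using True prod_encode_pfst_psnd[of k] by (simp flip: us)
      then show ?thesis by blast
    next
      case False
      then have "k = tm_code t' \<or> t' = Var (lnth es (psnd k))"
        using less.prems by (auto simp: subt.simps[of es k] split: if_splits simp flip: tm_code.simps(1))
      then show ?thesis using Fn by (metis rangeI tm.distinct(1))
    qed
  qed
qed

lemma lsub_code: "literal \<phi> \<Longrightarrow> lsub es (qf_code \<phi>) = qf_code (lsubst (lnth es) \<phi>)"
  by (erule literal_cases) (auto simp: lsub_def asub_def subt_code comp_def)

lemma subt_list_is_code:
  assumes "map (subt es) l = map tm_code ts" obtains us where "l = map tm_code us"
proof -
  have "x \<in> range tm_code" if "x \<in> set l" for x
  proof -
    have "subt es x \<in> set (map tm_code ts)"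
      using that unfolding assms[symmetric] by simp
    then show ?thesis using subt_is_code by auto
  qed
  then show ?thesis using that by (metis ex_map_conv rangeE)
qed

lemma asub_is_code:
  assumes "asub es k = qf_code \<phi>'" "atomic \<phi>'"
  shows "\<exists>\<phi>. atomic \<phi> \<and> k = qf_code \<phi>"
proof (cases \<phi>')
  case (Rel r ts)
  then have 1: "pfst k = 0" "map (subt es) (list_decode (psnd (psnd k))) = map tm_code ts"
    using assms by (auto simp: asub_def list_encode_eq split: if_splits)
  then obtain us where us: "list_decode (psnd (psnd k)) = map tm_code us"
    by (elim subt_list_is_code)
  have "k = qf_code (Rel (pfst (psnd k)) us)"
    using 1 prod_encode_pfst_psnd[of k] by (simp flip: us)
  then show ?thesis by (intro exI[of _ "Rel (pfst (psnd k)) us"]) simp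
next
  case (Eq s t)
  then have 1: "pfst k = 1" "subt es (pfst (psnd k)) = tm_code s" "subt es (psnd (psnd k)) = tm_code t"
    using assms by (auto simp: asub_def split: if_splits)
  then obtain s' t' where st: "pfst (psnd k) = tm_code s'" "psnd (psnd k) = tm_code t'"
    using subt_is_code by blast
  have "k = qf_code (Eq s' t')"
    using 1 prod_encode_pfst_psnd[of k] by (simp flip: st)
  then show ?thesis by (intro exI[of _ "Eq s' t'"]) simp
qed (use assms in auto)

lemma lsub_is_code:
  assumes "lsub es k = qf_code \<phi>'" "literal \<phi>'"
  shows "\<exists>\<phi>. literal \<phi> \<and> k = qf_code \<phi>"
proof (cases "pfst k = 2")
  case True
  then obtain \<psi> where "\<phi>' = Neg \<psi>" "atomic \<psi>" "asub es (psnd k) = qf_code \<psi>"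
    using assms by (auto simp: lsub_def elim!: literal_cases)
  then obtain \<chi> where "atomic \<chi>" "psnd k = qf_code \<chi>" using asub_is_code by blast
  then show ?thesis using True prod_encode_pfst_psnd[of k] by (intro exI[of _ "Neg \<chi>"]) auto
next
  case False
  then have *: "asub es k = qf_code \<phi>'" using assms by (simp add: lsub_def)
  \<comment> \<open>\<open>asub\<close> produces only the tags 0, 1 and 3.\<close>
  then have "pfst (qf_code \<phi>') \<noteq> 2" by (metis asub_def numeral_eq_iff pfst_prod_encode semiring_norm(83,85,87,89) zero_neq_numeral one_eq_numeral_iff numeral_One)
  then have "atomic \<phi>'" using assms(2) by (auto elim!: literal_cases)
  then show ?thesis using asub_is_code[OF *] by (auto simp: literal_def)
qed

lemma lsub_qf_code:
  assumes "literal \<phi>" "set es \<subseteq> univ S" "qf_vars \<phi> \<subseteq> {..<length es}"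
  shows "lsub es (qf_code \<phi>) \<in> diagram L S \<longleftrightarrow> wf_qf L \<phi> \<and> qf_holds S ((!) es) \<phi>"
proof -
  have v: "i < length es" if "i \<in> qf_vars \<phi>" for i
    using assms(3) that by auto
  have "qf_vars (lsubst (lnth es) \<phi>) \<subseteq> univ S"
    using v assms(2) lsubst_literal(3)[OF assms(1)] by (auto simp: lnth_def)
  moreover have "qf_holds S (lnth es) \<phi> = qf_holds S ((!) es) \<phi>"
    by (rule qf_holds_cong) (simp add: v lnth_def)
  ultimately show ?thesis
    using lsubst_literal[OF assms(1)] assms(1)
    by (auto simp: lsub_code diagram_def image_iff)
qed

text \<open>Translates questions about a partial enumeration \<open>es\<close> into queries to the
  diagram of \<open>S\<close>. Since \<open>k < length es\<close>, every variable in the formula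
  with code \<open>k\<close> receives an element.\<close>

lemma lsub_in_diagram:
  assumes "set es \<subseteq> univ S" "k < length es"
  shows "lsub es k \<in> diagram L S \<longleftrightarrow> k \<in> sat_diag L S ((!) es)"
proof (cases "\<exists>\<phi>. literal \<phi> \<and> k = qf_code \<phi>")
  case True
  then obtain \<phi> where \<phi>: "literal \<phi>" "k = qf_code \<phi>" by blast
  then have "qf_vars \<phi> \<subseteq> {..<length es}"
    using qf_vars_le_code assms(2) by fastforce
  then show ?thesis using \<phi> lsub_qf_code[OF \<phi>(1) assms(1)] by (auto simp: sat_diag_def)
next
  case False
  then have "lsub es k \<notin> diagram L S"
    using lsub_is_code[of es k] by (auto simp: diagram_def)
  moreover have "k \<notin> sat_diag L S ((!) es)" using False by (auto simp: sat_diag_def)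
  ultimately show ?thesis by blast
qed

lemma sat_diag_cong:
  assumes "\<And>i. i \<le> k \<Longrightarrow> v i = w i" shows "k \<in> sat_diag L S v \<longleftrightarrow> k \<in> sat_diag L S w"
proof -
  have "qf_holds S v \<phi> = qf_holds S w \<phi>" if "k = qf_code \<phi>" for \<phi>
    using assms qf_vars_le_code that by (intro qf_holds_cong) auto
  then show ?thesis by (auto simp: sat_diag_def)
qed

lemma ocomp_subt [cintro]:
  assumes "ocompl e" "ocomp k" shows "ocomp (\<lambda>X z. subt (e X z) (k X z))"
proof -
  define H where "H X k T z =
    (if pfst k = 0 then prod_encode (0, lnth (list_decode z) (psnd k))
     else if pfst k = 1 then
       prod_encode (1, prod_encode (pfst (psnd k),
         list_encode (map (\<lambda>x. lnth T x) (list_decode (psnd (psnd k))))))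
     else k)" for X :: "nat set" and k T z
  have "subt (list_decode z) k = H X k (map (\<lambda>j. subt (list_decode z) j) [0..<k]) z" for X k z
  proof -
    have "subt (list_decode z) x = lnth (map (\<lambda>j. subt (list_decode z) j) [0..<k]) x"
      if "x \<in> set (list_decode (psnd (psnd k)))" for x
    proof -
      have "x < k" using list_decode_less[OF that] psnd_le[of k] psnd_le[of "psnd k"] by linarith
      then show ?thesis by (simp add: lnth_def)
    qed
    then have "map (subt (list_decode z)) (list_decode (psnd (psnd k))) =
      map (\<lambda>x. lnth (map (\<lambda>j. subt (list_decode z) j) [0..<k]) x) (list_decode (psnd (psnd k)))"
      by auto
    then show ?thesis unfolding H_def by (subst subt.simps) (simp only:)
  qed
  moreover have "ocomp (\<lambda>X z. H X (pfst z) (list_decode (pfst (psnd z))) (psnd (psnd z)))"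
    unfolding H_def by (intro cintro)
  ultimately have "ocomp (\<lambda>X z. subt (list_decode (list_encode (e X z))) (k X z))"
    by (rule ocomp_course_of_values[where F = "\<lambda>X k z. subt (list_decode z) k" and a = k
        and b = "\<lambda>X z. list_encode (e X z)"]) (intro cintro assms)+
  then show ?thesis by simp
qed

lemma ocomp_lsub [cintro]:
  assumes "ocompl e" "ocomp k" shows "ocomp (\<lambda>X z. lsub (e X z) (k X z))"
proof -
  have "ocompl (\<lambda>X z. e X (psnd z))" by (intro ocompl_comp[OF assms(1)] cintro)
  then show ?thesis
    unfolding lsub_def asub_def by (intro cintro assms)
qed

section \<open>Certificates of computations\<close>

text \<open>An entry \<open>(p, xs, v)\<close> claims that the program with code \<open>p\<close> maps \<open>xs\<close> to \<open>v\<close>. In a certificate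
  every entry is justified by entries further right, except that oracle queries may be
  answered arbitrarily; a certificate is thus also a finite condition on the oracle.\<close>

definition entry :: "nat \<Rightarrow> nat list \<Rightarrow> nat \<Rightarrow> nat" where
  "entry pc xs v = prod_encode (pc, prod_encode (list_encode xs, v))"

abbreviation entry_args :: "nat \<Rightarrow> nat list" where "entry_args e \<equiv> list_decode (pfst (psnd e))"
abbreviation entry_val :: "nat \<Rightarrow> nat" where "entry_val e \<equiv> psnd (psnd e)"

lemma entry_sel [simp]: "pfst (entry pc xs v) = pc" "entry_args (entry pc xs v) = xs"
  "entry_val (entry pc xs v) = v"
  by (simp_all add: entry_def)

lemma entry_collapse: "entry (pfst e) (entry_args e) (entry_val e) = e"
  by (simp add: entry_def)

text \<open>The clauses mirror \<open>eval\<close> but are stated for numbers, selected by the tag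
  of \<open>pc\<close>, so that they are decidable uniformly in \<open>pc\<close>. For
  \<open>Mu\<close>, each smaller argument needs an entry of its own, which secures its
  convergence.\<close>

definition justified :: "nat list \<Rightarrow> nat \<Rightarrow> nat list \<Rightarrow> nat \<Rightarrow> bool" where
  "justified l pc xs v \<longleftrightarrow>
     pc = prog_code Zero \<and> v = 0 \<or>
     pc = prog_code Succ \<and> xs \<noteq> [] \<and> v = Suc (lnth xs 0) \<or>
     pfst pc = 2 \<and> psnd pc < length xs \<and> v = lnth xs (psnd pc) \<or>
     pc = prog_code Query \<and> xs \<noteq> [] \<and> v \<le> 1 \<or>
     pfst pc = 4 \<and> (\<exists>e\<in>set l. pfst e = pfst (psnd pc) \<and> entry_val e = v \<and>
       length (entry_args e) = length (list_decode (psnd (psnd pc))) \<and>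
       (\<forall>i<length (entry_args e).
          entry (lnth (list_decode (psnd (psnd pc))) i) xs (lnth (entry_args e) i) \<in> set l)) \<or>
     pfst pc = 5 \<and> xs \<noteq> [] \<and>
       (lnth xs 0 = 0 \<and> entry (pfst (psnd pc)) (tl xs) v \<in> set l \<or>
        lnth xs 0 \<noteq> 0 \<and> (\<exists>e\<in>set l. pfst e = pc \<and> entry_args e = (lnth xs 0 - 1) # tl xs \<and>
          entry (psnd (psnd pc)) ((lnth xs 0 - 1) # entry_val e # tl xs) v \<in> set l)) \<or>
     pfst pc = 6 \<and> entry (psnd pc) (v # xs) 0 \<in> set l \<and>
       (\<forall>m<v. \<exists>e\<in>set l. pfst e = psnd pc \<and> entry_args e = m # xs \<and> entry_val e \<noteq> 0)"

primrec certificate :: "nat list \<Rightarrow> bool" where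
  "certificate [] = True"
| "certificate (e # l) = (justified l (pfst e) (entry_args e) (entry_val e) \<and> certificate l)"

definition agrees :: "nat set \<Rightarrow> nat list \<Rightarrow> bool" where
  "agrees X c \<longleftrightarrow> (\<forall>e\<in>set c. pfst e = prog_code Query \<longrightarrow> entry_val e = of_bool (lnth (entry_args e) 0 \<in> X))"

lemma justified_mono:
  assumes "justified l pc xs v" "set l \<subseteq> set l'" shows "justified l' pc xs v"
proof -
  have *: "x \<in> set l'" if "x \<in> set l" for x using assms(2) that by blast
  show ?thesis
    using assms(1) unfolding justified_def by (elim disj_forward) (blast intro: *)+
qed

lemma justified_CompI:
  assumes "entry (prog_code f) rs v \<in> set l" "length rs = length gs"
    "\<And>i. i < length gs \<Longrightarrow> entry (prog_code (gs ! i)) xs (rs ! i) \<in> set l"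
  shows "justified l (prog_code (Comp f gs)) xs v"
  using assms
  by (simp add: justified_def)
    (rule bexI[of _ "entry (prog_code f) rs v"], auto simp: lnth_def)

lemma justified_PRecI:
  assumes "entry (prog_code (PRec f g)) (m # ys) y \<in> set l"
    "entry (prog_code g) (m # y # ys) v \<in> set l"
  shows "justified l (prog_code (PRec f g)) (Suc m # ys) v"
  using assms
  by (simp add: justified_def lnth_def)
    (rule bexI[of _ "entry (prog_code (PRec f g)) (m # ys) y"], auto)

lemma certificate_append: "certificate a \<Longrightarrow> certificate b \<Longrightarrow> certificate (a @ b)"
  by (induction a) (auto intro: justified_mono)

lemma agrees_append: "agrees X (a @ b) \<longleftrightarrow> agrees X a \<and> agrees X b"
  by (auto simp: agrees_def)

lemma certificate_sound:
  "certificate c \<Longrightarrow> agrees X c \<Longrightarrow> entry (prog_code p) xs v \<in> set c \<Longrightarrow> eval p X xs = Some v"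
proof (induction c arbitrary: p xs v)
  case (Cons e c)
  have IH: "eval p X xs = Some v" if "entry (prog_code p) xs v \<in> set c" for p xs v
    using Cons that by (auto simp: agrees_def)
  have IH': "eval p X (entry_args e') = Some (entry_val e')" if "e' \<in> set c" "pfst e' = prog_code p" for e' p
    using IH[of p "entry_args e'" "entry_val e'"] that by (metis entry_collapse)
  show ?case
  proof (cases "entry (prog_code p) xs v \<in> set c")
    case False
    then have e: "e = entry (prog_code p) xs v" using Cons.prems(3) by auto
    have j: "justified c (prog_code p) xs v" using Cons.prems(1) by (simp add: e)
    show ?thesis
    proof (cases p)
      case Zero
      then show ?thesis using j by (auto simp: justified_def)
    next
      case Succ
      then show ?thesis using j by (cases xs) (auto simp: justified_def lnth_def)
    next
      case (Proj i)
      then show ?thesis using j by (auto simp: justified_def lnth_def)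
    next
      case Query
      then have "xs \<noteq> []" using j by (auto simp: justified_def)
      moreover have "v = of_bool (lnth xs 0 \<in> X)"
        using Cons.prems(2) Query by (simp add: e agrees_def)
      ultimately show ?thesis using Query by (cases xs) (auto simp: lnth_def)
    next
      case (Comp f gs)
      then obtain e' where e': "e' \<in> set c" "pfst e' = prog_code f" "entry_val e' = v"
        "length (entry_args e') = length gs"
        "\<forall>i<length gs. entry (lnth (map prog_code gs) i) xs (lnth (entry_args e') i) \<in> set c"
        using j by (auto simp: justified_def)
      have g: "eval (gs ! i) X xs = Some (entry_args e' ! i)" if "i < length gs" for i
        using e'(4,5) that by (intro IH) (auto simp: lnth_def)
      have m: "map (\<lambda>g. eval g X xs) gs = map Some (entry_args e')"
        by (rule nth_equalityI) (auto simp: e'(4) g)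
      have "eval f X (entry_args e') = Some v" using IH'[OF e'(1,2)] e'(3) by simp
      then show ?thesis using Comp by (simp add: m)
    next
      case (PRec f g)
      then have p: "pfst (prog_code p) = 5" "pfst (psnd (prog_code p)) = prog_code f"
        "psnd (psnd (prog_code p)) = prog_code g" by auto
      then obtain k ys where xs: "xs = k # ys"
        using j by (cases xs) (auto simp: justified_def)
      show ?thesis
      proof (cases k)
        case 0
        then have "entry (prog_code f) ys v \<in> set c"
          using j p xs by (auto simp: justified_def lnth_def)
        then show ?thesis using IH PRec xs 0 by simp
      next
        case (Suc m)
        then obtain e' where e': "e' \<in> set c" "pfst e' = prog_code p" "entry_args e' = m # ys"
          "entry (prog_code g) (m # entry_val e' # ys) v \<in> set c"
          using j p xs by (auto simp: justified_def lnth_def)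
        have "eval p X (m # ys) = Some (entry_val e')" using IH'[OF e'(1,2)] e'(3) by simp
        moreover have "eval g X (m # entry_val e' # ys) = Some v" using IH e'(4) by blast
        ultimately show ?thesis using PRec xs Suc by simp
      qed
    next
      case (Mu f)
      then have v: "entry (prog_code f) (v # xs) 0 \<in> set c"
        and m: "\<forall>m<v. \<exists>e\<in>set c. pfst e = prog_code f \<and> entry_args e = m # xs \<and> entry_val e \<noteq> 0"
        using j by (auto simp: justified_def)
      have 1: "eval f X (v # xs) = Some 0" using IH v by blast
      have 2: "\<exists>y. eval f X (m # xs) = Some y \<and> y \<noteq> 0" if "m < v" for m
        using m that IH' by metis
      have "(LEAST k. eval f X (k # xs) = Some 0) = v"
      proof (rule Least_equality)
        show "v \<le> k" if "eval f X (k # xs) = Some 0" for k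
          using 2[of k] that by (cases "k < v") auto
      qed (rule 1)
      moreover have "\<exists>k. eval f X (k # xs) = Some 0 \<and> (\<forall>m<k. eval f X (m # xs) \<noteq> None)"
        using 1 2 by (intro exI[of _ v]) auto
      ultimately show ?thesis using Mu by simp
    qed
  qed (rule IH)
qed simp

definition good_cert :: "nat set \<Rightarrow> nat list \<Rightarrow> bool" where
  "good_cert X c \<longleftrightarrow> certificate c \<and> agrees X c"

lemma good_cert_append: "good_cert X a \<Longrightarrow> good_cert X b \<Longrightarrow> good_cert X (a @ b)"
  by (simp add: good_cert_def certificate_append agrees_append)

text \<open>Certificates may be concatenated, since further entries on the right only add
  justifications; finitely many claims thus share one certificate.\<close>

lemma good_cert_family:
  assumes "\<And>i::nat. i < n \<Longrightarrow> \<exists>c. good_cert X c \<and> f i \<in> set c"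
  shows "\<exists>c. good_cert X c \<and> (\<forall>i<n. f i \<in> set c)"
  using assms
proof (induction n)
  case 0
  show ?case by (intro exI[of _ "[]"]) (simp add: good_cert_def agrees_def)
next
  case (Suc n)
  then obtain c d where "good_cert X c" "\<forall>i<n. f i \<in> set c" "good_cert X d" "f n \<in> set d"
    by (metis less_Suc_eq)
  then show ?case
    by (intro exI[of _ "c @ d"]) (auto simp: good_cert_append less_Suc_eq)
qed

lemma good_cert_Cons:
  assumes "good_cert X c" "justified c (prog_code p) xs v"
    "p = Query \<Longrightarrow> v = of_bool (lnth xs 0 \<in> X)"
  shows "\<exists>c'. good_cert X c' \<and> entry (prog_code p) xs v \<in> set c'"
  using assms prog_code_inj[of p Query]
  by (intro exI[of _ "entry (prog_code p) xs v # c"]) (auto simp: good_cert_def agrees_def)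

lemma certificate_complete:
  "eval p X xs = Some v \<Longrightarrow> \<exists>c. good_cert X c \<and> entry (prog_code p) xs v \<in> set c"
proof (induction p arbitrary: xs v)
  case Zero
  then show ?case by (intro good_cert_Cons[of _ "[]"]) (auto simp: good_cert_def agrees_def justified_def)
next
  case Succ
  then show ?case by (intro good_cert_Cons[of _ "[]"])
    (auto simp: good_cert_def agrees_def justified_def lnth_def split: list.splits)
next
  case (Proj i)
  then show ?case by (intro good_cert_Cons[of _ "[]"])
    (auto simp: good_cert_def agrees_def justified_def lnth_def split: if_splits)
next
  case Query
  then show ?case by (intro good_cert_Cons[of _ "[]"])
    (auto simp: good_cert_def agrees_def justified_def lnth_def split: list.splits)
next
  case (Comp f gs)
  let ?rs = "map (\<lambda>g. eval g X xs) gs"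
  have n: "None \<notin> set ?rs" and f: "eval f X (map the ?rs) = Some v"
    using Comp.prems by (auto simp: Let_def split: if_splits)
  have "\<exists>c. good_cert X c \<and> entry (prog_code (gs ! i)) xs (the (?rs ! i)) \<in> set c" if "i < length gs" for i
  proof (rule Comp.IH(2))
    show "gs ! i \<in> set gs" using that by simp
    have "eval (gs ! i) X xs \<noteq> None" using n that by (metis length_map nth_map nth_mem)
    then show "eval (gs ! i) X xs = Some (the (?rs ! i))" using that by auto
  qed
  then obtain c where c: "good_cert X c"
    "\<forall>i<length gs. entry (prog_code (gs ! i)) xs (the (?rs ! i)) \<in> set c"
    using good_cert_family[of "length gs" X "\<lambda>i. entry (prog_code (gs ! i)) xs (the (?rs ! i))"] by blast
  obtain d where d: "good_cert X d" "entry (prog_code f) (map the ?rs) v \<in> set d"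
    using Comp.IH(1)[OF f] by blast
  show ?case
  proof (rule good_cert_Cons[OF good_cert_append[OF c(1) d(1)]])
    show "justified (c @ d) (prog_code (Comp f gs)) xs v"
      using c(2) d(2) by (intro justified_CompI[of f "map the ?rs"]) auto
  qed simp
next
  case (PRec f g)
  then obtain k ys where xs: "xs = k # ys" by (cases xs) auto
  let ?r = "\<lambda>k. eval (PRec f g) X (k # ys)"
  have "\<exists>c. good_cert X c \<and> entry (prog_code (PRec f g)) (k # ys) w \<in> set c" if "?r k = Some w" for w
    using that
  proof (induction k arbitrary: w)
    case 0
    then obtain c where c: "good_cert X c" "entry (prog_code f) ys w \<in> set c"
      using PRec.IH(1)[of ys w] by auto
    show ?case
      by (rule good_cert_Cons[OF c(1)]) (use c(2) in \<open>auto simp: justified_def lnth_def\<close>)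
  next
    case (Suc m)
    then obtain y where y: "?r m = Some y" "eval g X (m # y # ys) = Some w"
      by (auto simp: bind_eq_Some_conv)
    obtain c where c: "good_cert X c" "entry (prog_code (PRec f g)) (m # ys) y \<in> set c"
      using Suc.IH[OF y(1)] by blast
    obtain d where d: "good_cert X d" "entry (prog_code g) (m # y # ys) w \<in> set d"
      using PRec.IH(2)[OF y(2)] by blast
    show ?case
    proof (rule good_cert_Cons[OF good_cert_append[OF c(1) d(1)]])
      show "justified (c @ d) (prog_code (PRec f g)) (Suc m # ys) w"
        using c(2) d(2) by (intro justified_PRecI[of f g m _ y]) auto
    qed simp
  qed
  then show ?case using PRec.prems xs by simp
next
  case (Mu f)
  then obtain k where k: "eval f X (k # xs) = Some 0" "\<forall>m<k. eval f X (m # xs) \<noteq> None"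
    and v: "v = (LEAST k. eval f X (k # xs) = Some 0)" by (auto split: if_splits)
  have 0: "eval f X (v # xs) = Some 0" unfolding v by (rule LeastI) (rule k)
  have "v \<le> k" unfolding v by (rule Least_le) (rule k)
  have "\<exists>y. eval f X (m # xs) = Some y \<and> y \<noteq> 0" if "m < v" for m
  proof -
    have "eval f X (m # xs) \<noteq> None" using k(2) that \<open>v \<le> k\<close> by simp
    moreover have "eval f X (m # xs) \<noteq> Some 0" using that unfolding v by (rule not_less_Least)
    ultimately show ?thesis by auto
  qed
  then obtain y where y: "\<And>m. m < v \<Longrightarrow> eval f X (m # xs) = Some (y m) \<and> y m \<noteq> 0" by metis
  then obtain c where c: "good_cert X c" "\<forall>i<v. entry (prog_code f) (i # xs) (y i) \<in> set c"
    using good_cert_family[of v X "\<lambda>i. entry (prog_code f) (i # xs) (y i)"] Mu.IH by blast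
  obtain d where d: "good_cert X d" "entry (prog_code f) (v # xs) 0 \<in> set d"
    using Mu.IH[OF 0] by blast
  show ?case
  proof (rule good_cert_Cons[OF good_cert_append[OF c(1) d(1)]])
    have "\<exists>e\<in>set (c @ d). pfst e = prog_code f \<and> entry_args e = m # xs \<and> entry_val e \<noteq> 0" if "m < v" for m
      using c(2) y that by (intro bexI[of _ "entry (prog_code f) (m # xs) (y m)"]) auto
    then show "justified (c @ d) (prog_code (Mu f)) xs v"
      unfolding justified_def using d(2) by auto
  qed simp
qed

text \<open>The code of a certificate bounds all oracle positions it mentions. This yields the use
  principle, and it is the origin of the side conditions \<open>c < n\<close> on partial
  enumerations of length \<open>n\<close>.\<close>

lemma entry_less: "e \<in> set (list_decode c) \<Longrightarrow> lnth (entry_args e) 0 < c"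
proof -
  assume e: "e \<in> set (list_decode c)"
  have "lnth (entry_args e) 0 \<le> pfst (psnd e)"
    using list_decode_less[of "lnth (entry_args e) 0" "pfst (psnd e)"]
    by (auto simp: lnth_def intro: less_imp_le)
  also have "\<dots> \<le> e" using pfst_le psnd_le order_trans by blast
  also have "\<dots> < c" using e by (rule list_decode_less)
  finally show ?thesis .
qed

lemma use_principle:
  assumes "eval p X xs = Some v"
  shows "\<exists>N. \<forall>Y. (\<forall>k<N. k \<in> X \<longleftrightarrow> k \<in> Y) \<longrightarrow> eval p Y xs = Some v"
proof -
  obtain c where c: "good_cert X c" "entry (prog_code p) xs v \<in> set c"
    using certificate_complete[OF assms] by blast
  have "eval p Y xs = Some v" if Y: "\<forall>k<list_encode c. k \<in> X \<longleftrightarrow> k \<in> Y" for Y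
  proof (rule certificate_sound[OF _ _ c(2)])
    show "agrees Y c"
      using c(1) Y entry_less[of _ "list_encode c"] by (auto simp: good_cert_def agrees_def)
  qed (use c(1) in \<open>simp add: good_cert_def\<close>)
  then show ?thesis by blast
qed

lemma odec_justified:
  assumes "ocompl l" "ocomp pc" "ocompl xs" "ocomp v"
  shows "odec (\<lambda>X z. justified (l X z) (pc X z) (xs X z) (v X z))"
proof -
  have "odec (\<lambda>X z. justified (list_decode (pfst z)) (pfst (psnd z))
      (list_decode (pfst (psnd (psnd z)))) (psnd (psnd (psnd z))))"
    unfolding justified_def entry_def by (intro cintro)
  moreover have "ocomp (\<lambda>X z. prod_encode (list_encode (l X z), prod_encode (pc X z,
      prod_encode (list_encode (xs X z), v X z))))"
    by (intro cintro assms)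
  ultimately show ?thesis using odec_comp by fastforce
qed

text \<open>Replaces the recursion by a bounded quantifier, for which decidability is at
  hand.\<close>

lemma certificate_iff:
  "certificate c \<longleftrightarrow> (\<forall>i<length c. justified (drop (Suc i) c) (pfst (lnth c i)) (entry_args (lnth c i)) (entry_val (lnth c i)))"
proof (induction c)
  case (Cons e c)
  show ?case by (simp add: Cons All_less_Suc2 lnth_def)
qed simp

lemma odec_certificate [cintro]:
  assumes "ocompl c" shows "odec (\<lambda>X z. certificate (c X z))"
proof -
  have "odec (\<lambda>X z. certificate (list_decode z))"
    unfolding certificate_iff by (intro cintro odec_justified)
  from odec_comp[OF this ocomp_encode[OF assms]] show ?thesis by simp
qed

text \<open>Kleene's T predicate with \<open>c\<close> as the computation. Answering all queries by
  0 describes a run with the empty oracle.\<close>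

definition halts :: "nat \<Rightarrow> nat \<Rightarrow> nat \<Rightarrow> bool" where
  "halts pc k c \<longleftrightarrow> certificate (list_decode c) \<and>
     (\<forall>e\<in>set (list_decode c). pfst e = prog_code Query \<longrightarrow> entry_val e = 0) \<and>
     (\<exists>e\<in>set (list_decode c). pfst e = pc \<and> entry_args e = [k])"

lemma ce_set_halts: "k \<in> ce_set p \<longleftrightarrow> (\<exists>c. halts (prog_code p) k c)"
proof
  assume "k \<in> ce_set p"
  then obtain v where "eval p {} [k] = Some v" by (auto simp: ce_set_def)
  then obtain c where "good_cert {} c" "entry (prog_code p) [k] v \<in> set c"
    using certificate_complete by blast
  then have "halts (prog_code p) k (list_encode c)"
    by (auto simp: halts_def good_cert_def agrees_def intro!: bexI[of _ "entry (prog_code p) [k] v"])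
  then show "\<exists>c. halts (prog_code p) k c" ..
next
  assume "\<exists>c. halts (prog_code p) k c"
  then obtain c e where "certificate (list_decode c)" "agrees {} (list_decode c)"
    "e \<in> set (list_decode c)" "pfst e = prog_code p" "entry_args e = [k]"
    by (auto simp: halts_def agrees_def)
  moreover from this have "entry (prog_code p) [k] (entry_val e) = e"
    using entry_collapse[of e] by simp
  ultimately have "eval p {} [k] = Some (entry_val e)"
    using certificate_sound by metis
  then show "k \<in> ce_set p" by (simp add: ce_set_def)
qed

lemma odec_halts [cintro]:
  assumes "ocomp pc" "ocomp k" "ocomp c" shows "odec (\<lambda>X z. halts (pc X z) (k X z) (c X z))"
proof -
  have "odec (\<lambda>X z. halts (pfst z) (pfst (psnd z)) (psnd (psnd z)))"
    unfolding halts_def by (intro cintro)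
  then show ?thesis using assms by (rule odec_comp3)
qed

subsection \<open>Codes of programs\<close>

text \<open>A triangular number is at least its index, so a nonzero first component makes the code
  strictly larger. The constructors below which recursion on codes descends all have nonzero
  tags.\<close>

lemma psnd_less: "pfst k \<noteq> 0 \<Longrightarrow> psnd k < k"
proof -
  assume k: "pfst k \<noteq> 0"
  have "n \<le> triangle n" for n by (induction n) auto
  then have "pfst k + psnd k \<le> triangle (pfst k + psnd k)" .
  moreover have "triangle (pfst k + psnd k) + pfst k = k"
    using diag_index_bounds(1)[of k] by (simp add: diag_index_def)
  ultimately show ?thesis using k by linarith
qed

text \<open>A recursion on codes by which the range becomes decidable. It is wanted because
  \<open>ce_disj\<close> takes account only of numbers that code programs.\<close>

lemma range_prog_code:
  "k \<in> range prog_code \<longleftrightarrow>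
     k = prog_code Zero \<or> k = prog_code Succ \<or> k = prog_code Query \<or> pfst k = 2 \<or>
     pfst k = 4 \<and> pfst (psnd k) \<in> range prog_code \<and>
       (\<forall>x\<in>set (list_decode (psnd (psnd k))). x \<in> range prog_code) \<or>
     pfst k = 5 \<and> pfst (psnd k) \<in> range prog_code \<and> psnd (psnd k) \<in> range prog_code \<or>
     pfst k = 6 \<and> psnd k \<in> range prog_code" (is "?l \<longleftrightarrow> ?r")
proof
  assume ?l
  then obtain p where "k = prog_code p" by blast
  then show ?r by (cases p) auto
next
  have *: "\<exists>us. l = map prog_code us" if "\<forall>x\<in>set l. x \<in> range prog_code" for l
    using that by (simp add: ex_map_conv image_iff)
  assume ?r
  then consider "k = prog_code Zero \<or> k = prog_code Succ \<or> k = prog_code Query" | "pfst k = 2"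
    | f gs where "pfst k = 4" "pfst (psnd k) = prog_code f"
        "list_decode (psnd (psnd k)) = map prog_code gs"
    | f g where "pfst k = 5" "pfst (psnd k) = prog_code f" "psnd (psnd k) = prog_code g"
    | f where "pfst k = 6" "psnd k = prog_code f"
    by (elim disjE conjE rangeE) (use * in blast)+
  then show ?l
  proof cases
    case 2
    then have "k = prog_code (Proj (psnd k))" using prod_encode_pfst_psnd[of k] by simp
    then show ?thesis by blast
  next
    case (3 f gs)
    then have "k = prog_code (Comp f gs)"
      using prod_encode_pfst_psnd[of k] by (simp flip: 3)
    then show ?thesis by blast
  next
    case (4 f g)
    then have "k = prog_code (PRec f g)"
      using prod_encode_pfst_psnd[of k] by (simp flip: 4)
    then show ?thesis by blast
  next
    case (5 f)
    then have "k = prog_code (Mu f)"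
      using prod_encode_pfst_psnd[of k] by (simp flip: 5)
    then show ?thesis by blast
  qed blast
qed

lemma odec_range_prog_code [cintro]:
  assumes "ocomp k" shows "odec (\<lambda>X z. k X z \<in> range prog_code)"
proof -
  define H where "H X k T z = (of_bool (
     k = prog_code Zero \<or> k = prog_code Succ \<or> k = prog_code Query \<or> pfst k = 2 \<or>
     pfst k = 4 \<and> lnth T (pfst (psnd k)) = 1 \<and>
       (\<forall>x\<in>set (list_decode (psnd (psnd k))). lnth T x = 1) \<or>
     pfst k = 5 \<and> lnth T (pfst (psnd k)) = 1 \<and> lnth T (psnd (psnd k)) = 1 \<or>
     pfst k = 6 \<and> lnth T (psnd k) = 1) :: nat)" for X :: "nat set" and k T and z :: nat
  define R where "R = range prog_code"
  have "of_bool (k \<in> R) = H X k (map (\<lambda>j. of_bool (j \<in> R)) [0..<k]) z" for X k z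
  proof -
    let ?T = "map (\<lambda>j. of_bool (j \<in> R)) [0..<k]"
    have T: "lnth ?T x = 1 \<longleftrightarrow> x \<in> R" if "x < k" for x
      using that by (simp add: lnth_def)
    have lt: "psnd k < k" "pfst (psnd k) < k" "psnd (psnd k) < k" if "pfst k \<noteq> 0"
      using psnd_less[OF that] pfst_le[of "psnd k"] psnd_le[of "psnd k"] by linarith+
    have 2: "x < k" if "x \<in> set (list_decode (psnd (psnd k)))" for x
      using list_decode_less[OF that] psnd_le[of "psnd k"] psnd_le[of k] by linarith
    have "pfst k = 4 \<and> lnth ?T (pfst (psnd k)) = 1 \<and>
        (\<forall>x\<in>set (list_decode (psnd (psnd k))). lnth ?T x = 1) \<longleftrightarrow>
      pfst k = 4 \<and> pfst (psnd k) \<in> R \<and> (\<forall>x\<in>set (list_decode (psnd (psnd k))). x \<in> R)"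
      by (intro conj_cong ball_cong refl T 2 lt) simp
    moreover have "pfst k = 5 \<and> lnth ?T (pfst (psnd k)) = 1 \<and> lnth ?T (psnd (psnd k)) = 1 \<longleftrightarrow>
      pfst k = 5 \<and> pfst (psnd k) \<in> R \<and> psnd (psnd k) \<in> R"
      by (intro conj_cong refl T lt) simp_all
    moreover have "pfst k = 6 \<and> lnth ?T (psnd k) = 1 \<longleftrightarrow> pfst k = 6 \<and> psnd k \<in> R"
      by (intro conj_cong refl T lt) simp
    ultimately show ?thesis
      unfolding H_def using range_prog_code[of k, folded R_def] by presburger
  qed
  moreover have "ocomp (\<lambda>X z. H X (pfst z) (list_decode (pfst (psnd z))) (psnd (psnd z)))"
    unfolding H_def by (intro cintro)
  ultimately have "ocomp (\<lambda>X z. of_bool (k X z \<in> R))"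
    by (rule ocomp_course_of_values[where F = "\<lambda>X k z. of_bool (k \<in> R)" and H = H and a = k
        and b = "\<lambda>X z. 0"]) (intro cintro assms)+
  then show ?thesis by (simp add: odec_def R_def)
qed

primrec const_prog :: "nat \<Rightarrow> prog" where
  "const_prog 0 = Zero"
| "const_prog (Suc n) = Comp Succ [const_prog n]"

lemma eval_const_prog [simp]: "eval (const_prog n) X xs = Some n"
  by (induction n) auto

lemma ocomp_const_prog [cintro]:
  assumes "ocomp f" shows "ocomp (\<lambda>X z. prog_code (const_prog (f X z)))"
proof -
  have "prog_code (const_prog n) =
    rec_nat (prog_code Zero) (\<lambda>m r. prod_encode (4, prod_encode (prog_code Succ, list_encode [r]))) n" for n
    by (induction n) (auto simp: numeral_eq_Suc)
  then show ?thesis by (simp only:) (intro cintro assms)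
qed

text \<open>The s-m-n theorem: the parameter \<open>z\<close> is wired into the program by
  \<open>const_prog\<close>, and membership is a search for \<open>w\<close>.\<close>

lemma ce_index:
  assumes "odec (\<lambda>X y. R (pfst y) (pfst (psnd y)) (psnd (psnd y)))"
  obtains q where "ocomp (\<lambda>X z. prog_code (q z))" "\<And>z. ce_set (q z) = {k. \<exists>w. R z k w}"
proof -
  obtain r where r: "\<And>X y. eval r X [y] = Some (of_bool (\<not> R (pfst y) (pfst (psnd y)) (psnd (psnd y))))"
    using odec_not[OF assms] unfolding odec_def ocomp_def by blast
  \<comment> \<open>\<open>Mu\<close> puts the searched number in front, so \<open>Proj 0\<close> is
    \<open>w\<close> and \<open>Proj 1\<close> is \<open>k\<close>.\<close>
  define q where "q z = Mu (Comp r [Comp pair_prog [const_prog z, Comp pair_prog [Proj 1, Proj 0]]])" for z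
  have "ocomp (\<lambda>X z. prog_code (q z))"
    unfolding q_def prog_code.simps list.map by (intro cintro)
  moreover have "ce_set (q z) = {k. \<exists>w. R z k w}" for z
    by (simp add: ce_set_def q_def r)
  ultimately show ?thesis by (rule that)
qed

section \<open>Guessing in the limit\<close>

text \<open>When exactly one of \<open>\<exists>w. \<forall>t. P X w t\<close> and \<open>\<exists>w. \<forall>t. Q X w t\<close> holds, believe the one whose
  least unrefuted witness is smaller.\<close>

definition guess :: "(nat set \<Rightarrow> nat \<Rightarrow> nat \<Rightarrow> bool) \<Rightarrow> (nat set \<Rightarrow> nat \<Rightarrow> nat \<Rightarrow> bool) \<Rightarrow>
    nat set \<Rightarrow> nat \<Rightarrow> bool" where
  "guess P Q X s \<longleftrightarrow> (\<exists>w\<le>s. (\<forall>t<s. P X w t) \<and> (\<forall>w'<w. \<exists>t<s. \<not> Q X w' t))"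

lemma odec_guess:
  assumes "odec (\<lambda>X z. P X (pfst z) (psnd z))" "odec (\<lambda>X z. Q X (pfst z) (psnd z))"
  shows "odec (guess P Q)"
  unfolding guess_def
  by (intro cintro odec_comp2[OF assms(1)] odec_comp2[OF assms(2)])

lemma bounded_witnesses:
  assumes "\<And>w::nat. w < n \<Longrightarrow> \<exists>t::nat. P w t" shows "\<exists>s. \<forall>w<n. \<exists>t<s. P w t"
proof -
  obtain f where f: "\<And>w. w < n \<Longrightarrow> P w (f w)" using assms by metis
  have "f w < Suc (Max (f ` {..<n}))" if "w < n" for w
    using that by (simp add: less_Suc_eq_le)
  then show ?thesis using f by blast
qed

lemma guess_true:
  assumes "\<exists>w. \<forall>t. P X w t" "\<not> (\<exists>w. \<forall>t. Q X w t)" shows "\<exists>s0. \<forall>s\<ge>s0. guess P Q X s"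
proof -
  obtain w where w: "\<forall>t. P X w t" using assms(1) by blast
  obtain s1 where s1: "\<forall>w'<w. \<exists>t<s1. \<not> Q X w' t"
    using bounded_witnesses[of w "\<lambda>w' t. \<not> Q X w' t"] assms(2) by blast
  have "guess P Q X s" if s: "s \<ge> max w s1" for s
  proof -
    have "\<exists>t<s. \<not> Q X w' t" if "w' < w" for w'
      using s1 that s by (meson less_le_trans max.bounded_iff)
    moreover have "w \<le> s" using s by simp
    ultimately show ?thesis unfolding guess_def using w by blast
  qed
  then show ?thesis by blast
qed

text \<open>Let \<open>v\<close> be a permanent witness for \<open>Q\<close>. When all candidates
  for \<open>P\<close> up to \<open>v\<close> are refuted, only larger ones remain, and these are
  blocked by \<open>v\<close>.\<close>

lemma guess_false:
  assumes "\<not> (\<exists>w. \<forall>t. P X w t)" "\<exists>w. \<forall>t. Q X w t" shows "\<exists>s0. \<forall>s\<ge>s0. \<not> guess P Q X s"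
proof -
  obtain v where v: "\<forall>t. Q X v t" using assms(2) by blast
  \<comment> \<open>\<open>Suc v\<close> and not \<open>v\<close>, because \<open>guess\<close>
    resolves a tie in favour of \<open>P\<close>.\<close>
  obtain s0 where s0: "\<forall>w<Suc v. \<exists>t<s0. \<not> P X w t"
    using bounded_witnesses[of "Suc v" "\<lambda>w' t. \<not> P X w' t"] assms(1) by blast
  have "\<not> guess P Q X s" if "s \<ge> s0" for s
  proof
    assume "guess P Q X s"
    then obtain w where w: "\<forall>t<s. P X w t" "\<forall>w'<w. \<exists>t<s. \<not> Q X w' t" by (auto simp: guess_def)
    show False
    proof (cases "w < Suc v")
      case True
      then show False using s0 w(1) that by (meson less_le_trans)
    next
      case False
      then have "v < w" by simp
      then show False using w(2) v by blast
    qed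
  qed
  then show ?thesis by blast
qed

section \<open>Orders built from guesses\<close>

text \<open>Stage \<open>j\<close> puts the new point \<open>j\<close> above all earlier ones if
  \<open>g j\<close> holds and below them otherwise. Hence a comparison depends only on the guess at
  the later point and is never revised.\<close>

definition ord_le :: "(nat \<Rightarrow> bool) \<Rightarrow> nat \<Rightarrow> nat \<Rightarrow> bool" where
  "ord_le g i j \<longleftrightarrow> i = j \<or> i < j \<and> g j \<or> j < i \<and> \<not> g i"

definition ord_struct :: "(nat \<Rightarrow> bool) \<Rightarrow> struct" where
  "ord_struct g = \<lparr>univ = UNIV, rel_int = (\<lambda>_ xs. ord_le g (xs ! 0) (xs ! 1)), fun_int = (\<lambda>_ _. 0)\<rparr>"

text \<open>The first \<open>n\<close> points form a chain, and \<open>h\<close> is the position in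
  it. A new top point gets position \<open>n\<close>; a new bottom point gets 0 and shifts the
  others.\<close>

lemma ord_le_initial:
  "\<exists>h. bij_betw h {..<n} {..<n} \<and> (\<forall>i<n. \<forall>j<n. ord_le g i j \<longleftrightarrow> h i \<le> h j)"
proof (induction n)
  case 0
  show ?case by (intro exI[of _ id]) (simp add: bij_betw_def)
next
  case (Suc n)
  then obtain h where h: "bij_betw h {..<n} {..<n}" "\<forall>i<n. \<forall>j<n. ord_le g i j \<longleftrightarrow> h i \<le> h j"
    by blast
  have less: "h i < n" if "i < n" for i using h(1) that by (auto simp: bij_betw_def)
  show ?case
  proof (cases "g n")
    case True
    define k where "k = h(n := n)"
    have "bij_betw k {..<n} {..<n} \<longleftrightarrow> bij_betw h {..<n} {..<n}"
      by (rule bij_betw_cong) (simp add: k_def)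
    with h(1) have "bij_betw k ({..<n} \<union> {n}) ({..<n} \<union> {n})"
      by (intro bij_betw_combine) (auto simp: k_def bij_betw_def)
    moreover have "{..<n} \<union> {n} = {..<Suc n}" by auto
    moreover have "ord_le g i j \<longleftrightarrow> k i \<le> k j" if "i < Suc n" "j < Suc n" for i j
      using h(2) that True less[of i] less[of j] by (auto simp: k_def less_Suc_eq ord_le_def)
    ultimately show ?thesis by auto
  next
    case False
    define k where "k i = (if i = n then 0 else Suc (h i))" for i
    have "bij_betw Suc {..<n} {0<..n}"
      by (rule bij_betw_byWitness[where f' = "\<lambda>i. i - 1"]) auto
    then have "bij_betw (Suc \<circ> h) {..<n} {0<..n}" using bij_betw_trans[OF h(1)] by blast
    moreover have "bij_betw k {..<n} {0<..n} \<longleftrightarrow> bij_betw (Suc \<circ> h) {..<n} {0<..n}"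
      by (rule bij_betw_cong) (simp add: k_def)
    ultimately have "bij_betw k ({..<n} \<union> {n}) ({0<..n} \<union> {0})"
      by (intro bij_betw_combine) (auto simp: k_def bij_betw_def)
    moreover have "{..<n} \<union> {n} = {..<Suc n}" "{0<..n} \<union> {0} = {..<Suc n}" by auto
    moreover have "ord_le g i j \<longleftrightarrow> k i \<le> k j" if "i < Suc n" "j < Suc n" for i j
      using h(2) that False less[of i] less[of j] by (auto simp: k_def less_Suc_eq ord_le_def)
    ultimately show ?thesis by auto
  qed
qed

text \<open>From \<open>s0\<close> on every point goes on top, so an increasing sequence follows a
  finite chain.\<close>

lemma ord_le_omega:
  assumes "\<forall>s\<ge>s0. g s" shows "\<exists>h :: nat \<Rightarrow> nat. bij h \<and> (\<forall>i j. ord_le g i j \<longleftrightarrow> h i \<le> h j)"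
proof -
  obtain h where h: "bij_betw h {..<s0} {..<s0}" "\<forall>i<s0. \<forall>j<s0. ord_le g i j \<longleftrightarrow> h i \<le> h j"
    using ord_le_initial by blast
  define k where "k i = (if i < s0 then h i else i)" for i
  have less: "h i < s0" if "i < s0" for i using h(1) that by (auto simp: bij_betw_def)
  have "bij_betw k {..<s0} {..<s0} \<longleftrightarrow> bij_betw h {..<s0} {..<s0}"
    by (rule bij_betw_cong) (simp add: k_def)
  moreover have "bij_betw k {s0..} {s0..} \<longleftrightarrow> bij_betw id {s0..} {s0..}"
    by (rule bij_betw_cong) (simp add: k_def)
  ultimately have "bij_betw k ({..<s0} \<union> {s0..}) ({..<s0} \<union> {s0..})"
    using h(1) by (intro bij_betw_combine) auto
  moreover have "{..<s0} \<union> {s0..} = UNIV" by auto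
  moreover have "ord_le g i j \<longleftrightarrow> k i \<le> k j" for i j
    using h(2) assms less[of i] less[of j] by (auto simp: k_def ord_le_def not_less)
  ultimately show ?thesis by metis
qed

lemma is_structure_order: "is_structure order_lang S"
  by (simp add: is_structure_def order_lang_def)

lemma tuples2: "xs \<in> tuples S 2 \<longleftrightarrow> (\<exists>a b. xs = [a, b] \<and> a \<in> univ S \<and> b \<in> univ S)"
  by (auto simp: tuples_def length_Suc_conv numeral_2_eq_2)

lemma isomorphic_order:
  "isomorphic order_lang S T \<longleftrightarrow> (\<exists>h. bij_betw h (univ S) (univ T) \<and>
     (\<forall>a\<in>univ S. \<forall>b\<in>univ S. rel_int S 0 [a, b] \<longleftrightarrow> rel_int T 0 [h a, h b]))"
proof -
  have "(\<forall>xs\<in>tuples S 2. P xs) \<longleftrightarrow> (\<forall>a\<in>univ S. \<forall>b\<in>univ S. P [a, b])" for P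
    using tuples2 by metis
  then show ?thesis unfolding isomorphic_def by (simp add: order_lang_def)
qed

lemma ord_struct_omega: "\<forall>s\<ge>s0. g s \<Longrightarrow> ord_struct g \<in> copies order_lang omega"
  using ord_le_omega[of s0 g]
  by (auto simp: copies_def is_structure_order isomorphic_order ord_struct_def omega_def)

lemma ord_le_not: "ord_le (\<lambda>s. \<not> g s) i j \<longleftrightarrow> ord_le g j i"
  by (auto simp: ord_le_def)

lemma ord_struct_omega_star: "\<forall>s\<ge>s0. \<not> g s \<Longrightarrow> ord_struct g \<in> copies order_lang omega_star"
  using ord_le_omega[of s0 "\<lambda>s. \<not> g s"]
  by (auto simp: copies_def is_structure_order isomorphic_order ord_struct_def omega_star_def ord_le_not)

lemma omega_not_iso: "\<not> isomorphic order_lang omega omega_star"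
proof
  assume "isomorphic order_lang omega omega_star"
  then obtain h :: "nat \<Rightarrow> nat" where h: "bij h" "\<forall>a b. a \<le> b \<longleftrightarrow> h b \<le> h a"
    by (auto simp: isomorphic_order omega_def omega_star_def)
  obtain j where "h j = Suc (h 0)" using h(1) by (metis bij_pointE)
  then show False using h(2)[rule_format, of 0 j] by simp
qed

text \<open>Without function symbols only four shapes of literals are well formed, and their
  variables are bounded by the code. The diagram is therefore decided by a bounded search.\<close>

lemma diagram_ord_struct:
  "k \<in> diagram order_lang (ord_struct g) \<longleftrightarrow> (\<exists>i\<le>k. \<exists>j\<le>k.
     k = qf_code (Eq (Var i) (Var j)) \<and> i = j \<or>
     k = qf_code (Neg (Eq (Var i) (Var j))) \<and> i \<noteq> j \<or>
     k = qf_code (Rel 0 [Var i, Var j]) \<and> ord_le g i j \<or>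
     k = qf_code (Neg (Rel 0 [Var i, Var j])) \<and> \<not> ord_le g i j)" (is "_ \<longleftrightarrow> ?r")
proof
  assume "k \<in> diagram order_lang (ord_struct g)"
  then obtain \<phi> where \<phi>: "k = qf_code \<phi>" "wf_qf order_lang \<phi>" "literal \<phi>"
    "qf_holds (ord_struct g) (\<lambda>a. a) \<phi>" by (auto simp: diagram_def)
  have v: "\<exists>i. t = Var i" if "wf_tm order_lang t" for t
    using that by (cases t) (auto simp: order_lang_def)
  have v2: "\<exists>i j. ts = [Var i, Var j]" if "list_all (wf_tm order_lang) ts" "length ts = 2" for ts
    using that v by (auto simp: length_Suc_conv numeral_2_eq_2)
  have "\<exists>i j. \<phi> = Eq (Var i) (Var j) \<and> i = j \<or>
     \<phi> = Neg (Eq (Var i) (Var j)) \<and> i \<noteq> j \<or>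
     \<phi> = Rel 0 [Var i, Var j] \<and> ord_le g i j \<or>
     \<phi> = Neg (Rel 0 [Var i, Var j]) \<and> \<not> ord_le g i j"
    using \<phi>(3)
  proof (cases rule: literal_cases)
    case (1 r ts)
    then have "r = 0" "length ts = 2" "list_all (wf_tm order_lang) ts"
      using \<phi>(2) by (auto simp: order_lang_def)
    with v2 obtain i j where "ts = [Var i, Var j]" by blast
    with 1 \<phi>(4) \<open>r = 0\<close> show ?thesis by (auto simp: ord_struct_def)
  next
    case (2 s t)
    then show ?thesis using \<phi>(2,4) v[of s] v[of t] by auto
  next
    case (3 r ts)
    then have "r = 0" "length ts = 2" "list_all (wf_tm order_lang) ts"
      using \<phi>(2) by (auto simp: order_lang_def)
    with v2 obtain i j where "ts = [Var i, Var j]" by blast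
    with 3 \<phi>(4) \<open>r = 0\<close> show ?thesis by (auto simp: ord_struct_def)
  next
    case (4 s t)
    then show ?thesis using \<phi>(2,4) v[of s] v[of t] by auto
  qed
  then obtain i j where ij: "\<phi> = Eq (Var i) (Var j) \<and> i = j \<or>
     \<phi> = Neg (Eq (Var i) (Var j)) \<and> i \<noteq> j \<or>
     \<phi> = Rel 0 [Var i, Var j] \<and> ord_le g i j \<or>
     \<phi> = Neg (Rel 0 [Var i, Var j]) \<and> \<not> ord_le g i j" by blast
  then have "i \<le> k" "j \<le> k"
    using qf_vars_le_code[of i \<phi>] qf_vars_le_code[of j \<phi>] by (auto simp: \<phi>(1) simp del: qf_code.simps)
  then show ?r using ij unfolding \<phi>(1) by blast
next
  assume ?r
  then show "k \<in> diagram order_lang (ord_struct g)"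
    by (auto simp: diagram_def ord_struct_def order_lang_def image_iff simp del: qf_code.simps) 
qed

lemma odec_diagram_ord_struct:
  assumes "odec g" shows "odec (\<lambda>X k. k \<in> diagram order_lang (ord_struct (g X)))"
proof -
  show ?thesis
    unfolding diagram_ord_struct ord_le_def qf_code.simps tm_code.simps list.map
    by (intro cintro odec_comp[OF assms])
qed

lemma odec_computes:
  assumes "odec P" obtains p where "\<And>X. computes_set p X {k. P X k}"
  using assms unfolding odec_def ocomp_def computes_set_def by auto

lemma computable_set_odec:
  assumes "odec (\<lambda>X k. k \<in> Y)" shows "computable_set Y"
  using assms unfolding odec_def ocomp_def computable_set_def computes_set_def by blast

subsection \<open>Replacing the oracle by a program\<close>

primrec query_subst :: "prog \<Rightarrow> prog \<Rightarrow> prog" where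
  "query_subst r Zero = Zero"
| "query_subst r Succ = Succ"
| "query_subst r (Proj i) = Proj i"
| "query_subst r Query = Comp r [Proj 0]"
| "query_subst r (Comp f gs) = Comp (query_subst r f) (map (query_subst r) gs)"
| "query_subst r (PRec f g) = PRec (query_subst r f) (query_subst r g)"
| "query_subst r (Mu f) = Mu (query_subst r f)"

lemma eval_query_subst:
  assumes "computes_set r Y X" shows "eval (query_subst r p) Y xs = eval p X xs"
proof (induction p arbitrary: xs)
  case Query
  then show ?case using assms by (auto simp: computes_set_def split: list.splits)
next
  case (Comp f gs)
  have "map (\<lambda>g. eval g Y xs) (map (query_subst r) gs) = map (\<lambda>g. eval g X xs) gs"
    using Comp.IH(2) by auto
  then show ?case using Comp.IH(1) by (simp only: eval.simps query_subst.simps)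
qed (auto split: list.splits)

lemma computable_set_trans:
  assumes "computable_set X" "computes_set p X Y" shows "computable_set Y"
  using assms eval_query_subst unfolding computable_set_def computes_set_def by metis

text \<open>Computability refers to the empty oracle; answering queries by \<open>Zero\<close> makes
  the same program correct under every oracle.\<close>

lemma odec_computable_set:
  assumes "computable_set Y" "ocomp f" shows "odec (\<lambda>X z. f X z \<in> Y)"
proof -
  obtain p where p: "computes_set p {} Y" using assms(1) by (auto simp: computable_set_def)
  have "computes_set Zero X {}" for X by (simp add: computes_set_def)
  then have "eval (query_subst Zero p) X [k] = Some (of_bool (k \<in> Y))" for X k
    using p by (simp add: eval_query_subst computes_set_def)
  then have "odec (\<lambda>X z. z \<in> Y)" unfolding odec_def ocomp_def by blast
  then show ?thesis using assms(2) by (rule odec_comp)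
qed

section \<open>From orders to the two structures\<close>

definition true_fml :: qf where "true_fml = Eq (Var 0) (Var 0)"

primrec conjs :: "qf list \<Rightarrow> qf" where
  "conjs [] = true_fml"
| "conjs (\<phi> # \<phi>s) = Conj \<phi> (conjs \<phi>s)"

lemma conjs_holds [simp]: "qf_holds S v (conjs \<phi>s) \<longleftrightarrow> (\<forall>\<phi>\<in>set \<phi>s. qf_holds S v \<phi>)"
  by (induction \<phi>s) (auto simp: true_fml_def)

lemma conjs_wf [simp]: "wf_qf L (conjs \<phi>s) \<longleftrightarrow> (\<forall>\<phi>\<in>set \<phi>s. wf_qf L \<phi>)"
  by (induction \<phi>s) (auto simp: true_fml_def)

lemma conjs_vars [simp]: "qf_vars (conjs \<phi>s) = insert 0 (\<Union>\<phi>\<in>set \<phi>s. qf_vars \<phi>)"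
  by (induction \<phi>s) (auto simp: true_fml_def)

definition distinct_fml :: "nat \<Rightarrow> qf" where
  "distinct_fml n = conjs (map (\<lambda>i. conjs (map (\<lambda>j. Neg (Eq (Var i) (Var j))) [0..<i])) [0..<n])"

lemma distinct_fml_holds: "qf_holds S ((!) xs) (distinct_fml (length xs)) \<longleftrightarrow> distinct xs"
proof -
  have "distinct xs \<longleftrightarrow> (\<forall>i<length xs. \<forall>j<i. xs ! i \<noteq> xs ! j)"
    unfolding distinct_conv_nth
  proof (intro iffI allI impI)
    fix i j assume *: "\<forall>i<length xs. \<forall>j<i. xs ! i \<noteq> xs ! j" "i < length xs" "j < length xs" "i \<noteq> j"
    show "xs ! i \<noteq> xs ! j"
      using *(4) by (cases rule: linorder_neqE_nat) (use * in \<open>auto dest: sym\<close>)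
  qed auto
  then show ?thesis by (auto simp: distinct_fml_def)
qed

lemma distinct_fml_wf [simp]: "wf_qf L (distinct_fml n)"
  by (simp add: distinct_fml_def)

text \<open>Every conjunction ends in \<open>true_fml\<close>, which mentions variable 0; this is
  why \<open>n\<close> must be positive and why empty parts are treated separately below.\<close>

lemma distinct_fml_vars: "0 < n \<Longrightarrow> qf_vars (distinct_fml n) \<subseteq> {..<n}"
  by (auto simp: distinct_fml_def)

text \<open>Only finitely many literals have a code below \<open>length r\<close>. Their truth
  values on \<open>r\<close>, together with distinctness, form one existential sentence that holds
  in \<open>S\<close>, hence in \<open>T\<close>.\<close>

lemma equiv1_match:
  assumes "equiv1 L S T" "distinct r" "set r \<subseteq> univ S"
  shows "\<exists>xs. length xs = length r \<and> set xs \<subseteq> univ T \<and> distinct xs \<and>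
    (\<forall>k<length r. k \<in> sat_diag L S ((!) r) \<longleftrightarrow> k \<in> sat_diag L T ((!) xs))"
proof (cases "r = []")
  case True
  then show ?thesis by auto
next
  case False
  let ?n = "length r" and ?M = "{\<phi>. wf_qf L \<phi> \<and> literal \<phi> \<and> qf_code \<phi> < length r}"
  have "finite (qf_code ` ?M)" by (rule finite_subset[of _ "{..<?n}"]) auto
  then have "finite ?M" by (rule finite_imageD) (simp add: inj_on_def)
  then obtain ms where ms: "set ms = ?M" using finite_list by blast
  define lit where "lit \<phi> = (if qf_holds S ((!) r) \<phi> then \<phi> else Neg \<phi>)" for \<phi>
  define \<psi> where "\<psi> = conjs (distinct_fml ?n # map lit ms)"
  have "qf_vars \<phi> \<subseteq> {..<?n}" if "\<phi> \<in> ?M" for \<phi>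
    using qf_vars_le_code[of _ \<phi>] that by fastforce
  moreover have "wf_qf L (lit \<phi>) = wf_qf L \<phi>" "qf_vars (lit \<phi>) = qf_vars \<phi>" for \<phi>
    by (simp_all add: lit_def)
  ultimately have sent: "(?n, \<psi>) \<in> ex_sentences L"
    using distinct_fml_vars[of ?n] False ms by (auto simp: ex_sentences_def \<psi>_def)
  have "qf_holds S ((!) r) \<psi>"
    using assms(2) by (auto simp: \<psi>_def distinct_fml_holds lit_def)
  then have "ex_holds S (?n, \<psi>)"
    using assms(3) by (auto simp: ex_holds_def tuples_def)
  then have "ex_holds T (?n, \<psi>)" using assms(1) sent by (auto simp: equiv1_def)
  then obtain xs where xs: "length xs = ?n" "set xs \<subseteq> univ T" "qf_holds T ((!) xs) \<psi>"
    by (auto simp: ex_holds_def tuples_def)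
  have "distinct xs" using xs(3) distinct_fml_holds[of T xs] by (simp add: \<psi>_def xs(1))
  moreover have "qf_holds S ((!) r) \<phi> \<longleftrightarrow> qf_holds T ((!) xs) \<phi>" if "\<phi> \<in> ?M" for \<phi>
  proof -
    have "qf_holds T ((!) xs) (lit \<phi>)" using xs(3) that ms by (simp add: \<psi>_def)
    then show ?thesis by (auto simp: lit_def split: if_splits)
  qed
  ultimately show ?thesis
    using xs(1,2) by (intro exI[of _ xs]) (auto simp: sat_diag_def image_iff)
qed

lemma ex_holds_iso:
  assumes "T \<in> copies L S" "\<sigma> \<in> ex_sentences L" "ex_holds T \<sigma>" shows "ex_holds S \<sigma>"
proof -
  obtain n \<psi> where \<sigma>: "\<sigma> = (n, \<psi>)" "wf_qf L \<psi>" "qf_vars \<psi> \<subseteq> {..<n}"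
    using assms(2) by (auto simp: ex_sentences_def)
  obtain h where h: "iso_map L T S h" and T: "is_structure L T"
    using assms(1) by (auto simp: copies_def isomorphic_iff)
  obtain xs where xs: "xs \<in> tuples T n" "qf_holds T ((!) xs) \<psi>"
    using assms(3) by (auto simp: ex_holds_def \<sigma>)
  have len: "length xs = n" using xs(1) by (simp add: tuples_def)
  have "qf_holds S (\<lambda>i. h (xs ! i)) \<psi>"
  proof -
    have "xs ! i \<in> univ T" if "i \<in> qf_vars \<psi>" for i
    proof -
      have "i < length xs" using that \<sigma>(3) len by auto
      then have "xs ! i \<in> set xs" by simp
      then show ?thesis using xs(1) by (auto simp: tuples_def)
    qed
    then show ?thesis using iso_map_qf_holds[OF h T \<sigma>(2), of "(!) xs"] xs(2) by blast
  qed
  moreover have "qf_holds S (\<lambda>i. h (xs ! i)) \<psi> = qf_holds S ((!) (map h xs)) \<psi>"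
    using \<sigma>(3) len by (intro qf_holds_cong) (auto dest!: subsetD)
  ultimately show ?thesis
    using iso_map_tuples[OF h xs(1)] by (auto simp: ex_holds_def \<sigma>)
qed

lemma equiv1_copies:
  assumes "S' \<in> copies L S" "T' \<in> copies L T" "is_structure L S" "is_structure L T"
  shows "equiv1 L S' T' \<longleftrightarrow> equiv1 L S T"
  unfolding equiv1_def using ex_holds_iso copies_sym assms by metis

lemma diagram_univ: "qf_code (Eq (Var x) (Var x)) \<in> diagram L S \<longleftrightarrow> x \<in> univ S"
  by (auto simp: diagram_def image_iff simp del: qf_code.simps)

text \<open>The structure is built along a guess \<open>g\<close>: whenever the guess changes, the finite part built so
  far is carried over to the other structure, in which it is realised by \<open>equiv1\<close>.\<close>

locale limit_copy =
  fixes L :: lang and A B :: struct and g :: "nat set \<Rightarrow> nat \<Rightarrow> bool"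
  assumes structures: "is_structure L A" "is_structure L B"
    and infinite_univ: "infinite (univ A)" "infinite (univ B)"
    and computable: "computable_set (diagram L A)" "computable_set (diagram L B)"
    and equiv1: "equiv1 L A B"
    and odec_g: "odec g"
begin

section \<open>The copy in stages\<close>

definition target :: "bool \<Rightarrow> struct" where "target b = (if b then A else B)"

definition "tdiag b = diagram L (target b)"

lemma infinite_target: "infinite (univ (target b))"
  by (simp add: target_def infinite_univ)

lemma structure_target: "is_structure L (target b)"
  by (simp add: target_def structures)

lemma odec_tdiag [cintro]:
  assumes "ocomp f" "odec b" shows "odec (\<lambda>X z. f X z \<in> tdiag (b X z))"
proof (rule odec_cong)
  show "odec (\<lambda>X z. if b X z then f X z \<in> diagram L A else f X z \<in> diagram L B)"
    by (intro cintro assms odec_computable_set computable)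
qed (simp add: tdiag_def target_def)

lemma odec_univ [cintro]:
  assumes "ocomp f" "odec b" shows "odec (\<lambda>X z. f X z \<in> univ (target (b X z)))"
  unfolding diagram_univ[symmetric, of _ _ L] tdiag_def[symmetric] qf_code.simps tm_code.simps
  by (intro cintro assms)

definition "valid b r \<longleftrightarrow> distinct r \<and> (\<forall>x\<in>set r. x \<in> univ (target b))"

text \<open>The match is longer by one, so that the part at stage \<open>s\<close> has length
  \<open>s\<close>. It need only respect the literals with code below \<open>length r\<close>, and
  it may replace the named elements entirely.\<close>

definition "matches b b' r l \<longleftrightarrow> length l = Suc (length r) \<and> valid b' l \<and>
  (\<forall>k<length r. lsub r k \<in> tdiag b \<longleftrightarrow> lsub l k \<in> tdiag b')"

definition "fresh b r = (LEAST x. x \<in> univ (target b) \<and> x \<notin> set r)"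

definition "switch b b' r = (LEAST c. valid b r \<longrightarrow> matches b b' r (list_decode c))"

definition "next_part b b' r = (if b = b' then r @ [fresh b r] else list_decode (switch b b' r))"

primrec part :: "nat set \<Rightarrow> nat \<Rightarrow> nat list" where
  "part X 0 = []"
| "part X (Suc s) = next_part (g X s) (g X (Suc s)) (part X s)"

lemma fresh_exists: "\<exists>x. x \<in> univ (target b) \<and> x \<notin> set r"
  using infinite_target[of b] by (metis List.finite_set finite_subset subsetI)

lemma fresh: "fresh b r \<in> univ (target b)" "fresh b r \<notin> set r"
  using LeastI_ex[OF fresh_exists] unfolding fresh_def by blast+

lemma fresh_le: "x \<in> univ (target b) \<Longrightarrow> x \<notin> set r \<Longrightarrow> fresh b r \<le> x"
  unfolding fresh_def by (rule Least_le) simp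

lemma equiv1_target: "equiv1 L (target b) (target b')"
  using equiv1 by (auto simp: target_def equiv1_def)

lemma lsub_tdiag: "valid b r \<Longrightarrow> k < length r \<Longrightarrow> lsub r k \<in> tdiag b \<longleftrightarrow> k \<in> sat_diag L (target b) ((!) r)"
  unfolding tdiag_def by (rule lsub_in_diagram) (auto simp: valid_def)

lemma matches_extend:
  assumes "valid b r" "valid b' xs" "length xs = length r" "x \<in> univ (target b')" "x \<notin> set xs"
    "\<forall>k<length r. k \<in> sat_diag L (target b) ((!) r) \<longleftrightarrow> k \<in> sat_diag L (target b') ((!) xs)"
  shows "matches b b' r (xs @ [x])"
proof -
  have v: "valid b' (xs @ [x])" using assms(2,4,5) by (auto simp: valid_def)
  have "k \<in> sat_diag L (target b') ((!) (xs @ [x])) \<longleftrightarrow> k \<in> sat_diag L (target b') ((!) xs)"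
    if "k < length r" for k
    using that assms(3) by (intro sat_diag_cong) (auto simp: nth_append)
  then show ?thesis
    using assms v by (auto simp: matches_def lsub_tdiag)
qed

lemma matches_exists: "\<exists>c. valid b r \<longrightarrow> matches b b' r (list_decode c)"
proof (cases "valid b r")
  case True
  then obtain xs where xs: "length xs = length r" "valid b' xs"
    "\<forall>k<length r. k \<in> sat_diag L (target b) ((!) r) \<longleftrightarrow> k \<in> sat_diag L (target b') ((!) xs)"
    using equiv1_match[OF equiv1_target, of r b b'] unfolding valid_def by blast
  obtain x where "x \<in> univ (target b')" "x \<notin> set xs" using fresh_exists by blast
  then have "matches b b' r (xs @ [x])" using matches_extend True xs by blast
  then show ?thesis by (intro exI[of _ "list_encode (xs @ [x])"]) simp
qed simp

lemma next_part:
  assumes "valid b r" shows "matches b b' r (next_part b b' r)"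
proof (cases "b = b'")
  case True
  then show ?thesis using matches_extend[of b r b r] fresh assms by (simp add: next_part_def)
next
  case False
  then show ?thesis using LeastI_ex[OF matches_exists[of b r b']] assms
    by (simp add: next_part_def switch_def)
qed

lemma odec_valid [cintro]:
  assumes "odec b" "ocompl r" shows "odec (\<lambda>X z. valid (b X z) (r X z))"
  unfolding valid_def by (intro cintro assms odec_comp[OF assms(1)])

lemma ocomp_fresh [cintro]:
  assumes "odec b" "ocompl r" shows "ocomp (\<lambda>X z. fresh (b X z) (r X z))"
proof -
  have "ocomp (\<lambda>X z. fresh (pfst z = 0) (list_decode (psnd z)))"
    unfolding fresh_def by (rule ocomp_Least[OF fresh_exists]) (intro cintro)
  moreover have "ocomp (\<lambda>X z. prod_encode (of_bool (\<not> b X z), list_encode (r X z)))"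
    by (intro cintro assms)
  ultimately show ?thesis using ocomp_comp by fastforce
qed

lemma ocomp_switch [cintro]:
  assumes "odec b" "odec b'" "ocompl r" shows "ocomp (\<lambda>X z. switch (b X z) (b' X z) (r X z))"
proof -
  have "ocomp (\<lambda>X z. switch (pfst z = 0) (pfst (psnd z) = 0) (list_decode (psnd (psnd z))))"
    unfolding switch_def matches_def by (rule ocomp_Least[OF matches_exists[unfolded matches_def]]) (intro cintro)
  moreover have "ocomp (\<lambda>X z. prod_encode (of_bool (\<not> b X z), prod_encode (of_bool (\<not> b' X z), list_encode (r X z))))"
    by (intro cintro assms)
  ultimately show ?thesis using ocomp_comp by fastforce
qed

lemma ocompl_If [cintro]:
  assumes "odec P" "ocompl f" "ocompl h" shows "ocompl (\<lambda>X z. if P X z then f X z else h X z)"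
  unfolding ocompl_def if_distrib[of list_encode] using assms by (intro cintro)

lemma ocompl_part [cintro]:
  assumes "ocomp s" shows "ocompl (\<lambda>X z. part X (s X z))"
proof -
  have *: "list_encode (part X s) =
    rec_nat 0 (\<lambda>m r. list_encode (next_part (g X m) (g X (Suc m)) (list_decode r))) s" for X s
  proof (induction s)
    case (Suc s)
    show ?case by (simp flip: Suc)
  qed simp
  show ?thesis unfolding ocompl_def * next_part_def
    by (intro cintro assms odec_comp[OF odec_g])
qed

lemma valid_part: "valid (g X s) (part X s) \<and> length (part X s) = s"
proof (induction s)
  case 0
  show ?case by (simp add: valid_def)
next
  case (Suc s)
  then show ?case using next_part[of "g X s" "part X s" "g X (Suc s)"] by (simp add: matches_def)
qed

text \<open>Stage \<open>Suc k\<close> is the first whose part is long enough to answer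
  \<open>k\<close>. All later stages keep this answer, across changes of the guess too.\<close>

definition "decided X k \<longleftrightarrow> lsub (part X (Suc k)) k \<in> tdiag (g X (Suc k))"

lemma odec_decided: "odec decided"
  unfolding decided_def by (intro cintro odec_comp[OF odec_g])

lemma decided: "Suc k \<le> s \<Longrightarrow> decided X k \<longleftrightarrow> k \<in> sat_diag L (target (g X s)) ((!) (part X s))"
proof (induction s rule: dec_induct)
  case base
  show ?case using valid_part[of X "Suc k"] by (simp add: decided_def lsub_tdiag)
next
  case (step s)
  have v: "valid (g X s) (part X s)" "length (part X s) = s"
    "valid (g X (Suc s)) (part X (Suc s))" "length (part X (Suc s)) = Suc s"
    using valid_part by blast+
  have "lsub (part X s) k \<in> tdiag (g X s) \<longleftrightarrow> lsub (part X (Suc s)) k \<in> tdiag (g X (Suc s))"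
    using next_part[OF v(1), of "g X (Suc s)"] v(2) step.hyps by (simp add: matches_def)
  moreover have "lsub (part X s) k \<in> tdiag (g X s) \<longleftrightarrow> k \<in> sat_diag L (target (g X s)) ((!) (part X s))"
    using v step.hyps by (intro lsub_tdiag) simp_all
  moreover have "lsub (part X (Suc s)) k \<in> tdiag (g X (Suc s)) \<longleftrightarrow>
      k \<in> sat_diag L (target (g X (Suc s))) ((!) (part X (Suc s)))"
    using v step.hyps by (intro lsub_tdiag) simp_all
  ultimately show ?case using step.IH by blast
qed

lemma limit_copy:
  assumes "\<forall>s\<ge>s0. g X s = b"
  shows "\<exists>T\<in>copies L (target b). diagram L T = {k. decided X k}"
proof -
  have ext: "part X (Suc s) = part X s @ [fresh b (part X s)]" if "s \<ge> s0" for s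
    using assms that by (simp add: next_part_def)
  have v: "valid b (part X s)" "length (part X s) = s" if "s \<ge> s0" for s
    using valid_part[of X s] assms that by auto
  have len: "length (part X s) = s" for s using valid_part by blast
  have mono: "part X t ! i = part X s ! i" if "s0 \<le> s" "i < s" "s \<le> t" for i s t
    using that(3,1,2)
  proof (induction t rule: dec_induct)
    case (step t)
    then show ?case using ext[of t] len[of t] by (simp add: nth_append)
  qed simp
  define e where "e i = part X (max s0 (Suc i)) ! i" for i
  have e: "part X s ! i = e i" if "s \<ge> s0" "i < s" for s i
    unfolding e_def using that by (intro mono) auto
  have inj: "inj e"
  proof (rule injI)
    fix i j assume ij: "e i = e j"
    define s where "s = Suc (max s0 (max i j))"
    have s: "s0 \<le> s" "i < s" "j < s" by (auto simp: s_def)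
    have "part X s ! i = part X s ! j" using ij e s by simp
    then show "i = j" using v[OF s(1)] s by (auto simp: valid_def nth_eq_iff_index_eq)
  qed
  have in_univ: "e i \<in> univ (target b)" for i
  proof -
    define s where "s = Suc (max s0 i)"
    have s: "s0 \<le> s" "i < s" by (auto simp: s_def)
    then have "part X s ! i \<in> set (part X s)" using len by simp
    then show ?thesis using v(1)[OF s(1)] e[OF s] by (auto simp: valid_def)
  qed
  \<comment> \<open>An element never listed would bound all fresh elements from \<open>s0\<close>
    on, yet these are infinitely many.\<close>
  have surj: "x \<in> range e" if x: "x \<in> univ (target b)" for x
  proof (rule ccontr)
    assume not: "x \<notin> range e"
    have "e s \<le> x" if "s \<ge> s0" for s
    proof -
      have "x \<notin> set (part X s)"
      proof
        assume "x \<in> set (part X s)"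
        then obtain i where "i < s" "x = part X s ! i" using len by (auto simp: in_set_conv_nth)
        then show False using e[OF that] not by auto
      qed
      then have "fresh b (part X s) \<le> x" using x by (intro fresh_le)
      moreover have "e s = part X (Suc s) ! s" using e[of "Suc s" s] that by simp
      ultimately show ?thesis using ext[OF that] len[of s] by (simp add: nth_append)
    qed
    then have "e ` {s0..} \<subseteq> {..x}" by auto
    then have "finite (e ` {s0..})" by (rule finite_subset) simp
    moreover have "infinite (e ` {s0..})"
      using inj by (simp add: finite_image_iff inj_on_subset infinite_Ici)
    ultimately show False by simp
  qed
  have bij: "bij_betw e UNIV (univ (target b))"
    using inj in_univ surj by (auto simp: bij_betw_def)
  have "k \<in> sat_diag L (target b) e \<longleftrightarrow> decided X k" for k
  proof -
    define s where "s = max s0 (Suc k)"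
    have s: "s0 \<le> s" "Suc k \<le> s" by (auto simp: s_def)
    have "k \<in> sat_diag L (target b) e \<longleftrightarrow> k \<in> sat_diag L (target b) ((!) (part X s))"
      using e s by (intro sat_diag_cong) auto
    then show ?thesis using decided[OF s(2), of X] assms s(1) by simp
  qed
  then have "diagram L (pull (target b) e) = {k. decided X k}"
    using diagram_pull[OF structure_target bij] by blast
  then show ?thesis using pull_copies[OF structure_target bij] by blast
qed

lemma limit_prog:
  obtains p where
    "\<And>X s0. \<forall>s\<ge>s0. g X s \<Longrightarrow> \<exists>T\<in>copies L A. computes_set p X (diagram L T)"
    "\<And>X s0. \<forall>s\<ge>s0. \<not> g X s \<Longrightarrow> \<exists>T\<in>copies L B. computes_set p X (diagram L T)"
proof -
  obtain p where p: "\<And>X. computes_set p X {k. decided X k}"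
    using odec_computes[OF odec_decided] by blast
  show ?thesis
  proof (rule that[of p])
    show "\<exists>T\<in>copies L A. computes_set p X (diagram L T)" if "\<forall>s\<ge>s0. g X s" for X s0
      using limit_copy[of s0 X True] that p[of X] by (metis (no_types, lifting) target_def)
    show "\<exists>T\<in>copies L B. computes_set p X (diagram L T)" if "\<forall>s\<ge>s0. \<not> g X s" for X s0
      using limit_copy[of s0 X False] that p[of X] by (metis (no_types, lifting) target_def)
  qed
qed

end

text \<open>A program alone suffices. Images are chosen separately on the two disjoint sets of
  copies, and since both classes consist of just two isomorphism types, isomorphism is preserved and
  reflected automatically.\<close>

lemma tc_leI:
  assumes "is_structure L A" "is_structure L B" "is_structure L' C" "is_structure L' D"
    and AB: "\<not> isomorphic L A B" and CD: "\<not> isomorphic L' C D"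
    and p: "\<And>S. S \<in> copies L A \<Longrightarrow> \<exists>T\<in>copies L' C. computes_set p (diagram L S) (diagram L' T)"
      "\<And>S. S \<in> copies L B \<Longrightarrow> \<exists>T\<in>copies L' D. computes_set p (diagram L S) (diagram L' T)"
  shows "tc_le L (pair_class L A B) L' (pair_class L' C D)"
proof -
  obtain F1 where F1: "\<And>S. S \<in> copies L A \<Longrightarrow> F1 S \<in> copies L' C \<and> computes_set p (diagram L S) (diagram L' (F1 S))"
    using p(1) by metis
  obtain F2 where F2: "\<And>S. S \<in> copies L B \<Longrightarrow> F2 S \<in> copies L' D \<and> computes_set p (diagram L S) (diagram L' (F2 S))"
    using p(2) by metis
  define F where "F S = (if S \<in> copies L A then F1 S else F2 S)" for S
  have same: "isomorphic M S T" if "S \<in> copies M R" "T \<in> copies M R" "is_structure M R" for S T M R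
    using that isomorphic_trans isomorphic_sym unfolding copies_def by blast
  have diff: "\<not> isomorphic M S T" "\<not> isomorphic M T S"
    if "S \<in> copies M R" "T \<in> copies M Q" "is_structure M R" "is_structure M Q" "\<not> isomorphic M R Q" for S T M R Q
    using that isomorphic_trans isomorphic_sym unfolding copies_def by blast+
  have disj: "S \<notin> copies L A" if "S \<in> copies L B" for S
    using diff[of S L A S B] that assms(1,2) AB isomorphic_refl by blast
  have FA: "F S \<in> copies L' C" if "S \<in> copies L A" for S using F1 that by (simp add: F_def)
  have FB: "F S \<in> copies L' D" if "S \<in> copies L B" for S using F2 that disj by (simp add: F_def)
  show ?thesis
    unfolding tc_le_def
  proof (intro exI[of _ p] exI[of _ F] conjI ballI)
    fix S assume S: "S \<in> pair_class L A B"
    then show "F S \<in> pair_class L' C D" using FA FB by (auto simp: pair_class_def)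
    show "computes_set p (diagram L S) (diagram L' (F S))"
      using S F1 F2 disj by (auto simp: pair_class_def F_def)
    fix T assume T: "T \<in> pair_class L A B"
    show "isomorphic L S T \<longleftrightarrow> isomorphic L' (F S) (F T)"
      using S T FA FB same diff assms(1-4) AB CD unfolding pair_class_def by (metis UnE)
  qed
qed

lemma order_tc_le:
  assumes "is_structure L A" "is_structure L B" "infinite (univ A)" "infinite (univ B)"
    and "\<not> isomorphic L A B" "equiv1 L A B"
    and "computably_presentable L A" "computably_presentable L B"
  shows "tc_le order_lang (pair_class order_lang omega omega_star) L (pair_class L A B)"
proof -
  obtain A0 B0 where A0: "A0 \<in> copies L A" "computable_set (diagram L A0)"
    and B0: "B0 \<in> copies L B" "computable_set (diagram L B0)"
    using assms by (auto simp: computably_presentable_def)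
  let ?U = "\<lambda>X i. qf_code (Eq (Var i) (Var i)) \<in> X" and ?R = "\<lambda>X i j. qf_code (Rel 0 [Var i, Var j]) \<in> X"
  \<comment> \<open>A permanent witness for \<open>P\<close> is a least element, one for
    \<open>Q\<close> a greatest element.\<close>
  define P where "P X w t \<longleftrightarrow> ?U X w \<and> (?U X t \<longrightarrow> ?R X w t)" for X w t
  define Q where "Q X w t \<longleftrightarrow> ?U X w \<and> (?U X t \<longrightarrow> ?R X t w)" for X w t
  have "odec (guess P Q)"
    unfolding P_def Q_def qf_code.simps tm_code.simps list.map by (intro odec_guess cintro)
  then interpret limit_copy L A0 B0 "guess P Q"
    using A0 B0 assms equiv1_copies[OF A0(1) B0(1)] copies_infinite
    by unfold_locales (auto simp: copies_def)
  obtain p where p: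
    "\<And>X s0. \<forall>s\<ge>s0. guess P Q X s \<Longrightarrow> \<exists>T\<in>copies L A0. computes_set p X (diagram L T)"
    "\<And>X s0. \<forall>s\<ge>s0. \<not> guess P Q X s \<Longrightarrow> \<exists>T\<in>copies L B0. computes_set p X (diagram L T)"
    using limit_prog by blast
  have U: "?U (diagram order_lang S) i \<longleftrightarrow> i \<in> univ S" for S i by (rule diagram_univ)
  have R: "?R (diagram order_lang S) i j \<longleftrightarrow> i \<in> univ S \<and> j \<in> univ S \<and> rel_int S 0 [i, j]" for S i j
    by (auto simp: diagram_def image_iff order_lang_def simp del: qf_code.simps)
  show ?thesis
  proof (rule tc_leI[OF is_structure_order is_structure_order assms(1,2) omega_not_iso assms(5)])
    fix S assume "S \<in> copies order_lang omega"
    then obtain h :: "nat \<Rightarrow> nat" where h: "bij_betw h (univ S) UNIV"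
      "\<forall>a\<in>univ S. \<forall>b\<in>univ S. rel_int S 0 [a, b] \<longleftrightarrow> h a \<le> h b"
      by (auto simp: copies_def isomorphic_order omega_def)
    have ex: "\<exists>a\<in>univ S. h a = n" for n using h(1) by (metis UNIV_I bij_betw_iff_bijections)
    have "\<exists>w. \<forall>t. P (diagram order_lang S) w t"
      using ex[of 0] h(2) unfolding P_def U R by auto
    moreover have "\<not> (\<exists>w. \<forall>t. Q (diagram order_lang S) w t)"
    proof
      assume "\<exists>w. \<forall>t. Q (diagram order_lang S) w t"
      then obtain w where w: "w \<in> univ S" "\<forall>t\<in>univ S. h t \<le> h w"
        using h(2) unfolding Q_def U R by blast
      then show False using ex[of "Suc (h w)"] by auto
    qed
    ultimately have "\<exists>s0. \<forall>s\<ge>s0. guess P Q (diagram order_lang S) s" by (rule guess_true)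
    then show "\<exists>T\<in>copies L A. computes_set p (diagram order_lang S) (diagram L T)"
      using p(1) copies_trans[OF A0(1)] by blast
  next
    fix S assume "S \<in> copies order_lang omega_star"
    then obtain h :: "nat \<Rightarrow> nat" where h: "bij_betw h (univ S) UNIV"
      "\<forall>a\<in>univ S. \<forall>b\<in>univ S. rel_int S 0 [a, b] \<longleftrightarrow> h b \<le> h a"
      by (auto simp: copies_def isomorphic_order omega_star_def)
    have ex: "\<exists>a\<in>univ S. h a = n" for n using h(1) by (metis UNIV_I bij_betw_iff_bijections)
    have "\<exists>w. \<forall>t. Q (diagram order_lang S) w t"
      using ex[of 0] h(2) unfolding Q_def U R by auto
    moreover have "\<not> (\<exists>w. \<forall>t. P (diagram order_lang S) w t)"
    proof
      assume "\<exists>w. \<forall>t. P (diagram order_lang S) w t"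
      then obtain w where w: "w \<in> univ S" "\<forall>t\<in>univ S. h t \<le> h w"
        using h(2) unfolding P_def U R by blast
      then show False using ex[of "Suc (h w)"] by auto
    qed
    ultimately have "\<exists>s0. \<forall>s\<ge>s0. \<not> guess P Q (diagram order_lang S) s" by (intro guess_false)
    then show "\<exists>T\<in>copies L B. computes_set p (diagram order_lang S) (diagram L T)"
      using p(2) copies_trans[OF B0(1)] by blast
  qed
qed

section \<open>From the two structures to orders\<close>

lemma psnd_parts_less: "pfst k \<noteq> 0 \<Longrightarrow> pfst (psnd k) < k" "pfst k \<noteq> 0 \<Longrightarrow> psnd (psnd k) < k"
  using psnd_less[of k] pfst_le[of "psnd k"] psnd_le[of "psnd k"] by linarith+

text \<open>The value 2 signals that \<open>k\<close> does not code a well-formed formula.\<close>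

function truth :: "nat set \<Rightarrow> nat list \<Rightarrow> nat \<Rightarrow> nat" where
  "truth X es k =
    (if pfst k \<le> 1 then
       (if lsub es k \<in> X then 1 else if lsub es (prod_encode (2, k)) \<in> X then 0 else 2)
     else if pfst k = 2 then
       (if truth X es (psnd k) = 0 then 1 else if truth X es (psnd k) = 1 then 0 else 2)
     else if 2 < truth X es (pfst (psnd k)) + 1 \<or> 2 < truth X es (psnd (psnd k)) + 1 then 2
     else if pfst k = 3 then
       of_bool (truth X es (pfst (psnd k)) = 1 \<and> truth X es (psnd (psnd k)) = 1)
     else if pfst k = 4 then
       of_bool (truth X es (pfst (psnd k)) = 1 \<or> truth X es (psnd (psnd k)) = 1)
     else 2)"
  by auto
termination
  by (relation "measure (\<lambda>(X, es, k). k)") (auto simp: psnd_less psnd_parts_less)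

declare truth.simps [simp del]

lemma truth_qf_code:
  assumes "set es \<subseteq> univ S"
  shows "wf_qf L \<phi> \<Longrightarrow> qf_vars \<phi> \<subseteq> {..<length es} \<Longrightarrow>
    truth (diagram L S) es (qf_code \<phi>) = of_bool (qf_holds S ((!) es) \<phi>)"
proof (induction \<phi>)
  case (Rel r ts)
  have "lsub es (qf_code (Rel r ts)) \<in> diagram L S \<longleftrightarrow> qf_holds S ((!) es) (Rel r ts)"
    "lsub es (qf_code (Neg (Rel r ts))) \<in> diagram L S \<longleftrightarrow> \<not> qf_holds S ((!) es) (Rel r ts)"
    using Rel assms by (subst lsub_qf_code; simp)+
  then show ?case by (simp add: truth.simps[of _ _ "prod_encode _"])
next
  case (Eq s t)
  have "lsub es (qf_code (Eq s t)) \<in> diagram L S \<longleftrightarrow> qf_holds S ((!) es) (Eq s t)"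
    "lsub es (qf_code (Neg (Eq s t))) \<in> diagram L S \<longleftrightarrow> \<not> qf_holds S ((!) es) (Eq s t)"
    using Eq assms by (subst lsub_qf_code; simp)+
  then show ?case by (simp add: truth.simps[of _ _ "prod_encode _"])
qed (simp_all add: truth.simps[of _ _ "prod_encode _"])

text \<open>A program for a conjunction may also enumerate numbers that code no formula.
  \<open>ce_conj\<close> ignores them, and the value 2 ensures that they refute no witness.\<close>

lemma truth_garbage: "k \<notin> range qf_code \<Longrightarrow> truth (diagram L S) es k = 2"
proof (induction k rule: less_induct)
  case (less k)
  consider "pfst k \<le> 1" | "pfst k = 2" | "pfst k = 3 \<or> pfst k = 4" | "pfst k > 4" by linarith
  then show ?case
  proof cases
    case 1
    have "lsub es k \<notin> diagram L S"
      using lsub_is_code[of es k] less.prems by (auto simp: diagram_def)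
    moreover have "lsub es (prod_encode (2, k)) \<notin> diagram L S"
    proof
      assume "lsub es (prod_encode (2, k)) \<in> diagram L S"
      then obtain \<phi> where "prod_encode (2, k) = qf_code \<phi>"
        using lsub_is_code[of es "prod_encode (2, k)"] by (auto simp: diagram_def)
      then have "k \<in> range qf_code" by (cases \<phi>) auto
      then show False using less.prems by blast
    qed
    ultimately show ?thesis using 1 by (simp add: truth.simps[of _ _ k])
  next
    case 2
    have "psnd k \<notin> range qf_code"
    proof
      assume "psnd k \<in> range qf_code"
      then obtain \<phi> where "psnd k = qf_code \<phi>" by blast
      then have "k = qf_code (Neg \<phi>)" using 2 prod_encode_pfst_psnd[of k] by simp
      then show False using less.prems by blast
    qed
    then have "truth (diagram L S) es (psnd k) = 2"
      using less.IH psnd_less[of k] 2 by simp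
    then show ?thesis using 2 by (simp add: truth.simps[of _ _ k])
  next
    case 3
    have "pfst (psnd k) \<notin> range qf_code \<or> psnd (psnd k) \<notin> range qf_code"
    proof (rule ccontr)
      assume "\<not> ?thesis"
      then obtain \<phi> \<psi> where *: "pfst (psnd k) = qf_code \<phi>" "psnd (psnd k) = qf_code \<psi>" by blast
      have "k = prod_encode (pfst k, prod_encode (qf_code \<phi>, qf_code \<psi>))"
        by (simp flip: *)
      then have "k = qf_code (Conj \<phi> \<psi>) \<or> k = qf_code (Disj \<phi> \<psi>)" using 3 by auto
      then show False using less.prems by blast
    qed
    moreover have "pfst (psnd k) < k" "psnd (psnd k) < k"
      using psnd_less[of k] 3 pfst_le[of "psnd k"] psnd_le[of "psnd k"] by auto
    ultimately have "truth (diagram L S) es (pfst (psnd k)) = 2 \<or> truth (diagram L S) es (psnd (psnd k)) = 2"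
      using less.IH by blast
    then show ?thesis using 3 by (auto simp: truth.simps[of _ _ k])
  next
    case 4
    then show ?thesis by (simp add: truth.simps[of _ _ k])
  qed
qed

lemma ocomp_truth [cintro]:
  assumes "ocompl e" "ocomp k" shows "ocomp (\<lambda>X z. truth X (e X z) (k X z))"
proof -
  define H :: "nat set \<Rightarrow> nat \<Rightarrow> nat list \<Rightarrow> nat \<Rightarrow> nat" where "H X k T z =
    (if pfst k \<le> 1 then
       (if lsub (list_decode z) k \<in> X then 1 else if lsub (list_decode z) (prod_encode (2, k)) \<in> X then 0 else 2)
     else if pfst k = 2 then
       (if lnth T (psnd k) = 0 then 1 else if lnth T (psnd k) = 1 then 0 else 2)
     else if 2 < lnth T (pfst (psnd k)) + 1 \<or> 2 < lnth T (psnd (psnd k)) + 1 then 2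
     else if pfst k = 3 then
       of_bool (lnth T (pfst (psnd k)) = 1 \<and> lnth T (psnd (psnd k)) = 1)
     else if pfst k = 4 then
       of_bool (lnth T (pfst (psnd k)) = 1 \<or> lnth T (psnd (psnd k)) = 1)
     else 2)" for X k T z
  have "truth X (list_decode z) k = H X k (map (\<lambda>j. truth X (list_decode z) j) [0..<k]) z" for X k z
  proof -
    let ?T = "map (\<lambda>j. truth X (list_decode z) j) [0..<k]"
    have T: "lnth ?T x = truth X (list_decode z) x" if "x < k" for x
      using that by (simp add: lnth_def)
    show ?thesis
    proof (cases "pfst k \<le> 1")
      case True
      then show ?thesis by (simp add: H_def truth.simps[of _ _ k])
    next
      case False
      then have "psnd k < k" by (intro psnd_less) simp
      moreover from this have "pfst (psnd k) < k" "psnd (psnd k) < k"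
        using pfst_le[of "psnd k"] psnd_le[of "psnd k"] by linarith+
      ultimately show ?thesis unfolding H_def by (subst truth.simps) (simp only: T)
    qed
  qed
  moreover have "ocomp (\<lambda>X z. H X (pfst z) (list_decode (pfst (psnd z))) (psnd (psnd z)))"
    unfolding H_def by (intro cintro)
  ultimately have "ocomp (\<lambda>X z. truth X (list_decode (list_encode (e X z))) (k X z))"
    by (rule ocomp_course_of_values[where F = "\<lambda>X k z. truth X (list_decode z) k" and H = H and a = k
        and b = "\<lambda>X z. list_encode (e X z)"]) (intro cintro assms)+
  then show ?thesis by simp
qed

text \<open>With \<open>w\<close> ranging over disjuncts with a choice of witnesses and \<open>t\<close> over instances of its
  conjuncts, \<open>\<exists>w. \<forall>t\<close> expresses the truth of the sentence with index \<open>q\<close>.\<close>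

definition unrefuted :: "prog \<Rightarrow> nat set \<Rightarrow> nat \<Rightarrow> nat \<Rightarrow> nat list \<Rightarrow> nat \<Rightarrow> nat \<Rightarrow> nat \<Rightarrow> nat list \<Rightarrow> nat \<Rightarrow> bool" where
  "unrefuted q X n pc xs c m j ys d \<longleftrightarrow>
     pc \<in> range prog_code \<and> halts (prog_code q) (prod_encode (n, pc)) c \<and>
     length xs = n \<and> (\<forall>x\<in>set xs. qf_code (Eq (Var x) (Var x)) \<in> X) \<and>
     (halts pc (prod_encode (m, j)) d \<and> length ys = m \<and> (\<forall>y\<in>set ys. qf_code (Eq (Var y) (Var y)) \<in> X) \<longrightarrow>
        truth X (xs @ ys) j \<noteq> 0)"

text \<open>Candidates and challenges, with four components each, are packed into single numbers,
  the form that \<open>guess\<close> expects.\<close>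

definition sigma2_matrix :: "prog \<Rightarrow> nat set \<Rightarrow> nat \<Rightarrow> nat \<Rightarrow> bool" where
  "sigma2_matrix q X w t \<longleftrightarrow>
     unrefuted q X (pfst w) (pfst (psnd w)) (list_decode (pfst (psnd (psnd w)))) (psnd (psnd (psnd w)))
       (pfst t) (pfst (psnd t)) (list_decode (pfst (psnd (psnd t)))) (psnd (psnd (psnd t)))"

lemma odec_sigma2_matrix: "odec (\<lambda>X z. sigma2_matrix q X (pfst z) (psnd z))"
  unfolding sigma2_matrix_def unrefuted_def qf_code.simps tm_code.simps by (intro cintro)

lemma sigma2_matrix_iff:
  "(\<exists>w. \<forall>t. sigma2_matrix q X w t) \<longleftrightarrow>
    (\<exists>n pc xs c. \<forall>m j ys d. unrefuted q X n pc xs c m j ys d)"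
proof
  assume "\<exists>w. \<forall>t. sigma2_matrix q X w t"
  then obtain w where w: "\<And>t. sigma2_matrix q X w t" by blast
  have "unrefuted q X (pfst w) (pfst (psnd w)) (list_decode (pfst (psnd (psnd w)))) (psnd (psnd (psnd w))) m j ys d"
    for m j ys d
    using w[of "prod_encode (m, prod_encode (j, prod_encode (list_encode ys, d)))"]
    by (simp add: sigma2_matrix_def)
  then show "\<exists>n pc xs c. \<forall>m j ys d. unrefuted q X n pc xs c m j ys d" by blast
next
  assume "\<exists>n pc xs c. \<forall>m j ys d. unrefuted q X n pc xs c m j ys d"
  then obtain n pc xs c where *: "\<forall>m j ys d. unrefuted q X n pc xs c m j ys d" by blast
  show "\<exists>w. \<forall>t. sigma2_matrix q X w t"
    by (intro exI[of _ "prod_encode (n, prod_encode (pc, prod_encode (list_encode xs, c)))"])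
      (simp add: sigma2_matrix_def *)
qed

lemma in_ce_conj [simp]: "(m, \<psi>) \<in> ce_conj p \<longleftrightarrow> prod_encode (m, qf_code \<psi>) \<in> ce_set p"
  by (simp add: ce_conj_def)

lemma in_ce_disj: "(n, C) \<in> ce_disj q \<longleftrightarrow> (\<exists>p. C = ce_conj p \<and> prod_encode (n, prog_code p) \<in> ce_set q)"
  by (auto simp: ce_disj_def)

lemma sigma2_holds_iff: "sigma2_holds S \<Phi> \<longleftrightarrow> (\<exists>n C. (n, C) \<in> \<Phi> \<and> (\<exists>xs\<in>tuples S n. \<forall>m \<psi>.
    (m, \<psi>) \<in> C \<longrightarrow> (\<forall>ys\<in>tuples S m. qf_holds S ((!) (xs @ ys)) \<psi>)))"
  by (simp add: sigma2_holds_def Bex_def Ball_def split_paired_Ex split_paired_All)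

lemma sigma2_holds_ce_disj:
  "sigma2_holds S (ce_disj q) \<longleftrightarrow>
    (\<exists>n p. prod_encode (n, prog_code p) \<in> ce_set q \<and> (\<exists>xs\<in>tuples S n. \<forall>m \<psi>.
       prod_encode (m, qf_code \<psi>) \<in> ce_set p \<longrightarrow> (\<forall>ys\<in>tuples S m. qf_holds S ((!) (xs @ ys)) \<psi>)))"
proof -
  have "sigma2_holds S (ce_disj q) \<longleftrightarrow>
      (\<exists>n C. (\<exists>p. C = ce_conj p \<and> prod_encode (n, prog_code p) \<in> ce_set q) \<and>
        (\<exists>xs\<in>tuples S n. \<forall>m \<psi>. (m, \<psi>) \<in> C \<longrightarrow> (\<forall>ys\<in>tuples S m. qf_holds S ((!) (xs @ ys)) \<psi>)))"
    by (simp only: sigma2_holds_iff in_ce_disj)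
  also have "\<dots> \<longleftrightarrow> (\<exists>n p. prod_encode (n, prog_code p) \<in> ce_set q \<and>
      (\<exists>xs\<in>tuples S n. \<forall>m \<psi>. (m, \<psi>) \<in> ce_conj p \<longrightarrow> (\<forall>ys\<in>tuples S m. qf_holds S ((!) (xs @ ys)) \<psi>)))"
    by blast
  finally show ?thesis by (simp only: in_ce_conj)
qed

text \<open>Computations remove the c.e. conditions from the matrix: the one that enumerates the
  disjunct joins the existential witness, those that enumerate conjuncts join the universal
  challenge. Well-formedness makes \<open>truth\<close> correct on every genuine conjunct.\<close>

lemma sigma2_matrix:
  assumes wf: "wf_sigma2 L (ce_disj q)"
  shows "(\<exists>w. \<forall>t. sigma2_matrix q (diagram L S) w t) \<longleftrightarrow> sigma2_holds S (ce_disj q)"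
proof -
  let ?X = "diagram L S"
  have wf': "wf_qf L \<psi> \<and> qf_vars \<psi> \<subseteq> {..<n + m}"
    if "prod_encode (n, prog_code p) \<in> ce_set q" "prod_encode (m, qf_code \<psi>) \<in> ce_set p" for n m p \<psi>
  proof -
    have "(n, ce_conj p) \<in> ce_disj q" "(m, \<psi>) \<in> ce_conj p" using that by (auto simp: in_ce_disj)
    then show ?thesis using wf by (force simp: wf_sigma2_def)
  qed
  have truth: "truth ?X (xs @ ys) (qf_code \<psi>) = of_bool (qf_holds S ((!) (xs @ ys)) \<psi>)"
    if "prod_encode (n, prog_code p) \<in> ce_set q" "prod_encode (m, qf_code \<psi>) \<in> ce_set p"
      "xs \<in> tuples S n" "ys \<in> tuples S m" for n m p \<psi> xs ys
    using wf'[OF that(1,2)] that(3,4) by (intro truth_qf_code) (auto simp: tuples_def)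
  show ?thesis
    unfolding sigma2_matrix_iff sigma2_holds_ce_disj
  proof (intro iffI)
    assume "\<exists>n pc xs c. \<forall>m j ys d. unrefuted q ?X n pc xs c m j ys d"
    then obtain n pc xs c where *: "\<And>m j ys d. unrefuted q ?X n pc xs c m j ys d" by blast
    obtain p where p: "pc = prog_code p" using *[of 0 0 "[]" 0] by (auto simp: unrefuted_def)
    have n: "prod_encode (n, prog_code p) \<in> ce_set q" and xs: "xs \<in> tuples S n"
      using *[of 0 0 "[]" 0] by (auto simp: unrefuted_def ce_set_halts p tuples_def diagram_univ simp del: qf_code.simps)
    have "qf_holds S ((!) (xs @ ys)) \<psi>"
      if m: "prod_encode (m, qf_code \<psi>) \<in> ce_set p" and ys: "ys \<in> tuples S m" for m \<psi> ys
    proof -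
      obtain d where "halts pc (prod_encode (m, qf_code \<psi>)) d" using m by (auto simp: ce_set_halts p)
      then have "truth ?X (xs @ ys) (qf_code \<psi>) \<noteq> 0"
        using *[of m "qf_code \<psi>" ys d] ys
        by (auto simp: unrefuted_def tuples_def diagram_univ simp del: qf_code.simps)
      then show ?thesis using truth[OF n m xs ys] by simp
    qed
    then show "\<exists>n p. prod_encode (n, prog_code p) \<in> ce_set q \<and> (\<exists>xs\<in>tuples S n. \<forall>m \<psi>.
       prod_encode (m, qf_code \<psi>) \<in> ce_set p \<longrightarrow> (\<forall>ys\<in>tuples S m. qf_holds S ((!) (xs @ ys)) \<psi>))"
      using n xs by blast
  next
    assume "\<exists>n p. prod_encode (n, prog_code p) \<in> ce_set q \<and> (\<exists>xs\<in>tuples S n. \<forall>m \<psi>.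
       prod_encode (m, qf_code \<psi>) \<in> ce_set p \<longrightarrow> (\<forall>ys\<in>tuples S m. qf_holds S ((!) (xs @ ys)) \<psi>))"
    then obtain n p xs where n: "prod_encode (n, prog_code p) \<in> ce_set q" and xs: "xs \<in> tuples S n"
      and *: "\<And>m \<psi> ys. prod_encode (m, qf_code \<psi>) \<in> ce_set p \<Longrightarrow> ys \<in> tuples S m \<Longrightarrow> qf_holds S ((!) (xs @ ys)) \<psi>"
      by blast
    obtain c where c: "halts (prog_code q) (prod_encode (n, prog_code p)) c" using n by (auto simp: ce_set_halts)
    have "truth ?X (xs @ ys) j \<noteq> 0"
      if "halts (prog_code p) (prod_encode (m, j)) d" "ys \<in> tuples S m" for m j ys d
    proof (cases "j \<in> range qf_code")
      case True
      then obtain \<psi> where "j = qf_code \<psi>" by blast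
      moreover have "prod_encode (m, j) \<in> ce_set p" using that(1) by (auto simp: ce_set_halts)
      ultimately show ?thesis using truth[OF n _ xs that(2)] *[OF _ that(2)] by simp
    qed (simp add: truth_garbage)
    then have "unrefuted q ?X n (prog_code p) xs c m j ys d" for m j ys d
      using c xs by (auto simp: unrefuted_def tuples_def diagram_univ subset_eq simp del: qf_code.simps)
    then show "\<exists>n pc xs c. \<forall>m j ys d. unrefuted q ?X n pc xs c m j ys d" by blast
  qed
qed

lemma sigma2_holds_iso:
  assumes "T \<in> copies L S" "wf_sigma2 L \<Phi>" "sigma2_holds T \<Phi>" shows "sigma2_holds S \<Phi>"
proof -
  obtain h where h: "iso_map L T S h" and T: "is_structure L T"
    using assms(1) by (auto simp: copies_def isomorphic_iff)
  obtain n C xs where nC: "(n, C) \<in> \<Phi>" and xs: "xs \<in> tuples T n"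
    and C: "\<forall>(m, \<psi>)\<in>C. \<forall>ys\<in>tuples T m. qf_holds T ((!) (xs @ ys)) \<psi>"
    using assms(3) by (auto simp: sigma2_holds_def)
  have "qf_holds S ((!) (map h xs @ zs)) \<psi>" if m: "(m, \<psi>) \<in> C" and zs: "zs \<in> tuples S m" for m \<psi> zs
  proof -
    have "\<forall>z\<in>set zs. \<exists>y\<in>univ T. z = h y"
      using h zs by (auto simp: iso_map_def bij_betw_def tuples_def)
    then obtain k where k: "\<forall>z\<in>set zs. k z \<in> univ T \<and> z = h (k z)" by metis
    define ys where "ys = map k zs"
    have ys: "ys \<in> tuples T m" "zs = map h ys"
      using k zs by (auto simp: ys_def tuples_def intro!: map_idI[symmetric])
    have wf: "wf_qf L \<psi>" "qf_vars \<psi> \<subseteq> {..<length (xs @ ys)}"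
      using assms(2) nC m xs ys(1) by (fastforce simp: wf_sigma2_def tuples_def)+
    have "(xs @ ys) ! i \<in> univ T" if "i \<in> qf_vars \<psi>" for i
    proof -
      have "(xs @ ys) ! i \<in> set (xs @ ys)" using wf(2) that by (intro nth_mem) auto
      then show ?thesis using xs ys(1) by (auto simp: tuples_def)
    qed
    then have "qf_holds T ((!) (xs @ ys)) \<psi> \<longleftrightarrow> qf_holds S (\<lambda>i. h ((xs @ ys) ! i)) \<psi>"
      using wf(1) by (intro iso_map_qf_holds[OF h T]) auto
    moreover have "qf_holds S (\<lambda>i. h ((xs @ ys) ! i)) \<psi> \<longleftrightarrow> qf_holds S ((!) (map h (xs @ ys))) \<psi>"
    proof (rule qf_holds_cong)
      fix i assume "i \<in> qf_vars \<psi>"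
      then have "i < length (xs @ ys)" using wf(2) by blast
      then show "h ((xs @ ys) ! i) = map h (xs @ ys) ! i" by (simp only: nth_map)
    qed
    ultimately show ?thesis using C m ys by auto
  qed
  then show ?thesis
    unfolding sigma2_holds_def using nC iso_map_tuples[OF h xs] by blast
qed

lemma sigma2_tc_le:
  assumes "is_structure L A" "is_structure L B" "\<not> isomorphic L A B"
    and "sigma2c_Th L A - sigma2c_Th L B \<noteq> {}" "sigma2c_Th L B - sigma2c_Th L A \<noteq> {}"
  shows "tc_le L (pair_class L A B) order_lang (pair_class order_lang omega omega_star)"
proof -
  obtain p where p: "wf_sigma2 L (ce_disj p)" "sigma2_holds A (ce_disj p)" "\<not> sigma2_holds B (ce_disj p)"
    using assms(4) by (auto simp: sigma2c_Th_def sigma2c_sentences_def)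
  obtain q where q: "wf_sigma2 L (ce_disj q)" "sigma2_holds B (ce_disj q)" "\<not> sigma2_holds A (ce_disj q)"
    using assms(5) by (auto simp: sigma2c_Th_def sigma2c_sentences_def)
  define g where "g = guess (sigma2_matrix p) (sigma2_matrix q)"
  have "odec g" unfolding g_def by (intro odec_guess odec_sigma2_matrix)
  then obtain r where r: "\<And>X. computes_set r X {k. k \<in> diagram order_lang (ord_struct (g X))}"
    using odec_computes[OF odec_diagram_ord_struct] by blast
  have iso: "sigma2_holds S \<Phi> \<longleftrightarrow> sigma2_holds R \<Phi>" if "S \<in> copies L R" "is_structure L R" "wf_sigma2 L \<Phi>" for S R \<Phi>
    using sigma2_holds_iso copies_sym that by blast
  show ?thesis
  proof (rule tc_leI[OF assms(1,2) is_structure_order is_structure_order assms(3) omega_not_iso])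
    fix S assume "S \<in> copies L A"
    then have "\<exists>s0. \<forall>s\<ge>s0. g (diagram L S) s"
      unfolding g_def using iso[OF _ assms(1)] p q by (intro guess_true) (simp_all add: sigma2_matrix)
    then show "\<exists>T\<in>copies order_lang omega. computes_set r (diagram L S) (diagram order_lang T)"
      using ord_struct_omega[of _ "g (diagram L S)"] r[of "diagram L S"] by auto
  next
    fix S assume "S \<in> copies L B"
    then have "\<exists>s0. \<forall>s\<ge>s0. \<not> g (diagram L S) s"
      unfolding g_def using iso[OF _ assms(2)] p q by (intro guess_false) (simp_all add: sigma2_matrix)
    then show "\<exists>T\<in>copies order_lang omega_star. computes_set r (diagram L S) (diagram order_lang T)"
      using ord_struct_omega_star[of _ "g (diagram L S)"] r[of "diagram L S"] by auto
  qed
qed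

section \<open>Consequences of equivalence with the two orders\<close>

text \<open>Isomorphism is reflected, so the images of \<open>A\<close> and \<open>B\<close> are
  copies of different targets; it is preserved, so all other copies follow. Which structure goes
  where remains open, hence \<open>C'\<close> and \<open>D'\<close>.\<close>

lemma tc_leE:
  assumes "tc_le L (pair_class L A B) L' (pair_class L' C D)"
    and str: "is_structure L A" "is_structure L B" "is_structure L' C" "is_structure L' D"
    and "\<not> isomorphic L A B"
  obtains p C' D' where "C' = C \<and> D' = D \<or> C' = D \<and> D' = C"
    "\<And>S. S \<in> copies L A \<Longrightarrow> \<exists>T\<in>copies L' C'. computes_set p (diagram L S) (diagram L' T)"
    "\<And>S. S \<in> copies L B \<Longrightarrow> \<exists>T\<in>copies L' D'. computes_set p (diagram L S) (diagram L' T)"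
proof -
  obtain p F where F: "\<And>S. S \<in> pair_class L A B \<Longrightarrow>
      F S \<in> pair_class L' C D \<and> computes_set p (diagram L S) (diagram L' (F S))"
    and iso: "\<And>S T. S \<in> pair_class L A B \<Longrightarrow> T \<in> pair_class L A B \<Longrightarrow>
      isomorphic L S T \<longleftrightarrow> isomorphic L' (F S) (F T)"
    using assms(1) unfolding tc_le_def by blast
  have A: "A \<in> pair_class L A B" and B: "B \<in> pair_class L A B"
    using str copies_refl by (auto simp: pair_class_def)
  have sub: "S \<in> pair_class L A B" if "S \<in> copies L A \<or> S \<in> copies L B" for S
    using that by (auto simp: pair_class_def)
  have str_F: "is_structure L' (F S)" if "S \<in> pair_class L A B" for S
    using F[OF that] by (auto simp: pair_class_def copies_def)
  have "\<exists>C'. C' \<in> {C, D} \<and> F A \<in> copies L' C'" "\<exists>D'. D' \<in> {C, D} \<and> F B \<in> copies L' D'"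
    using F[OF A] F[OF B] by (auto simp: pair_class_def)
  then obtain C' D' where C': "C' \<in> {C, D}" "F A \<in> copies L' C'" and D': "D' \<in> {C, D}" "F B \<in> copies L' D'"
    by blast
  have "C' \<noteq> D'"
  proof
    assume "C' = D'"
    then have "isomorphic L' (F A) (F B)"
      using C' D' str isomorphic_sym isomorphic_trans unfolding copies_def by blast
    then show False using iso[OF A B] assms(6) by blast
  qed
  then have "C' = C \<and> D' = D \<or> C' = D \<and> D' = C" using C' D' by auto
  moreover have "\<exists>T\<in>copies L' C'. computes_set p (diagram L S) (diagram L' T)" if "S \<in> copies L A" for S
  proof (rule bexI[of _ "F S"])
    have "isomorphic L' (F S) (F A)" using that iso[of S A] sub A by (auto simp: copies_def)
    then show "F S \<in> copies L' C'"
      using C'(2) str_F sub that isomorphic_trans unfolding copies_def by blast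
    show "computes_set p (diagram L S) (diagram L' (F S))" using F sub that by blast
  qed
  moreover have "\<exists>T\<in>copies L' D'. computes_set p (diagram L S) (diagram L' T)" if "S \<in> copies L B" for S
  proof (rule bexI[of _ "F S"])
    have "isomorphic L' (F S) (F B)" using that iso[of S B] sub B by (auto simp: copies_def)
    then show "F S \<in> copies L' D'"
      using D'(2) str_F sub that isomorphic_trans unfolding copies_def by blast
    show "computes_set p (diagram L S) (diagram L' (F S))" using F sub that by blast
  qed
  ultimately show ?thesis by (rule that)
qed

lemma computable_ord_struct: "computable_set (diagram order_lang (ord_struct (\<lambda>_. b)))"
  by (rule computable_set_odec, rule odec_diagram_ord_struct) (rule odec_const)

text \<open>Guesses from stage \<open>N\<close> on do not affect the diagram below \<open>N\<close>;
  an order can thus change its type beyond any finite part that has been read.\<close>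

lemma diagram_ord_struct_cong:
  assumes "\<forall>s<N. g s = h s" "k < N"
  shows "k \<in> diagram order_lang (ord_struct g) \<longleftrightarrow> k \<in> diagram order_lang (ord_struct h)"
proof -
  have "ord_le g i j = ord_le h i j" if "i \<le> k" "j \<le> k" for i j
    using assms that by (auto simp: ord_le_def)
  then show ?thesis unfolding diagram_ord_struct by blast
qed

text \<open>Truth of an existential sentence in the image is witnessed by a finite part of the diagram of
  the source, which extends to a copy of the other order.\<close>

lemma ex_transfer:
  assumes S: "computes_set p (diagram order_lang (ord_struct (\<lambda>_. b))) (diagram L T)" "T \<in> copies L C"
    and S': "\<And>N. \<exists>T\<in>copies L D. computes_set p (diagram order_lang (ord_struct (\<lambda>s. if s < N then b else \<not> b))) (diagram L T)"
    and C: "is_structure L C" and \<sigma>: "\<sigma> \<in> ex_sentences L" "ex_holds C \<sigma>"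
  shows "ex_holds D \<sigma>"
proof -
  let ?X = "diagram order_lang (ord_struct (\<lambda>_. b))"
  obtain n \<psi> where n: "\<sigma> = (n, \<psi>)" "wf_qf L \<psi>" "qf_vars \<psi> \<subseteq> {..<n}"
    using \<sigma>(1) by (auto simp: ex_sentences_def)
  have "ex_holds T \<sigma>" using ex_holds_iso[OF copies_sym[OF S(2) C]] \<sigma> by blast
  then obtain xs where xs: "length xs = n" "set xs \<subseteq> univ T" "qf_holds T ((!) xs) \<psi>"
    by (auto simp: ex_holds_def n tuples_def)
  \<comment> \<open>For a diagram as oracle, \<open>P\<close> says that \<open>xs\<close> lies in
    the universe and satisfies \<open>\<psi>\<close>. It is decidable from the oracle.\<close>
  define P where "P Y \<longleftrightarrow> (\<forall>x\<in>set xs. qf_code (Eq (Var x) (Var x)) \<in> Y) \<and> truth Y xs (qf_code \<psi>) = 1" for Y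
  have xs_const: "ocompl (\<lambda>X z. xs)" unfolding ocompl_def by (rule ocomp_const)
  have "odec (\<lambda>X z. P X)"
    unfolding P_def qf_code.simps(2) tm_code.simps by (intro cintro xs_const)
  then obtain e where e: "\<And>Y z. eval e Y [z] = Some (of_bool (P Y))"
    unfolding odec_def ocomp_def by blast
  have P: "P (diagram L U) \<longleftrightarrow> set xs \<subseteq> univ U \<and> qf_holds U ((!) xs) \<psi>" for U
  proof (cases "set xs \<subseteq> univ U")
    case True
    then have "truth (diagram L U) xs (qf_code \<psi>) = of_bool (qf_holds U ((!) xs) \<psi>)"
      using n xs(1) by (intro truth_qf_code) auto
    then show ?thesis using True unfolding P_def diagram_univ by auto
  next
    case False
    then show ?thesis unfolding P_def diagram_univ by auto
  qed
  \<comment> \<open>The program \<open>e\<close>, with its queries answered by \<open>p\<close>,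
    decides \<open>P\<close> of the image from the source. Its use bounds the part of the source
    that matters; the argument 0 is a dummy.\<close>
  have "eval (query_subst p e) ?X [0] = Some 1"
    using xs P by (simp add: eval_query_subst[OF S(1)] e)
  then obtain N where N: "\<And>Y. (\<forall>k<N. k \<in> ?X \<longleftrightarrow> k \<in> Y) \<Longrightarrow> eval (query_subst p e) Y [0] = Some 1"
    using use_principle by blast
  obtain U where U: "U \<in> copies L D"
    "computes_set p (diagram order_lang (ord_struct (\<lambda>s. if s < N then b else \<not> b))) (diagram L U)"
    using S' by blast
  have "eval (query_subst p e) (diagram order_lang (ord_struct (\<lambda>s. if s < N then b else \<not> b))) [0] = Some 1"
    by (intro N allI impI diagram_ord_struct_cong[of N]) auto
  then have "P (diagram L U)"
    by (cases "P (diagram L U)") (auto simp: eval_query_subst[OF U(2)] e)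
  then have "ex_holds U \<sigma>" using P xs(1) by (auto simp: ex_holds_def n tuples_def)
  then show ?thesis using ex_holds_iso[OF U(1) \<sigma>(1)] by blast
qed

lemma order_embedding:
  assumes "tc_le order_lang (pair_class order_lang omega omega_star) L (pair_class L A B)"
    and str: "is_structure L A" "is_structure L B"
  shows "computably_presentable L A \<and> computably_presentable L B \<and> equiv1 L A B"
proof -
  obtain p C D where CD: "C = A \<and> D = B \<or> C = B \<and> D = A"
    and p: "\<And>S. S \<in> copies order_lang omega \<Longrightarrow> \<exists>T\<in>copies L C. computes_set p (diagram order_lang S) (diagram L T)"
      "\<And>S. S \<in> copies order_lang omega_star \<Longrightarrow> \<exists>T\<in>copies L D. computes_set p (diagram order_lang S) (diagram L T)"
    by (rule tc_leE[OF assms(1) is_structure_order is_structure_order str omega_not_iso]) blast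
  have str': "is_structure L C" "is_structure L D" using CD str by auto
  \<comment> \<open>\<open>?S' b N\<close> agrees with \<open>?S b\<close> up to stage
    \<open>N\<close> and afterwards grows at the other end, so that it has the opposite order
    type.\<close>
  let ?S = "\<lambda>b. ord_struct (\<lambda>_. b)" and ?S' = "\<lambda>b N. ord_struct (\<lambda>s. if s < N then b else \<not> b)"
  have 1: "?S True \<in> copies order_lang omega" "?S' False N \<in> copies order_lang omega" for N
    by (rule ord_struct_omega[of 0] ord_struct_omega[of N]; simp)+
  have 2: "?S False \<in> copies order_lang omega_star" "?S' True N \<in> copies order_lang omega_star" for N
    by (rule ord_struct_omega_star[of 0] ord_struct_omega_star[of N]; simp)+
  obtain T where T: "T \<in> copies L C" "computes_set p (diagram order_lang (?S True)) (diagram L T)"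
    using p(1)[OF 1(1)] by blast
  obtain T' where T': "T' \<in> copies L D" "computes_set p (diagram order_lang (?S False)) (diagram L T')"
    using p(2)[OF 2(1)] by blast
  have "computably_presentable L C" "computably_presentable L D"
    using T(1) computable_set_trans[OF computable_ord_struct T(2)]
      T'(1) computable_set_trans[OF computable_ord_struct T'(2)]
    by (auto simp: computably_presentable_def)
  moreover have "ex_holds C \<sigma> \<longleftrightarrow> ex_holds D \<sigma>" if "\<sigma> \<in> ex_sentences L" for \<sigma>
    using ex_transfer[OF T(2,1) p(2)[OF 2(2)] str'(1) that]
      ex_transfer[OF T'(2,1) p(1)[OF 1(2)] str'(2) that] by blast
  then have "equiv1 L C D" "equiv1 L D C" by (auto simp: equiv1_def)
  ultimately show ?thesis using CD by auto
qed

subsection \<open>Pulling back a \<open>\<Sigma>\<^sub>2\<close> property\<close>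

lemma agrees_cong:
  assumes "\<And>k. k < list_encode c \<Longrightarrow> k \<in> X \<longleftrightarrow> k \<in> Y" shows "agrees X c \<longleftrightarrow> agrees Y c"
  using assms entry_less[of _ "list_encode c"] by (auto simp: agrees_def)

lemma ocomp_conjs:
  assumes "ocompl l" "ocomp (\<lambda>X z. qf_code (f X (pfst z) (psnd z)))"
  shows "ocomp (\<lambda>X z. qf_code (conjs (map (\<lambda>x. f X x z) (l X z))))"
proof -
  have "qf_code (conjs (map h xs)) =
    foldr (\<lambda>x r. prod_encode (3, prod_encode (qf_code (h x), r))) xs (qf_code true_fml)" for h and xs :: "nat list"
    by (induction xs) auto
  then show ?thesis
    by (simp only:) (intro ocomp_foldr cintro assms(1) ocomp_comp2[OF assms(2)])
qed

text \<open>\<open>D\<close> serves to decide which numbers code well-formed literals, with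
  \<open>u\<close> as the element substituted for all variables. The property pulled back is that
  the image contains some \<open>Q0 a\<close> but no \<open>Q1 a b\<close>; in the application these
  say that \<open>a\<close> exists and that \<open>b\<close> lies strictly beyond
  \<open>a\<close>.\<close>

locale pull_back =
  fixes L :: lang and p :: prog and D :: "nat set" and R :: struct and u :: nat
    and Q0 :: "nat \<Rightarrow> nat" and Q1 :: "nat \<Rightarrow> nat \<Rightarrow> nat"
  assumes D: "D = diagram L R" "computable_set D" "u \<in> univ R"
    and Q0: "ocomp (\<lambda>X. Q0)" and Q1: "ocomp (\<lambda>X z. Q1 (pfst z) (psnd z))"
begin

section \<open>Deciding well-formed literals\<close>

definition wf_lit :: "nat \<Rightarrow> bool" where
  "wf_lit k \<longleftrightarrow> (\<exists>\<phi>. wf_qf L \<phi> \<and> literal \<phi> \<and> k = qf_code \<phi>)"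

text \<open>With \<open>u\<close> for every variable, a well-formed atomic formula or its negation
  belongs to \<open>D\<close>. For a negated \<open>k\<close> that is false under this substitution,
  the formula below the negation belongs to \<open>D\<close>; the tag test then excludes double
  negations.\<close>

lemma wf_lit_iff:
  fixes k defines "es \<equiv> map (\<lambda>_. u) [0..<Suc k]"
  shows "wf_lit k \<longleftrightarrow> lsub es k \<in> D \<or> lsub es (prod_encode (2, k)) \<in> D \<or>
    pfst k = 2 \<and> pfst (psnd k) \<noteq> 2 \<and> lsub es (psnd k) \<in> D" (is "_ \<longleftrightarrow> ?r")
proof
  have es: "set es \<subseteq> univ R" using D(3) by (auto simp: es_def)
  assume "wf_lit k"
  then obtain \<phi> where \<phi>: "wf_qf L \<phi>" "literal \<phi>" "k = qf_code \<phi>" by (auto simp: wf_lit_def)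
  have v: "qf_vars \<phi> \<subseteq> {..<length es}"
    using qf_vars_le_code[of _ \<phi>] \<phi>(3) by (auto simp: es_def less_Suc_eq_le)
  have 1: "lsub es k \<in> D \<longleftrightarrow> qf_holds R ((!) es) \<phi>"
    using lsub_qf_code[OF \<phi>(2) es v] \<phi> unfolding D(1) by blast
  show ?r
  proof (cases "atomic \<phi>")
    case True
    then have "lsub es (qf_code (Neg \<phi>)) \<in> D \<longleftrightarrow> \<not> qf_holds R ((!) es) \<phi>"
      using lsub_qf_code[of "Neg \<phi>" es R L] es v \<phi>(1) unfolding D(1) by simp
    then show ?thesis using 1 \<phi>(3) by auto
  next
    case False
    then obtain \<chi> where \<chi>: "\<phi> = Neg \<chi>" "atomic \<chi>" using \<phi>(2) by (auto simp: literal_def)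
    have "lsub es (qf_code \<chi>) \<in> D \<longleftrightarrow> qf_holds R ((!) es) \<chi>"
      using lsub_qf_code[of \<chi> es R L] es v \<phi>(1) \<chi> unfolding D(1) by (simp add: literal_def)
    moreover have "pfst (qf_code \<chi>) \<noteq> 2" using \<chi>(2) by (cases \<chi>) auto
    ultimately show ?thesis using 1 \<phi>(3) \<chi> by auto
  qed
next
  assume r: ?r
  have es: "set es \<subseteq> univ R" using D(3) by (auto simp: es_def)
  have *: "\<exists>\<phi>. literal \<phi> \<and> j = qf_code \<phi> \<and> wf_qf L \<phi>" if j: "lsub es j \<in> D" for j
  proof -
    obtain \<phi>' where "lsub es j = qf_code \<phi>'" "literal \<phi>'" "wf_qf L \<phi>'"
      using j by (auto simp: D(1) diagram_def)
    moreover from this obtain \<phi> where "literal \<phi>" "j = qf_code \<phi>" using lsub_is_code by blast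
    ultimately show ?thesis
      using lsubst_literal(2)[of \<phi> L "lnth es"] lsub_code[of \<phi> es] by auto
  qed
  from r show "wf_lit k"
  proof (elim disjE conjE)
    assume "lsub es k \<in> D"
    then show ?thesis using * by (auto simp: wf_lit_def)
  next
    assume "lsub es (prod_encode (2, k)) \<in> D"
    then obtain \<phi> where \<phi>: "literal \<phi>" "prod_encode (2, k) = qf_code \<phi>" "wf_qf L \<phi>" using * by blast
    then obtain \<chi> where "\<phi> = Neg \<chi>" "k = qf_code \<chi>" by (cases \<phi>) auto
    then show ?thesis using \<phi> by (auto simp: wf_lit_def literal_def)
  next
    assume k: "pfst k = 2" "pfst (psnd k) \<noteq> 2" "lsub es (psnd k) \<in> D"
    then obtain \<phi> where \<phi>: "literal \<phi>" "psnd k = qf_code \<phi>" "wf_qf L \<phi>" using * by blast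
    then have "atomic \<phi>" using k(2) by (auto elim!: literal_cases)
    moreover have "k = qf_code (Neg \<phi>)" using k(1) \<phi>(2) prod_encode_pfst_psnd[of k] by simp
    ultimately show ?thesis using \<phi>(3) by (auto simp: wf_lit_def intro!: exI[of _ "Neg \<phi>"])
  qed
qed

lemma odec_wf_lit [cintro]:
  assumes "ocomp k" shows "odec (\<lambda>X z. wf_lit (k X z))"
proof -
  have "odec (\<lambda>X z. wf_lit z)"
    unfolding wf_lit_iff by (intro cintro odec_computable_set D(2))
  then show ?thesis using assms by (rule odec_comp)
qed

text \<open>A formula for the claim that an enumeration gives \<open>k\<close> the answer
  \<open>v\<close>. Where this claim does not depend on the enumeration, a constant truth value
  stands for it.\<close>

definition lit :: "nat \<Rightarrow> nat \<Rightarrow> qf" where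
  "lit k v = (if wf_lit k then
       (if v = 1 then inv qf_code k else if v = 0 then Neg (inv qf_code k) else Neg true_fml)
     else if v = 0 then true_fml else Neg true_fml)"

lemma inv_qf_code [simp]: "inv qf_code (qf_code \<phi>) = \<phi>"
  by (simp add: inj_def)

lemma lit_holds: "qf_holds S f (lit k v) \<longleftrightarrow> v = of_bool (k \<in> sat_diag L S f)"
proof (cases "wf_lit k")
  case True
  then obtain \<phi> where \<phi>: "wf_qf L \<phi>" "literal \<phi>" "k = qf_code \<phi>" by (auto simp: wf_lit_def)
  then have "k \<in> sat_diag L S f \<longleftrightarrow> qf_holds S f \<phi>" by (auto simp: sat_diag_def)
  then show ?thesis using True \<phi>(3) by (auto simp: lit_def true_fml_def)
next
  case False
  then have "k \<notin> sat_diag L S f" by (auto simp: sat_diag_def wf_lit_def)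
  then show ?thesis using False by (auto simp: lit_def true_fml_def)
qed

lemma lit_wf [simp]: "wf_qf L (lit k v)"
  by (auto simp: lit_def wf_lit_def true_fml_def)

lemma lit_vars: "qf_vars (lit k v) \<subseteq> {..k}"
  by (auto simp: lit_def wf_lit_def true_fml_def dest: qf_vars_le_code)

text \<open>On the level of codes \<open>inv qf_code\<close> disappears, and \<open>lit\<close>
  becomes computable.\<close>

lemma lit_code: "qf_code (lit k v) = (if wf_lit k then
       (if v = 1 then k else if v = 0 then prod_encode (2, k) else qf_code (Neg true_fml))
     else if v = 0 then qf_code true_fml else qf_code (Neg true_fml))"
  by (auto simp: lit_def wf_lit_def)

section \<open>Finite conditions on the oracle as formulas\<close>

definition query_fml :: "nat \<Rightarrow> qf" where
  "query_fml e = (if pfst e = prog_code Query then lit (lnth (entry_args e) 0) (entry_val e) else true_fml)"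

text \<open>For a certificate \<open>c\<close>, the formula says that the elements named by the variables are distinct
  and that they determine an oracle agreeing with \<open>c\<close>.\<close>

definition condition :: "nat \<Rightarrow> nat \<Rightarrow> qf" where
  "condition n c = Conj (distinct_fml n) (conjs (map query_fml (list_decode c)))"

lemma condition_holds:
  "length zs = n \<Longrightarrow> qf_holds S ((!) zs) (condition n c) \<longleftrightarrow>
    distinct zs \<and> agrees (sat_diag L S ((!) zs)) (list_decode c)"
proof -
  assume n: "length zs = n"
  have "qf_holds S f (query_fml e) \<longleftrightarrow>
      (pfst e = prog_code Query \<longrightarrow> entry_val e = of_bool (lnth (entry_args e) 0 \<in> sat_diag L S f))" for f e
    by (simp add: query_fml_def lit_holds) (simp add: true_fml_def)
  then show ?thesis
    using distinct_fml_holds[of S zs] n by (simp add: condition_def agrees_def)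
qed

lemma condition_wf [simp]: "wf_qf L (condition n c)"
  by (auto simp: condition_def query_fml_def true_fml_def)

lemma condition_vars:
  assumes "c < n" shows "qf_vars (condition n c) \<subseteq> {..<n}"
proof -
  have "qf_vars (query_fml e) \<subseteq> {..<n}" if "e \<in> set (list_decode c)" for e
    using entry_less[OF that] lit_vars[of "lnth (entry_args e) 0" "entry_val e"] assms
    by (auto simp: query_fml_def true_fml_def)
  then show ?thesis using distinct_fml_vars[of n] assms by (auto simp: condition_def)
qed

lemma ocomp_query_fml:
  assumes "ocomp e" shows "ocomp (\<lambda>X z. qf_code (query_fml (e X z)))"
  unfolding query_fml_def if_distrib[of qf_code] lit_code by (intro cintro assms)

lemma ocomp_distinct_fml:
  assumes "ocomp n" shows "ocomp (\<lambda>X z. qf_code (distinct_fml (n X z)))"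
proof -
  have *: "ocomp (\<lambda>X z. qf_code (Neg (Eq (Var (i X z)) (Var (j X z)))))" if "ocomp i" "ocomp j" for i j
    unfolding qf_code.simps tm_code.simps by (intro cintro that)
  show ?thesis unfolding distinct_fml_def by (intro ocomp_conjs * cintro assms)
qed

lemma ocomp_condition [cintro]:
  assumes "ocomp n" "ocomp c" shows "ocomp (\<lambda>X z. qf_code (condition (n X z) (c X z)))"
  unfolding condition_def qf_code.simps
  by (intro ocomp_distinct_fml ocomp_conjs ocomp_query_fml cintro assms)

text \<open>\<open>c\<close> certifies that the operator puts \<open>k\<close> into its output for
  each oracle that agrees with \<open>c\<close>.\<close>

definition witness :: "nat \<Rightarrow> nat \<Rightarrow> bool" where
  "witness k c \<longleftrightarrow> certificate (list_decode c) \<and> entry (prog_code p) [k] 1 \<in> set (list_decode c)"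

lemma odec_witness [cintro]:
  assumes "ocomp k" "ocomp c" shows "odec (\<lambda>X z. witness (k X z) (c X z))"
  unfolding witness_def entry_def by (intro cintro assms)

lemma witness_sound:
  assumes "witness k c" "agrees X (list_decode c)" "computes_set p X Y" shows "k \<in> Y"
proof -
  have "eval p X [k] = Some 1"
    using assms(1,2) by (intro certificate_sound) (auto simp: witness_def)
  then show ?thesis using assms(3) by (cases "k \<in> Y") (auto simp: computes_set_def)
qed

lemma witness_complete:
  assumes "computes_set p X Y" "k \<in> Y" obtains c where "witness k c" "agrees X (list_decode c)"
proof -
  have "eval p X [k] = Some 1" using assms by (simp add: computes_set_def)
  then obtain l where "good_cert X l" "entry (prog_code p) [k] 1 \<in> set l"
    using certificate_complete by blast
  then show ?thesis using that[of "list_encode l"] by (simp add: witness_def good_cert_def)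
qed

text \<open>In terms of forcing: the partial enumeration \<open>xs\<close> forces
  \<open>Q0 a\<close>, and no extension forces any \<open>Q1 a b\<close>. Appending exactly
  \<open>Suc d\<close> elements makes the extension long enough for certificate \<open>d\<close> and
  fixes the number of universal quantifiers.\<close>

definition holds :: "struct \<Rightarrow> bool" where
  "holds S \<longleftrightarrow> (\<exists>a n c xs. c < n \<and> witness (Q0 a) c \<and> length xs = n \<and> set xs \<subseteq> univ S \<and> distinct xs \<and>
     agrees (sat_diag L S ((!) xs)) (list_decode c) \<and>
     (\<forall>b d ys. witness (Q1 a b) d \<longrightarrow> length ys = Suc d \<longrightarrow> set ys \<subseteq> univ S \<longrightarrow> distinct (xs @ ys) \<longrightarrow>
       \<not> agrees (sat_diag L S ((!) (xs @ ys))) (list_decode d)))"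

text \<open>All ingredients are decidable, so \<open>ce_index\<close> supplies the indices. A
  disjunct is given by \<open>a\<close>, \<open>n\<close> and \<open>c\<close>. Its conjuncts are
  the condition for \<open>c\<close> and, for each \<open>b\<close> and \<open>d\<close> with
  \<open>witness (Q1 a b) d\<close>, a negated condition.\<close>

lemma sentence: "\<exists>\<Phi>\<in>sigma2c_sentences L. \<forall>S. sigma2_holds S \<Phi> \<longleftrightarrow> holds S"
proof -
  \<comment> \<open>\<open>w\<close> packs \<open>b\<close> and \<open>d\<close>. The components 0
    and \<open>Suc (psnd w)\<close> in front are the numbers of universally quantified
    variables.\<close>
  define Cj where "Cj a n c k w \<longleftrightarrow> k = prod_encode (0, qf_code (condition n c)) \<or>
      witness (Q1 a (pfst w)) (psnd w) \<and>
      k = prod_encode (Suc (psnd w), qf_code (Neg (condition (n + Suc (psnd w)) (psnd w))))" for a n c k w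
  have "odec (\<lambda>X y. Cj (pfst (pfst y)) (pfst (psnd (pfst y))) (psnd (psnd (pfst y))) (pfst (psnd y)) (psnd (psnd y)))"
    unfolding Cj_def qf_code.simps by (intro cintro ocomp_comp2[OF Q1])
  from ce_index[OF this] obtain q where q: "ocomp (\<lambda>X z. prog_code (q z))"
    "\<And>z. ce_set (q z) = {k. \<exists>w. Cj (pfst z) (pfst (psnd z)) (psnd (psnd z)) k w}" by metis
  \<comment> \<open>\<open>z\<close> packs \<open>a\<close>, \<open>n\<close> and \<open>c\<close>,
    so \<open>q z\<close> is the index of the conjunction belonging to them.\<close>
  define Dj where "Dj k z \<longleftrightarrow> psnd (psnd z) < pfst (psnd z) \<and> witness (Q0 (pfst z)) (psnd (psnd z)) \<and>
      k = prod_encode (pfst (psnd z), prog_code (q z))" for k z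
  have "odec (\<lambda>X y. Dj (pfst (psnd y)) (psnd (psnd y)))"
    unfolding Dj_def by (intro cintro ocomp_comp[OF Q0] ocomp_comp[OF q(1)])
  from ce_index[where R = "\<lambda>z k w. Dj k w", OF this] obtain r where r: "ce_set r = {k. \<exists>z. Dj k z}" by metis
  have cj: "(m, \<psi>) \<in> ce_conj (q (prod_encode (a, prod_encode (n, c)))) \<longleftrightarrow>
      m = 0 \<and> \<psi> = condition n c \<or>
      (\<exists>b d. witness (Q1 a b) d \<and> m = Suc d \<and> \<psi> = Neg (condition (n + Suc d) d))" for m \<psi> a n c
  proof -
    have "(\<exists>w. Cj a n c (prod_encode (m, qf_code \<psi>)) w) \<longleftrightarrow>
      m = 0 \<and> \<psi> = condition n c \<or>
      (\<exists>w. witness (Q1 a (pfst w)) (psnd w) \<and> m = Suc (psnd w) \<and>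
        \<psi> = Neg (condition (n + Suc (psnd w)) (psnd w)))"
      unfolding Cj_def by (simp only: prod_encode_eq prod.inject qf_code_eq) blast
    also have "(\<exists>w. witness (Q1 a (pfst w)) (psnd w) \<and> m = Suc (psnd w) \<and>
        \<psi> = Neg (condition (n + Suc (psnd w)) (psnd w))) \<longleftrightarrow>
      (\<exists>b d. witness (Q1 a b) d \<and> m = Suc d \<and> \<psi> = Neg (condition (n + Suc d) d))"
      by (metis pfst_prod_encode psnd_prod_encode)
    finally show ?thesis by (simp add: q(2))
  qed
  have dj: "(n, C) \<in> ce_disj r \<longleftrightarrow> (\<exists>a c. c < n \<and> witness (Q0 a) c \<and>
      C = ce_conj (q (prod_encode (a, prod_encode (n, c)))))" for n C
  proof
    assume "(n, C) \<in> ce_disj r"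
    then obtain s z where s: "C = ce_conj s" "Dj (prod_encode (n, prog_code s)) z"
      by (auto simp: in_ce_disj r)
    then have "s = q z" "pfst (psnd z) = n" using prog_code_inj by (auto simp: Dj_def)
    moreover from this have "z = prod_encode (pfst z, prod_encode (n, psnd (psnd z)))"
      by (metis prod_encode_pfst_psnd)
    ultimately show "\<exists>a c. c < n \<and> witness (Q0 a) c \<and> C = ce_conj (q (prod_encode (a, prod_encode (n, c))))"
      using s unfolding Dj_def by metis
  next
    assume "\<exists>a c. c < n \<and> witness (Q0 a) c \<and> C = ce_conj (q (prod_encode (a, prod_encode (n, c))))"
    then obtain a c where "c < n" "witness (Q0 a) c" "C = ce_conj (q (prod_encode (a, prod_encode (n, c))))"
      by blast
    then show "(n, C) \<in> ce_disj r"
      unfolding in_ce_disj r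
      by (intro exI[of _ "q (prod_encode (a, prod_encode (n, c)))"] conjI CollectI
          exI[of _ "prod_encode (a, prod_encode (n, c))"]) (auto simp: Dj_def)
  qed
  have "wf_qf L \<psi> \<and> qf_vars \<psi> \<subseteq> {..<n + m}" if C: "(n, C) \<in> ce_disj r" and m: "(m, \<psi>) \<in> C" for n C m \<psi>
  proof -
    obtain a c where ac: "c < n" "C = ce_conj (q (prod_encode (a, prod_encode (n, c))))"
      using C unfolding dj by blast
    have "condition n c = \<psi> \<and> m = 0 \<or> (\<exists>d. \<psi> = Neg (condition (n + Suc d) d) \<and> m = Suc d)"
      using m unfolding ac(2) cj by blast
    then show ?thesis
    proof (elim disjE exE conjE)
      fix d assume "\<psi> = Neg (condition (n + Suc d) d)" "m = Suc d"
      then show ?thesis using condition_vars[of d "n + Suc d"] by simp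
    qed (use condition_vars[OF ac(1)] in auto)
  qed
  then have "ce_disj r \<in> sigma2c_sentences L"
    unfolding sigma2c_sentences_def wf_sigma2_def by blast
  moreover have "sigma2_holds S (ce_disj r) \<longleftrightarrow> holds S" for S
  proof -
    have *: "(\<forall>m \<psi>. (m, \<psi>) \<in> ce_conj (q (prod_encode (a, prod_encode (n, c)))) \<longrightarrow>
          (\<forall>ys\<in>tuples S m. qf_holds S ((!) (xs @ ys)) \<psi>)) \<longleftrightarrow>
        distinct xs \<and> agrees (sat_diag L S ((!) xs)) (list_decode c) \<and>
        (\<forall>b d ys. witness (Q1 a b) d \<longrightarrow> length ys = Suc d \<longrightarrow> set ys \<subseteq> univ S \<longrightarrow> distinct (xs @ ys) \<longrightarrow>
           \<not> agrees (sat_diag L S ((!) (xs @ ys))) (list_decode d))" (is "?l \<longleftrightarrow> ?r")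
      if "length xs = n" for a n c xs
    proof -
      have "?l \<longleftrightarrow> (\<forall>ys\<in>tuples S 0. qf_holds S ((!) (xs @ ys)) (condition n c)) \<and>
        (\<forall>b d. witness (Q1 a b) d \<longrightarrow>
          (\<forall>ys\<in>tuples S (Suc d). qf_holds S ((!) (xs @ ys)) (Neg (condition (n + Suc d) d))))"
        unfolding cj by blast
      moreover have "(\<forall>ys\<in>tuples S 0. qf_holds S ((!) (xs @ ys)) (condition n c)) \<longleftrightarrow>
          distinct xs \<and> agrees (sat_diag L S ((!) xs)) (list_decode c)"
        using condition_holds[OF that] by (simp add: tuples_def)
      moreover have "(\<forall>ys\<in>tuples S (Suc d). qf_holds S ((!) (xs @ ys)) (Neg (condition (n + Suc d) d))) \<longleftrightarrow>
          (\<forall>ys. length ys = Suc d \<longrightarrow> set ys \<subseteq> univ S \<longrightarrow> distinct (xs @ ys) \<longrightarrow>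
            \<not> agrees (sat_diag L S ((!) (xs @ ys))) (list_decode d))" for d
      proof -
        have "qf_holds S ((!) (xs @ ys)) (Neg (condition (n + Suc d) d)) \<longleftrightarrow>
            (distinct (xs @ ys) \<longrightarrow> \<not> agrees (sat_diag L S ((!) (xs @ ys))) (list_decode d))"
          if "length ys = Suc d" for ys
          using condition_holds[of "xs @ ys" "n + Suc d" S d] that \<open>length xs = n\<close>
          by (simp del: distinct_append)
        then show ?thesis unfolding tuples_def by blast
      qed
      ultimately show ?thesis by blast
    qed
    have "sigma2_holds S (ce_disj r) \<longleftrightarrow> (\<exists>n a c. c < n \<and> witness (Q0 a) c \<and> (\<exists>xs\<in>tuples S n. \<forall>m \<psi>.
        (m, \<psi>) \<in> ce_conj (q (prod_encode (a, prod_encode (n, c)))) \<longrightarrow>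
          (\<forall>ys\<in>tuples S m. qf_holds S ((!) (xs @ ys)) \<psi>)))"
      unfolding sigma2_holds_iff dj by blast
    also have "\<dots> \<longleftrightarrow> (\<exists>n a c. c < n \<and> witness (Q0 a) c \<and> (\<exists>xs\<in>tuples S n.
        distinct xs \<and> agrees (sat_diag L S ((!) xs)) (list_decode c) \<and>
        (\<forall>b d ys. witness (Q1 a b) d \<longrightarrow> length ys = Suc d \<longrightarrow> set ys \<subseteq> univ S \<longrightarrow> distinct (xs @ ys) \<longrightarrow>
           \<not> agrees (sat_diag L S ((!) (xs @ ys))) (list_decode d))))"
    proof (intro arg_cong[of _ _ Ex] ext conj_cong refl bex_cong)
      fix n a c xs assume "xs \<in> tuples S n"
      then have "length xs = n" by (simp add: tuples_def)
      then show "(\<forall>m \<psi>. (m, \<psi>) \<in> ce_conj (q (prod_encode (a, prod_encode (n, c)))) \<longrightarrow>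
          (\<forall>ys\<in>tuples S m. qf_holds S ((!) (xs @ ys)) \<psi>)) \<longleftrightarrow>
        (distinct xs \<and> agrees (sat_diag L S ((!) xs)) (list_decode c) \<and>
        (\<forall>b d ys. witness (Q1 a b) d \<longrightarrow> length ys = Suc d \<longrightarrow> set ys \<subseteq> univ S \<longrightarrow> distinct (xs @ ys) \<longrightarrow>
           \<not> agrees (sat_diag L S ((!) (xs @ ys))) (list_decode d)))" by (rule *)
    qed
    also have "\<dots> \<longleftrightarrow> holds S" unfolding holds_def tuples_def by blast
    finally show ?thesis .
  qed
  ultimately show ?thesis by blast
qed

section \<open>The sentence compared with the images of copies\<close>

lemma agrees_enumeration:
  assumes "c < n"
  shows "agrees (sat_diag L S ((!) (map e [0..<n]))) (list_decode c) \<longleftrightarrow> agrees (sat_diag L S e) (list_decode c)"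
  using assms by (intro agrees_cong sat_diag_cong) auto

lemma distinct_enumeration: "bij_betw e UNIV U \<Longrightarrow> distinct xs \<Longrightarrow> distinct (map e xs)"
  by (auto simp: distinct_map bij_betw_def intro: inj_on_subset)

text \<open>Any full enumeration that extends \<open>xs\<close> gives a copy whose image contains
  \<open>Q0 a\<close>, hence some \<open>Q1 a b\<close>. The certificate for the latter reads only
  an initial segment, which is one of the forbidden extensions.\<close>

lemma holds_false:
  assumes "is_structure L S" "infinite (univ S)"
    and Y: "\<And>T. T \<in> copies L S \<Longrightarrow> \<exists>Y. computes_set p (diagram L T) Y \<and> (\<forall>a. Q0 a \<in> Y \<longrightarrow> (\<exists>b. Q1 a b \<in> Y))"
  shows "\<not> holds S"
proof
  assume "holds S"
  then obtain a n c xs where *: "c < n" "witness (Q0 a) c" "length xs = n" "set xs \<subseteq> univ S" "distinct xs"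
    "agrees (sat_diag L S ((!) xs)) (list_decode c)"
    and no: "\<And>b d ys. witness (Q1 a b) d \<Longrightarrow> length ys = Suc d \<Longrightarrow> set ys \<subseteq> univ S \<Longrightarrow> distinct (xs @ ys) \<Longrightarrow>
       \<not> agrees (sat_diag L S ((!) (xs @ ys))) (list_decode d)"
    unfolding holds_def by blast
  obtain e where e: "bij_betw e UNIV (univ S)" "\<And>i. i < length xs \<Longrightarrow> e i = xs ! i"
    using enumeration_extends[OF assms(2) *(5,4)] by blast
  have xs: "map e [0..<n] = xs" by (rule nth_equalityI) (auto simp: *(3) e(2))
  obtain Y where Y: "computes_set p (sat_diag L S e) Y" "\<forall>a. Q0 a \<in> Y \<longrightarrow> (\<exists>b. Q1 a b \<in> Y)"
    using Y[OF pull_copies[OF assms(1) e(1)]] diagram_pull[OF assms(1) e(1)] by auto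
  have "Q0 a \<in> Y"
    using witness_sound[OF *(2) _ Y(1)] agrees_enumeration[OF *(1), of S e] *(6) xs by simp
  then obtain b where "Q1 a b \<in> Y" using Y(2) by blast
  then obtain d where d: "witness (Q1 a b) d" "agrees (sat_diag L S e) (list_decode d)"
    using witness_complete[OF Y(1)] by blast
  define ys where "ys = map e [n..<n + Suc d]"
  have app: "xs @ ys = map e [0..<n + Suc d]"
    unfolding ys_def xs[symmetric] by (metis le_add1 map_append upt_add_eq_append zero_le)
  have "agrees (sat_diag L S ((!) (xs @ ys))) (list_decode d)"
    unfolding app using d(2) by (subst agrees_enumeration) auto
  moreover have "distinct (xs @ ys)"
    unfolding app by (rule distinct_enumeration[OF e(1)]) (rule distinct_upt)
  moreover have "set ys \<subseteq> univ S" using e(1) by (auto simp: ys_def bij_betw_def)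
  ultimately show False using no[OF d(1), of ys] by (simp add: ys_def)
qed

lemma extend_part:
  assumes "infinite (univ S)" "distinct zs" "set zs \<subseteq> univ S"
  obtains ys where "length ys = n" "distinct (zs @ ys)" "set ys \<subseteq> univ S"
proof -
  obtain e where e: "bij_betw e UNIV (univ S)" "\<And>i. i < length zs \<Longrightarrow> e i = zs ! i"
    using enumeration_extends[OF assms] by blast
  have zs: "map e [0..<length zs] = zs" by (rule nth_equalityI) (auto simp: e(2))
  have "zs @ map e [length zs..<length zs + n] = map e [0..<length zs + n]"
    by (subst zs[symmetric]) (metis le_add1 map_append upt_add_eq_append zero_le)
  then have "distinct (zs @ map e [length zs..<length zs + n])"
    using distinct_enumeration[OF e(1) distinct_upt] by simp
  moreover have "set (map e [length zs..<length zs + n]) \<subseteq> univ S"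
    using e(1) by (auto simp: bij_betw_def)
  ultimately show ?thesis by (intro that[of "map e [length zs..<length zs + n]"]) auto
qed

text \<open>A generic enumeration of \<open>S\<close>: if the sentence fails then the requirements are dense, and the
  image of the resulting copy has no \<open>a\<close> with \<open>Q0 a\<close> but no \<open>Q1 a b\<close>.\<close>

lemma holds_true:
  assumes "is_structure L S" "infinite (univ S)"
    and Y: "\<And>T. T \<in> copies L S \<Longrightarrow> \<exists>Y. computes_set p (diagram L T) Y \<and> (\<exists>a. Q0 a \<in> Y \<and> (\<forall>b. Q1 a b \<notin> Y))"
  shows "holds S"
proof (rule ccontr)
  assume not: "\<not> holds S"
  define part where "part zs \<longleftrightarrow> distinct zs \<and> set zs \<subseteq> univ S" for zs
  \<comment> \<open>Requirement \<open>a\<close>: either \<open>zs\<close> already forces some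
    \<open>Q1 a b\<close>, or no extension of \<open>zs\<close> forces \<open>Q0 a\<close>.\<close>
  define req where "req a zs \<longleftrightarrow>
      (\<exists>b d. d < length zs \<and> witness (Q1 a b) d \<and> agrees (sat_diag L S ((!) zs)) (list_decode d)) \<or>
      (\<forall>c ys. part (zs @ ys) \<longrightarrow> c < length (zs @ ys) \<longrightarrow> witness (Q0 a) c \<longrightarrow>
        \<not> agrees (sat_diag L S ((!) (zs @ ys))) (list_decode c))" for a zs
  have dense: "\<exists>ys. part (zs @ ys) \<and> req a (zs @ ys)" if zs: "part zs" for a zs
  \<comment> \<open>If some extension forces \<open>Q0 a\<close>, the failure of the sentence at
    that extension yields a further one that forces some \<open>Q1 a b\<close>.\<close>
  proof (cases "\<exists>c ys. part (zs @ ys) \<and> c < length (zs @ ys) \<and> witness (Q0 a) c \<and>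
        agrees (sat_diag L S ((!) (zs @ ys))) (list_decode c)")
    case True
    then obtain c ys where *: "part (zs @ ys)" "c < length (zs @ ys)" "witness (Q0 a) c"
      "agrees (sat_diag L S ((!) (zs @ ys))) (list_decode c)" by blast
    obtain b d us where "witness (Q1 a b) d" "length us = Suc d" "set us \<subseteq> univ S"
      "distinct ((zs @ ys) @ us)" "agrees (sat_diag L S ((!) ((zs @ ys) @ us))) (list_decode d)"
      using not * unfolding holds_def part_def by blast
    then have "part (zs @ ys @ us) \<and> req a (zs @ ys @ us)"
      using * unfolding req_def part_def by auto
    then show ?thesis by blast
  next
    case False
    then have "req a (zs @ [])" unfolding req_def by auto
    then show ?thesis using zs by (intro exI[of _ "[]"]) simp
  qed
  have step: "\<exists>zs'. part zs' \<and> (\<exists>ys. zs' = zs @ ys) \<and> i < length zs' \<and> req i zs' \<and>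
      (i \<in> univ S \<longrightarrow> i \<in> set zs')" if zs: "part zs" for zs i
  proof -
    \<comment> \<open>\<open>us\<close> lists the element \<open>i\<close> if \<open>S\<close> has
      it, \<open>vs\<close> provides the length, and \<open>ws\<close> meets requirement
      \<open>i\<close> by density.\<close>
    obtain us where us: "part (zs @ us)" "i \<in> univ S \<longrightarrow> i \<in> set (zs @ us)"
    proof (cases "i \<in> univ S \<and> i \<notin> set zs")
      case True
      then show ?thesis using zs that[of "[i]"] by (auto simp: part_def)
    next
      case False
      then show ?thesis using zs that[of "[]"] by auto
    qed
    obtain vs where vs: "length vs = Suc i" "distinct ((zs @ us) @ vs)" "set vs \<subseteq> univ S"
      using extend_part[OF assms(2)] us(1) unfolding part_def by metis
    then have "part (zs @ us @ vs)" using us by (auto simp: part_def)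
    then obtain ws where "part ((zs @ us @ vs) @ ws)" "req i ((zs @ us @ vs) @ ws)" using dense by blast
    then show ?thesis using us(2) vs(1) by (intro exI[of _ "(zs @ us @ vs) @ ws"]) auto
  qed
  have "\<exists>f. \<forall>i. part (f i) \<and> (\<exists>ys. f (Suc i) = f i @ ys) \<and> i < length (f (Suc i)) \<and> req i (f (Suc i)) \<and>
      (i \<in> univ S \<longrightarrow> i \<in> set (f (Suc i)))"
  proof -
    have "\<exists>f. \<forall>i. part (f i) \<and> ((\<exists>ys. f (Suc i) = f i @ ys) \<and> i < length (f (Suc i)) \<and> req i (f (Suc i)) \<and>
      (i \<in> univ S \<longrightarrow> i \<in> set (f (Suc i))))"
    proof (rule dependent_nat_choice)
      show "\<exists>x. part x" by (intro exI[of _ "[]"]) (simp add: part_def)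
    qed (use step in blast)
    then show ?thesis by blast
  qed
  then obtain f where f: "\<And>i. part (f i)" "\<And>i. \<exists>ys. f (Suc i) = f i @ ys" "\<And>i. i < length (f (Suc i))"
    "\<And>i. req i (f (Suc i))" "\<And>i. i \<in> univ S \<Longrightarrow> i \<in> set (f (Suc i))" by metis
  have ext: "\<exists>ys. f j = f i @ ys" if "i \<le> j" for i j
    using that
  proof (induction j rule: dec_induct)
    case (step j)
    then show ?case using f(2)[of j] by auto
  qed simp
  define e where "e i = f (Suc i) ! i" for i
  have e: "f i ! k = e k" if "k < length (f i)" for i k
  proof -
    obtain ys us where "f (max i (Suc k)) = f i @ ys" "f (max i (Suc k)) = f (Suc k) @ us"
      using ext[of i "max i (Suc k)"] ext[of "Suc k" "max i (Suc k)"] by auto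
    then have "(f i @ ys) ! k = (f (Suc k) @ us) ! k" by simp
    then show ?thesis using that f(3)[of k] by (simp add: e_def nth_append)
  qed
  have f_e: "f i = map e [0..<length (f i)]" for i
    by (rule nth_equalityI) (auto simp: e)
  have "inj e"
  proof (rule injI)
    fix i j assume ij: "e i = e j"
    let ?k = "Suc (max i j)"
    have "length (f m) \<le> length (f n)" if "m \<le> n" for m n
      using ext[OF that] by auto
    then have "length (f (Suc i)) \<le> length (f ?k)" "length (f (Suc j)) \<le> length (f ?k)" by simp_all
    then have "i < length (f ?k)" "j < length (f ?k)" using f(3)[of i] f(3)[of j] by linarith+
    then show "i = j" using ij e[of i ?k] e[of j ?k] f(1)[of ?k]
        nth_eq_iff_index_eq[of "f ?k" i j] by (simp add: part_def)
  qed
  moreover have "e i \<in> univ S" for i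
    using f(1)[of "Suc i"] f(3)[of i] unfolding e_def part_def by (meson nth_mem subsetD)
  moreover have "x \<in> range e" if x: "x \<in> univ S" for x
    using f(5)[OF x] by (subst (asm) f_e) auto
  ultimately have bij: "bij_betw e UNIV (univ S)" by (auto simp: bij_betw_def)
  obtain Y a where Y: "computes_set p (sat_diag L S e) Y" and a: "Q0 a \<in> Y" "\<forall>b. Q1 a b \<notin> Y"
    using Y[OF pull_copies[OF assms(1) bij]] diagram_pull[OF assms(1) bij] by auto
  let ?n = "length (f (Suc a))"
  \<comment> \<open>Requirement \<open>a\<close> was met. The first alternative puts some
    \<open>Q1 a b\<close> into the image; the second contradicts the certificate for
    \<open>Q0 a\<close> that \<open>e\<close> itself provides.\<close>
  show False
    using f(4)[of a] unfolding req_def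
  proof (elim disjE exE conjE)
    fix b d assume d: "d < ?n" "witness (Q1 a b) d" "agrees (sat_diag L S ((!) (f (Suc a)))) (list_decode d)"
    have "agrees (sat_diag L S e) (list_decode d)"
      using d(3) agrees_enumeration[OF d(1), of S e] f_e[of "Suc a"] by simp
    then show False using witness_sound[OF d(2) _ Y] a(2) by blast
  next
    assume no: "\<forall>c ys. part (f (Suc a) @ ys) \<longrightarrow> c < length (f (Suc a) @ ys) \<longrightarrow> witness (Q0 a) c \<longrightarrow>
        \<not> agrees (sat_diag L S ((!) (f (Suc a) @ ys))) (list_decode c)"
    obtain c where c: "witness (Q0 a) c" "agrees (sat_diag L S e) (list_decode c)"
      using witness_complete[OF Y a(1)] by blast
    \<comment> \<open>Initial segments are prolonged until they have more than \<open>c\<close>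
      elements.\<close>
    define ys where "ys = map e [?n..<?n + Suc c]"
    have app: "f (Suc a) @ ys = map e [0..<?n + Suc c]"
      unfolding ys_def by (subst (1) f_e) (metis le_add1 map_append upt_add_eq_append zero_le)
    have "part (f (Suc a) @ ys)"
      unfolding app part_def using distinct_enumeration[OF bij distinct_upt, of 0 "?n + Suc c"] bij
      by (intro conjI) (auto simp: bij_betw_def)
    moreover have "agrees (sat_diag L S ((!) (f (Suc a) @ ys))) (list_decode c)"
      unfolding app using c(2) by (subst agrees_enumeration) auto
    moreover have "c < length (f (Suc a) @ ys)" by (simp add: ys_def)
    ultimately show False using no c(1) by blast
  qed
qed

end

section \<open>Separation in both directions and the equivalence\<close>

lemma order_copies_orientation:
  assumes "T \<in> copies order_lang (if d then omega else omega_star)"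
  obtains h :: "nat \<Rightarrow> nat" where "bij_betw h (univ T) UNIV"
    "\<And>a b. a \<in> univ T \<Longrightarrow> b \<in> univ T \<Longrightarrow> rel_int T 0 (if d then [a, b] else [b, a]) \<longleftrightarrow> h a \<le> h b"
proof -
  obtain h :: "nat \<Rightarrow> nat" where "bij_betw h (univ T) UNIV"
    "\<forall>a\<in>univ T. \<forall>b\<in>univ T. rel_int T 0 [a, b] \<longleftrightarrow> (if d then h a \<le> h b else h b \<le> h a)"
    using assms by (cases d) (auto simp: copies_def isomorphic_order omega_def omega_star_def)
  then show ?thesis by (intro that[of h]) auto
qed

lemma sigma2_separates:
  assumes "is_structure L A" "is_structure L B" "infinite (univ A)" "infinite (univ B)"
    and "computably_presentable L A"
    and A: "\<And>S. S \<in> copies L A \<Longrightarrow> \<exists>T\<in>copies order_lang (if d then omega else omega_star).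
      computes_set p (diagram L S) (diagram order_lang T)"
    and B: "\<And>S. S \<in> copies L B \<Longrightarrow> \<exists>T\<in>copies order_lang (if \<not> d then omega else omega_star).
      computes_set p (diagram L S) (diagram order_lang T)"
  shows "sigma2c_Th L A - sigma2c_Th L B \<noteq> {}"
proof -
  obtain R where R: "R \<in> copies L A" "computable_set (diagram L R)"
    using assms(5) by (auto simp: computably_presentable_def)
  then obtain u where u: "u \<in> univ R"
    using copies_infinite[OF R(1) assms(3)] by (metis ex_in_conv finite.emptyI)
  define Q0 where "Q0 a = qf_code (Eq (Var a) (Var a))" for a
  \<comment> \<open>\<open>Q1 a b\<close> says that \<open>b\<close> lies strictly below
    \<open>a\<close> if \<open>d\<close> holds, and strictly above \<open>a\<close> otherwise: on
    the side where the image of \<open>A\<close> comes to an end.\<close>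
  define Q1 where "Q1 a b = qf_code (Neg (Rel 0 (if d then [Var a, Var b] else [Var b, Var a])))" for a b
  have Q1_iff: "Q1 a b \<in> diagram order_lang T \<longleftrightarrow>
      a \<in> univ T \<and> b \<in> univ T \<and> \<not> rel_int T 0 (if d then [a, b] else [b, a])" for a b T
    by (auto simp: Q1_def diagram_def image_iff order_lang_def simp del: qf_code.simps)
  interpret pull_back L p "diagram L R" R u Q0 Q1
  proof
    show "ocomp (\<lambda>X. Q0)"
      unfolding Q0_def qf_code.simps tm_code.simps by (intro cintro)
    show "ocomp (\<lambda>X z. Q1 (pfst z) (psnd z))"
      unfolding Q1_def qf_code.simps tm_code.simps by (cases d; simp; intro cintro)
  qed (use R u in auto)
  obtain \<Phi> where \<Phi>: "\<Phi> \<in> sigma2c_sentences L" "\<And>S. sigma2_holds S \<Phi> \<longleftrightarrow> holds S"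
    using sentence by blast
  have "holds A"
  proof (rule holds_true[OF assms(1,3)])
    fix S assume "S \<in> copies L A"
    then obtain T where T: "T \<in> copies order_lang (if d then omega else omega_star)"
      "computes_set p (diagram L S) (diagram order_lang T)" using A by blast
    obtain h :: "nat \<Rightarrow> nat" where h: "bij_betw h (univ T) UNIV"
      "\<And>a b. a \<in> univ T \<Longrightarrow> b \<in> univ T \<Longrightarrow> rel_int T 0 (if d then [a, b] else [b, a]) \<longleftrightarrow> h a \<le> h b"
      using order_copies_orientation[OF T(1)] by blast
    obtain a where a: "a \<in> univ T" "h a = 0" using h(1) by (metis UNIV_I bij_betw_iff_bijections)
    have "Q1 a b \<notin> diagram order_lang T" for b
      using h(2)[OF a(1), of b] a(2) Q1_iff[of a b T] by auto
    moreover have "Q0 a \<in> diagram order_lang T"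
      unfolding Q0_def diagram_univ by (rule a(1))
    ultimately show "\<exists>Y. computes_set p (diagram L S) Y \<and> (\<exists>a. Q0 a \<in> Y \<and> (\<forall>b. Q1 a b \<notin> Y))"
      using T(2) by blast
  qed
  moreover have "\<not> holds B"
  proof (rule holds_false[OF assms(2,4)])
    fix S assume "S \<in> copies L B"
    then obtain T where T: "T \<in> copies order_lang (if \<not> d then omega else omega_star)"
      "computes_set p (diagram L S) (diagram order_lang T)" using B by blast
    obtain h :: "nat \<Rightarrow> nat" where h: "bij_betw h (univ T) UNIV"
      "\<And>a b. a \<in> univ T \<Longrightarrow> b \<in> univ T \<Longrightarrow> rel_int T 0 (if \<not> d then [a, b] else [b, a]) \<longleftrightarrow> h a \<le> h b"
      using order_copies_orientation[OF T(1)] by blast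
    have "\<exists>b. Q1 a b \<in> diagram order_lang T" if a: "a \<in> univ T" for a
    proof -
      \<comment> \<open>The image of \<open>B\<close> is oriented the other way, so the next
        position under \<open>h\<close> lies on the side asked for by \<open>Q1\<close>.\<close>
      obtain b where b: "b \<in> univ T" "h b = Suc (h a)" using h(1) by (metis UNIV_I bij_betw_iff_bijections)
      have "\<not> rel_int T 0 (if d then [a, b] else [b, a])"
        using h(2)[OF b(1) a] b(2) by (cases d) simp_all
      then show ?thesis using a b(1) Q1_iff by blast
    qed
    then have "\<forall>a. Q0 a \<in> diagram order_lang T \<longrightarrow> (\<exists>b. Q1 a b \<in> diagram order_lang T)"
      unfolding Q0_def diagram_univ by blast
    then show "\<exists>Y. computes_set p (diagram L S) Y \<and> (\<forall>a. Q0 a \<in> Y \<longrightarrow> (\<exists>b. Q1 a b \<in> Y))"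
      using T(2) by blast
  qed
  ultimately show ?thesis using \<Phi> by (auto simp: sigma2c_Th_def)
qed

theorem theorem3p1:
  fixes L :: lang and A B :: struct
  assumes "computable_lang L"
    and "is_structure L A" and "is_structure L B"
    and "infinite (univ A)" and "infinite (univ B)"
    and "\<not> isomorphic L A B"
  shows "tc_equiv L (pair_class L A B) order_lang (pair_class order_lang omega omega_star) \<longleftrightarrow>
    computably_presentable L A \<and> computably_presentable L B \<and> equiv1 L A B \<and>
    sigma2c_Th L A - sigma2c_Th L B \<noteq> {} \<and> sigma2c_Th L B - sigma2c_Th L A \<noteq> {}"
proof
  assume equiv: "tc_equiv L (pair_class L A B) order_lang (pair_class order_lang omega omega_star)"
  then have 1: "computably_presentable L A \<and> computably_presentable L B \<and> equiv1 L A B"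
    using order_embedding assms(2,3) unfolding tc_equiv_def by blast
  have "tc_le L (pair_class L A B) order_lang (pair_class order_lang omega omega_star)"
    using equiv by (simp add: tc_equiv_def)
  then obtain p C D where CD: "C = omega \<and> D = omega_star \<or> C = omega_star \<and> D = omega"
    and p: "\<And>S. S \<in> copies L A \<Longrightarrow> \<exists>T\<in>copies order_lang C. computes_set p (diagram L S) (diagram order_lang T)"
      "\<And>S. S \<in> copies L B \<Longrightarrow> \<exists>T\<in>copies order_lang D. computes_set p (diagram L S) (diagram order_lang T)"
    by (rule tc_leE[OF _ assms(2,3) is_structure_order is_structure_order assms(6)]) blast
  \<comment> \<open>The flag records which of the two orders is the image of
    \<open>A\<close>.\<close>
  obtain d where d: "C = (if d then omega else omega_star)" "D = (if \<not> d then omega else omega_star)"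
    using CD that[of True] that[of False] by auto
  have "sigma2c_Th L A - sigma2c_Th L B \<noteq> {}"
    using sigma2_separates[of L A B d p] assms(2-5) 1 p unfolding d by blast
  moreover have "sigma2c_Th L B - sigma2c_Th L A \<noteq> {}"
    \<comment> \<open>Exchanging the structures reverses the orientation, while the operator
      \<open>p\<close> stays the same.\<close>
    using sigma2_separates[of L B A "\<not> d" p] assms(2-5) 1 p unfolding d by simp
  ultimately show "computably_presentable L A \<and> computably_presentable L B \<and> equiv1 L A B \<and>
    sigma2c_Th L A - sigma2c_Th L B \<noteq> {} \<and> sigma2c_Th L B - sigma2c_Th L A \<noteq> {}"
    using 1 by blast
next
  assume "computably_presentable L A \<and> computably_presentable L B \<and> equiv1 L A B \<and>
    sigma2c_Th L A - sigma2c_Th L B \<noteq> {} \<and> sigma2c_Th L B - sigma2c_Th L A \<noteq> {}"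
  then show "tc_equiv L (pair_class L A B) order_lang (pair_class order_lang omega omega_star)"
    using order_tc_le sigma2_tc_le assms(2-6) by (simp add: tc_equiv_def)
qed

end
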